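(* With $\mathfrak g=\mathfrak{sl}(3,\mathbb C)$, $\mathfrak k$, $\mathfrak p$, $K=S(U(2)\times U(1))$ and the elements $\tilde e,\tilde f,\tilde g,\tilde h,\tilde i,\tilde j$ as defined in the context, the algebra $(U(\mathfrak g)\otimes C(\mathfrak p))^K$ is a free module over $U(\mathfrak g)^K$ (acting by left multiplication by $U(\mathfrak g)^K\otimes 1$) of rank $16$, and the elements of the set $$\tilde T=\{1,\tilde e,\tilde f,\tilde g,\tilde h,\tilde i,\tilde j,\tilde e\tilde f,\tilde e\tilde g,\tilde f\tilde g,\tilde g^2,\tilde e\tilde i,\tilde e\tilde j,\tilde f\tilde h,\tilde f\tilde i,\tilde f\tilde j\}$$ form a basis of this free module.
   Context: Let $e_{ij}$ be the $3\times 3$ matrix units. The Lie algebra $\mathfrak g=\mathfrak{sl}(3,\mathbb C)$ has basis $H_1=\frac13(2e_{11}-e_{22}-e_{33})$, $H_2=\frac13(-e_{11}+2e_{22}-e_{33})$, $E=e_{12}$, $F=e_{21}$, $E_1=e_{13}$, $E_2=e_{23}$, $F_1=e_{31}$, $F_2=e_{32}$; put $H=H_1-H_2$. Let $\mathfrak k=\mathrm{span}\{H_1,H_2,E,F\}\cong\mathfrak{gl}(2,\mathbb C)$ and $\mathfrak p=\mathrm{span}\{E_1,E_2,F_1,F_2\}$. $K=S(U(2)\times U(1))$ is the (connected) maximal compact subgroup of $SU(2,1)$ consisting of block-diagonal matrices, with complexified Lie algebra $\mathfrak k$. $U(\mathfrak g)$ is the universal enveloping algebra. $C(\mathfrak p)$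 is the Clifford algebra of $\mathfrak p$ with respect to the trace form $B(X,Y)=\mathrm{tr}(XY)$, with the convention $xy+yx=-2B(x,y)$ for $x,y\in\mathfrak p$. $U(\mathfrak g)\otimes C(\mathfrak p)$ is the tensor product algebra, on which $K$ acts by $\mathrm{Ad}\otimes\mathrm{Ad}$; the superscript $K$ denotes the subalgebra of $K$-invariants. $U(\mathfrak g)^K$ is identified with $U(\mathfrak g)^K\otimes 1$. The following $K$-invariant elements of $U(\mathfrak g)\otimes C(\mathfrak p)$ are used: - $\tilde e=F_1\otimes E_1+F_2\otimes E_2$, - $\tilde f=E_1\otimes F_1+E_2\otimes F_2$, - $\tilde g=1\otimes(E_1F_1+E_2F_2)$, - $\tilde h=(2EE_2+HE_1)\otimes F_1+(-HE_2+2FE_1)\otimes F_2$, - $\tilde i=2E\otimes E_2F_1+H\otimes E_1F_1-H\otimes E_2F_2+2F\otimes E_1F_2$, - $\tilde j=(HF_1+2FF_2)\otimes E_1+(2EF_1-HF_2)\otimes E_2$. *)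

theory Defs
  imports "HOL-Analysis.Analysis" "HOL-Library.Poly_Mapping"
begin

section \<open>Associative unital complex algebras, quotients and free modules\<close>

text \<open>
  The class only requires \<open>ring + monoid_mult\<close> and not \<open>ring_1\<close>, since the latter contains
  \<open>0 \<noteq> 1\<close>, which for algebras given by generators and relations is a theorem and not part of
  the construction.
\<close>

class complex_algebra = ring + monoid_mult +
  fixes cscale :: "complex \<Rightarrow> 'a \<Rightarrow> 'a"  (infixr \<open>*\<^sub>C\<close> 75)
  assumes cscale_add_right: "z *\<^sub>C (x + y) = z *\<^sub>C x + z *\<^sub>C y"
    and cscale_add_left: "(z + w) *\<^sub>C x = z *\<^sub>C x + w *\<^sub>C x"
    and cscale_cscale: "z *\<^sub>C w *\<^sub>C x = (z * w) *\<^sub>C x"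
    and cscale_one: "1 *\<^sub>C x = x"
    and cscale_mult_left: "(z *\<^sub>C x) * y = z *\<^sub>C (x * y)"
    and cscale_mult_right: "x * (z *\<^sub>C y) = z *\<^sub>C (x * y)"

text \<open>
  All algebras below are quotients of a monoid algebra \<open>'m \<Rightarrow>\<^sub>0 complex\<close>, the monoid being
  written additively because this is the convention of \<open>Poly_Mapping\<close>.
\<close>

abbreviation basis_vec :: "'m \<Rightarrow> 'm \<Rightarrow>\<^sub>0 complex" where
  "basis_vec m \<equiv> Poly_Mapping.single m 1"

definition pm_scale :: "complex \<Rightarrow> ('m::monoid_add \<Rightarrow>\<^sub>0 complex) \<Rightarrow> ('m \<Rightarrow>\<^sub>0 complex)" where
  "pm_scale z x = Poly_Mapping.single 0 z * x"

inductive_set ideal_gen :: "'r::ring_1 set \<Rightarrow> 'r set" for S :: "'r set" where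
  zero: "0 \<in> ideal_gen S"
| step: "s \<in> S \<Longrightarrow> x \<in> ideal_gen S \<Longrightarrow> a * s * b + x \<in> ideal_gen S"

definition qcong :: "'r::ring_1 set \<Rightarrow> 'r \<Rightarrow> 'r \<Rightarrow> bool" where
  "qcong S x y \<longleftrightarrow> x - y \<in> ideal_gen S"

text \<open>The linear extension of a map of bases (push-forward of finitely supported functions).\<close>

definition push :: "('m \<Rightarrow> 'n) \<Rightarrow> ('m \<Rightarrow>\<^sub>0 complex) \<Rightarrow> ('n \<Rightarrow>\<^sub>0 complex)" where
  "push f x = (\<Sum>m\<in>Poly_Mapping.keys x. Poly_Mapping.single (f m) (Poly_Mapping.lookup x m))"

definition unital_subring :: "'r::{ring, monoid_mult} set \<Rightarrow> bool" where
  "unital_subring R \<longleftrightarrow> 1 \<in> R \<and> (\<forall>r\<in>R. \<forall>s\<in>R. r - s \<in> R \<and> r * s \<in> R)"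

definition left_module_on ::
  "'r::{ring, monoid_mult} set \<Rightarrow> ('r \<Rightarrow> 'm \<Rightarrow> 'm) \<Rightarrow> 'm::ab_group_add set \<Rightarrow> bool" where
  "left_module_on R act M \<longleftrightarrow>
     unital_subring R \<and>
     0 \<in> M \<and> (\<forall>x\<in>M. \<forall>y\<in>M. x - y \<in> M) \<and>
     (\<forall>r\<in>R. \<forall>x\<in>M. act r x \<in> M) \<and>
     (\<forall>r\<in>R. \<forall>x\<in>M. \<forall>y\<in>M. act r (x + y) = act r x + act r y) \<and>
     (\<forall>r\<in>R. \<forall>s\<in>R. \<forall>x\<in>M. act (r + s) x = act r x + act s x) \<and>
     (\<forall>r\<in>R. \<forall>s\<in>R. \<forall>x\<in>M. act (r * s) x = act r (act s x)) \<and>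
     (\<forall>x\<in>M. act 1 x = x)"

definition left_module_basis ::
  "'r::{ring, monoid_mult} set \<Rightarrow> ('r \<Rightarrow> 'm \<Rightarrow> 'm) \<Rightarrow> 'm::ab_group_add set \<Rightarrow> 'm set \<Rightarrow> bool" where
  "left_module_basis R act M B \<longleftrightarrow>
     B \<subseteq> M \<and>
     (\<forall>x\<in>M. \<exists>S c. finite S \<and> S \<subseteq> B \<and> (\<forall>b\<in>S. c b \<in> R) \<and> x = (\<Sum>b\<in>S. act (c b) b)) \<and>
     (\<forall>S c. finite S \<and> S \<subseteq> B \<and> (\<forall>b\<in>S. c b \<in> R) \<and> (\<Sum>b\<in>S. act (c b) b) = 0
        \<longrightarrow> (\<forall>b\<in>S. c b = 0))"

definition free_left_module_of_rank ::
  "'r::{ring, monoid_mult} set \<Rightarrow> ('r \<Rightarrow> 'm \<Rightarrow> 'm) \<Rightarrow> 'm::ab_group_add set \<Rightarrow> nat \<Rightarrow> bool" where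
  "free_left_module_of_rank R act M n \<longleftrightarrow>
     left_module_on R act M \<and> (\<exists>B. left_module_basis R act M B \<and> finite B \<and> card B = n)"


subsection \<open>Auxiliary facts\<close>

lemma ideal_gen_gen: "s \<in> S \<Longrightarrow> s \<in> ideal_gen S"
  using ideal_gen.step[OF _ ideal_gen.zero, of s S 1 1] by simp

lemma ideal_gen_add: "x \<in> ideal_gen S \<Longrightarrow> y \<in> ideal_gen S \<Longrightarrow> x + y \<in> ideal_gen S"
  by (induction rule: ideal_gen.induct) (auto simp: add.assoc intro: ideal_gen.step)

lemma ideal_gen_mult_left: "x \<in> ideal_gen S \<Longrightarrow> c * x \<in> ideal_gen S"
proof (induction rule: ideal_gen.induct)
  case (step s x a b)
  then show ?case using ideal_gen.step[of s S "c * x" "c * a" b] by (simp add: algebra_simps)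
qed (simp add: ideal_gen.zero)

lemma ideal_gen_mult_right: "x \<in> ideal_gen S \<Longrightarrow> x * c \<in> ideal_gen S"
proof (induction rule: ideal_gen.induct)
  case (step s x a b)
  then show ?case using ideal_gen.step[of s S "x * c" a "b * c"] by (simp add: algebra_simps)
qed (simp add: ideal_gen.zero)

lemma ideal_gen_uminus: "x \<in> ideal_gen S \<Longrightarrow> - x \<in> ideal_gen S"
  using ideal_gen_mult_left[of x S "- 1"] by simp

lemma qcong_eqI: "x = y \<Longrightarrow> qcong S x y"
  by (simp add: qcong_def ideal_gen.zero)

lemma qcong_sym: "qcong S x y \<Longrightarrow> qcong S y x"
  using ideal_gen_uminus[of "x - y" S] by (simp add: qcong_def)

lemma qcong_trans: "qcong S x y \<Longrightarrow> qcong S y z \<Longrightarrow> qcong S x z"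
  using ideal_gen_add[of "x - y" S "y - z"] by (simp add: qcong_def)

lemma equivp_qcong: "equivp (qcong S)"
  by (rule equivpI) (auto simp: reflp_def symp_def transp_def intro: qcong_eqI qcong_sym qcong_trans)

lemma qcong_add: "qcong S x y \<Longrightarrow> qcong S x' y' \<Longrightarrow> qcong S (x + x') (y + y')"
  using ideal_gen_add[of "x - y" S "x' - y'"] by (simp add: qcong_def algebra_simps)

lemma qcong_uminus: "qcong S x y \<Longrightarrow> qcong S (- x) (- y)"
  using ideal_gen_uminus[of "x - y" S] by (simp add: qcong_def algebra_simps)

lemma qcong_diff: "qcong S x y \<Longrightarrow> qcong S x' y' \<Longrightarrow> qcong S (x - x') (y - y')"
  using qcong_add[OF _ qcong_uminus, of S x y x' y'] by simp

lemma qcong_mult: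
  assumes "qcong S x y" "qcong S x' y'" shows "qcong S (x * x') (y * y')"
proof -
  have "(x - y) * x' + y * (x' - y') \<in> ideal_gen S"
    using assms by (auto simp: qcong_def intro: ideal_gen_add ideal_gen_mult_left ideal_gen_mult_right)
  then show ?thesis by (simp add: qcong_def algebra_simps)
qed

lemma qcong_pm_scale: "qcong S x y \<Longrightarrow> qcong S (pm_scale z x) (pm_scale z y)"
  unfolding pm_scale_def by (rule qcong_mult[OF qcong_eqI]) auto

lemma pm_induct [case_names zero single add]:
  fixes x :: "'m \<Rightarrow>\<^sub>0 'c::comm_monoid_add"
  assumes z: "P 0" and s: "\<And>m c. P (Poly_Mapping.single m c)"
    and a: "\<And>x y. P x \<Longrightarrow> P y \<Longrightarrow> P (x + y)"
  shows "P x"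
proof (induction x rule: update_induct)
  case (update f m c)
  have "Poly_Mapping.update m c f = f + Poly_Mapping.single m c"
    using update(1)
    by (intro poly_mapping_eqI)
       (auto simp: lookup_update lookup_add lookup_single when_def in_keys_iff)
  then show ?case using update s a by simp
qed (rule z)

lemma push_superset:
  assumes "finite A" "Poly_Mapping.keys x \<subseteq> A"
  shows "push f x = (\<Sum>m\<in>A. Poly_Mapping.single (f m) (Poly_Mapping.lookup x m))"
  unfolding push_def by (rule sum.mono_neutral_left) (use assms in \<open>auto simp: in_keys_iff\<close>)

lemma push_zero: "push f 0 = 0"
  by (simp add: push_def)

lemma push_single: "push f (Poly_Mapping.single m z) = Poly_Mapping.single (f m) z"
  by (simp add: push_def)

lemma push_add: "push f (x + y) = push f x + push f y"
proof -
  let ?A = "Poly_Mapping.keys x \<union> Poly_Mapping.keys y"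
  have "push f (x + y) = (\<Sum>m\<in>?A. Poly_Mapping.single (f m) (Poly_Mapping.lookup (x + y) m))"
    by (rule push_superset) (use keys_add[of x y] in auto)
  also have "\<dots> = push f x + push f y"
    by (simp add: push_superset[of ?A x] push_superset[of ?A y] lookup_add single_add sum.distrib)
  finally show ?thesis .
qed

lemma push_uminus: "push f (- x) = - push f x"
  using push_add[of f x "- x"] by (simp add: push_zero minus_unique)

lemma push_diff: "push f (x - y) = push f x - push f y"
  using push_add[of f x "- y"] by (simp add: push_uminus)

lemma push_mult:
  assumes hom: "\<And>m n. f (m + n) = f m + f n"
  shows "push f (x * y) = push f x * push f y"
proof (induction x rule: pm_induct)
  case (single m c)
  show ?case
    by (induction y rule: pm_induct)
       (simp_all add: push_zero push_single push_add mult_single hom algebra_simps)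
qed (simp_all add: push_zero push_add algebra_simps)

lemma push_ideal_gen:
  assumes hom: "\<And>m n. f (m + n) = f m + f n"
    and S: "\<And>s. s \<in> S \<Longrightarrow> push f s \<in> ideal_gen S'"
    and x: "x \<in> ideal_gen S"
  shows "push f x \<in> ideal_gen S'"
  using x
  by (induction rule: ideal_gen.induct)
     (auto simp: push_zero push_add push_mult[of f, OF hom]
       intro: ideal_gen.zero ideal_gen_add ideal_gen_mult_left ideal_gen_mult_right S)

lemma push_qcong:
  assumes "\<And>m n. f (m + n) = f m + f n"
    and "\<And>s. s \<in> S \<Longrightarrow> push f s \<in> ideal_gen S'"
    and "qcong S x y"
  shows "qcong S' (push f x) (push f y)"
  using push_ideal_gen[of f S S' "x - y"] assms by (simp add: qcong_def push_diff)

lemma push_pm_scale: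
  assumes "\<And>m n. f (m + n) = f m + f n" "f 0 = 0"
  shows "push f (pm_scale z x) = pm_scale z (push f x)"
  by (simp add: pm_scale_def push_mult[of f, OF assms(1)] push_single assms(2))

lemma pm_scale_commute: "x * pm_scale z y = pm_scale z (x * y)"
proof -
  have "x * Poly_Mapping.single 0 z = Poly_Mapping.single 0 z * x"
    by (induction x rule: pm_induct) (simp_all add: mult_single algebra_simps)
  then show ?thesis by (simp add: pm_scale_def mult.assoc[symmetric])
qed

lemma pm_scale_simps:
  "pm_scale z (x + y) = pm_scale z x + pm_scale z y"
  "pm_scale (z + w) x = pm_scale z x + pm_scale w x"
  "pm_scale z (pm_scale w x) = pm_scale (z * w) x"
  "pm_scale 1 x = x"
  "pm_scale z x * y = pm_scale z (x * y)"
  by (simp_all add: pm_scale_def distrib_left distrib_right single_add mult_single flip: mult.assoc)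

lemma pm_scale_single:
  "pm_scale z (Poly_Mapping.single m w) = Poly_Mapping.single m (z * w)"
  by (simp add: pm_scale_def mult_single)


section \<open>The free monoid\<close>

datatype 'a word = Word "'a list"

fun word_map :: "('a \<Rightarrow> 'b) \<Rightarrow> 'a word \<Rightarrow> 'b word" where
  "word_map f (Word xs) = Word (map f xs)"

instantiation word :: (type) monoid_add
begin

definition zero_word :: "'a word" where "zero_word = Word []"

fun plus_word :: "'a word \<Rightarrow> 'a word \<Rightarrow> 'a word" where
  "plus_word (Word xs) (Word ys) = Word (xs @ ys)"

instance
proof
  fix a b c :: "'a word"
  show "a + b + c = a + (b + c)" by (cases a; cases b; cases c) simp
  show "0 + a = a" by (cases a) (simp add: zero_word_def)
  show "a + 0 = a" by (cases a) (simp add: zero_word_def)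
qed

end

lemma word_map_plus: "word_map f (v + w) = word_map f v + word_map f w"
  by (cases v; cases w) simp

lemma word_map_zero: "word_map f 0 = 0"
  by (simp add: zero_word_def)

text \<open>The free associative unital algebra on a set of letters, and its generators.\<close>

type_synonym 'a free_alg = "'a word \<Rightarrow>\<^sub>0 complex"

definition letter :: "'a \<Rightarrow> 'a free_alg" where
  "letter a = basis_vec (Word [a])"

lemma push_letter: "push (word_map f) (letter a) = letter (f a)"
  by (simp add: letter_def push_single)


section \<open>Matrices\<close>

type_synonym mat3 = "complex^3^3"

definition mscale :: "complex \<Rightarrow> mat3 \<Rightarrow> mat3" where
  "mscale c A = (\<chi> i j. c * A $ i $ j)"

definition munit :: "3 \<Rightarrow> 3 \<Rightarrow> mat3" where
  "munit r s = (\<chi> i j. if i = r \<and> j = s then 1 else 0)"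

definition conj_transpose :: "mat3 \<Rightarrow> mat3" where
  "conj_transpose A = (\<chi> i j. cnj (A $ j $ i))"

definition mH1 :: mat3 where
  "mH1 = mscale (1/3) (mscale 2 (munit 1 1) - munit 2 2 - munit 3 3)"
definition mH2 :: mat3 where
  "mH2 = mscale (1/3) (- munit 1 1 + mscale 2 (munit 2 2) - munit 3 3)"
definition mH :: mat3 where "mH = mH1 - mH2"
definition mE :: mat3 where "mE = munit 1 2"
definition mF :: mat3 where "mF = munit 2 1"
definition mE1 :: mat3 where "mE1 = munit 1 3"
definition mE2 :: mat3 where "mE2 = munit 2 3"
definition mF1 :: mat3 where "mF1 = munit 3 1"
definition mF2 :: mat3 where "mF2 = munit 3 2"

lemma mscale_nth [simp]: "mscale c A $ i $ j = c * A $ i $ j"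
  by (simp add: mscale_def)

lemma munit_nth [simp]: "munit r s $ i $ j = (if i = r \<and> j = s then 1 else 0)"
  by (simp add: munit_def)

lemma mat3_eq_iff: "(A :: mat3) = B \<longleftrightarrow> (\<forall>i j. A $ i $ j = B $ i $ j)"
  by (simp add: vec_eq_iff)

lemma mult_nth_3: "((A :: mat3) ** B) $ i $ j = A$i$1 * B$1$j + A$i$2 * B$2$j + A$i$3 * B$3$j"
  by (simp add: matrix_matrix_mult_def sum_3)

lemma trace_3: "trace (A :: mat3) = A$1$1 + A$2$2 + A$3$3"
  by (simp add: trace_def sum_3)

lemma trace_linear:
  "trace ((A :: mat3) + B) = trace A + trace B"
  "trace ((A :: mat3) - B) = trace A - trace B"
  "trace (mscale c A) = c * trace A"
  by (simp_all add: trace_3 distrib_left)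

lemma mscale_mult: "(A :: mat3) ** mscale c B = mscale c (A ** B)" "mscale c A ** B = mscale c (A ** (B :: mat3))"
  by (simp_all add: mat3_eq_iff mult_nth_3 algebra_simps)


section \<open>The Lie algebra, the space \<open>\<pp>\<close> and the group \<open>K\<close>\<close>

typedef sl3 = "{A :: mat3. trace A = 0}"
  by (rule exI[of _ 0]) (simp add: trace_3)

definition p_space :: "mat3 set" where
  "p_space = {mscale a mE1 + mscale b mE2 + mscale c mF1 + mscale d mF2 | a b c d. True}"

lemma p_space_iff:
  "A \<in> p_space \<longleftrightarrow> A$1$1 = 0 \<and> A$1$2 = 0 \<and> A$2$1 = 0 \<and> A$2$2 = 0 \<and> A$3$3 = 0"
proof (intro iffI)
  assume *: "A$1$1 = 0 \<and> A$1$2 = 0 \<and> A$2$1 = 0 \<and> A$2$2 = 0 \<and> A$3$3 = 0"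
  have "A = mscale (A$1$3) mE1 + mscale (A$2$3) mE2 + mscale (A$3$1) mF1 + mscale (A$3$2) mF2"
    unfolding mat3_eq_iff forall_3 using * by (simp add: mE1_def mE2_def mF1_def mF2_def)
  then show "A \<in> p_space" unfolding p_space_def by blast
next
  assume "A \<in> p_space"
  then obtain a b c d where "A = mscale a mE1 + mscale b mE2 + mscale c mF1 + mscale d mF2"
    unfolding p_space_def by blast
  then show "A$1$1 = 0 \<and> A$1$2 = 0 \<and> A$2$1 = 0 \<and> A$2$2 = 0 \<and> A$3$3 = 0"
    by (simp add: mE1_def mE2_def mF1_def mF2_def)
qed

typedef pspace = p_space
  by (rule exI[of _ 0]) (simp add: p_space_iff)

lemma conj_transpose_one: "conj_transpose (mat 1) = mat 1"
  by (simp add: mat3_eq_iff conj_transpose_def mat_def)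

typedef Kgrp = "{k :: mat3. conj_transpose k ** k = mat 1 \<and> k ** conj_transpose k = mat 1 \<and> det k = 1
    \<and> k$1$3 = 0 \<and> k$2$3 = 0 \<and> k$3$1 = 0 \<and> k$3$2 = 0}"
  by (rule exI[of _ "mat 1"]) (simp add: conj_transpose_one, simp add: mat_def)

setup_lifting type_definition_sl3
setup_lifting type_definition_pspace
setup_lifting type_definition_Kgrp

lift_definition sl3_add :: "sl3 \<Rightarrow> sl3 \<Rightarrow> sl3" is "\<lambda>A B. A + B"
  by (simp add: trace_linear)
lift_definition sl3_scale :: "complex \<Rightarrow> sl3 \<Rightarrow> sl3" is mscale
  by (simp add: trace_linear)
lift_definition sl3_bracket :: "sl3 \<Rightarrow> sl3 \<Rightarrow> sl3" is "\<lambda>A B. A ** B - B ** A"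
  unfolding mem_Collect_eq trace_linear by (subst trace_mul_sym) simp

lift_definition p_add :: "pspace \<Rightarrow> pspace \<Rightarrow> pspace" is "\<lambda>A B. A + B"
  by (simp add: p_space_iff)
lift_definition p_scale :: "complex \<Rightarrow> pspace \<Rightarrow> pspace" is mscale
  by (simp add: p_space_iff)
lift_definition p_form :: "pspace \<Rightarrow> pspace \<Rightarrow> complex" is "\<lambda>A B. trace (A ** B)" .

lemma K_inverse:
  assumes "conj_transpose k ** k = mat 1" "k ** conj_transpose k = mat 1"
  shows "matrix_inv k = conj_transpose k"
proof -
  have "k ** matrix_inv k = mat 1 \<and> matrix_inv k ** k = mat 1"
    unfolding matrix_inv_def by (rule someI) (use assms in simp)
  then have "conj_transpose k ** (k ** matrix_inv k) = conj_transpose k" by simp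
  then show ?thesis using assms(1) by (simp add: matrix_mul_assoc)
qed

lift_definition Ad_g :: "Kgrp \<Rightarrow> sl3 \<Rightarrow> sl3" is "\<lambda>k A. k ** A ** matrix_inv k"
proof -
  fix k A :: mat3
  assume "conj_transpose k ** k = mat 1 \<and> k ** conj_transpose k = mat 1 \<and> det k = 1
    \<and> k$1$3 = 0 \<and> k$2$3 = 0 \<and> k$3$1 = 0 \<and> k$3$2 = 0" and A: "trace A = 0"
  then have k: "conj_transpose k ** k = mat 1" "k ** conj_transpose k = mat 1" by auto
  have "trace (k ** A ** matrix_inv k) = trace (matrix_inv k ** (k ** A))"
    by (rule trace_mul_sym)
  then show "trace (k ** A ** matrix_inv k) = 0" using A k by (simp add: K_inverse matrix_mul_assoc)
qed

lift_definition Ad_p :: "Kgrp \<Rightarrow> pspace \<Rightarrow> pspace" is "\<lambda>k A. k ** A ** matrix_inv k"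
proof -
  fix k A :: mat3
  assume "conj_transpose k ** k = mat 1 \<and> k ** conj_transpose k = mat 1 \<and> det k = 1
    \<and> k$1$3 = 0 \<and> k$2$3 = 0 \<and> k$3$1 = 0 \<and> k$3$2 = 0" and A: "A \<in> p_space"
  then show "k ** A ** matrix_inv k \<in> p_space"
    by (auto simp: K_inverse p_space_iff mult_nth_3 conj_transpose_def)
qed

lemma conj_mult:
  assumes "l ** k = (mat 1 :: mat3)"
  shows "(k ** A ** l) ** (k ** B ** l) = k ** (A ** B) ** l"
proof -
  have "(k ** A ** l) ** (k ** B ** l) = k ** A ** (l ** k) ** B ** l"
    by (simp only: matrix_mul_assoc)
  then show ?thesis by (simp add: assms matrix_mul_assoc)
qed

lemma conj_add: "(k :: mat3) ** (A + B) ** (l :: mat3) = k ** A ** l + k ** B ** l"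
  by (simp add: mat3_eq_iff mult_nth_3 distrib_left distrib_right)

lemma conj_diff: "(k :: mat3) ** (A - B) ** (l :: mat3) = k ** A ** l - k ** B ** l"
  using conj_add[of k "A - B" B l] by (simp add: eq_diff_eq)

lemma Ad_g_simps:
  "Ad_g k (sl3_add X Y) = sl3_add (Ad_g k X) (Ad_g k Y)"
  "Ad_g k (sl3_scale z X) = sl3_scale z (Ad_g k X)"
  "Ad_g k (sl3_bracket X Y) = sl3_bracket (Ad_g k X) (Ad_g k Y)"
    apply (transfer, simp add: conj_add)
   apply (transfer, simp add: mscale_mult)
  apply (transfer, simp add: K_inverse conj_mult conj_diff)
  done

lemma Ad_p_simps:
  "Ad_p k (p_add x y) = p_add (Ad_p k x) (Ad_p k y)"
  "Ad_p k (p_scale z x) = p_scale z (Ad_p k x)"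
   apply (transfer, simp add: conj_add)
  apply (transfer, simp add: mscale_mult)
  done

lemma p_form_Ad_p: "p_form (Ad_p k x) (Ad_p k y) = p_form x y"
proof (transfer, elim CollectE conjE)
  fix k A B :: mat3
  assume k: "conj_transpose k ** k = mat 1" "k ** conj_transpose k = mat 1"
  have "trace (k ** (A ** B) ** conj_transpose k) = trace (conj_transpose k ** (k ** (A ** B)))"
    by (rule trace_mul_sym)
  also have "\<dots> = trace (A ** B)"
    using k by (simp add: matrix_mul_assoc)
  finally show "trace (k ** A ** matrix_inv k ** (k ** B ** matrix_inv k)) = trace (A ** B)"
    using k by (simp add: K_inverse conj_mult)
qed


lifting_forget sl3.lifting
lifting_forget pspace.lifting
lifting_forget Kgrp.lifting


section \<open>The universal enveloping algebra\<close>

text \<open>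
  The tensor algebra \<open>T(V)\<close> is the free algebra on the underlying set of \<open>V\<close> modulo the
  relations making the inclusion of \<open>V\<close> linear; the first two families of relations below (and
  for the Clifford algebra further down) express this.
\<close>

definition U_rels :: "sl3 free_alg set" where
  "U_rels =
     {letter (sl3_add X Y) - (letter X + letter Y) | X Y. True} \<union>
     {letter (sl3_scale z X) - pm_scale z (letter X) | z X. True} \<union>
     {letter X * letter Y - letter Y * letter X - letter (sl3_bracket X Y) | X Y. True}"

lemma U_relsI:
  "letter (sl3_add X Y) - (letter X + letter Y) \<in> U_rels"
  "letter (sl3_scale z X) - pm_scale z (letter X) \<in> U_rels"
  "letter X * letter Y - letter Y * letter X - letter (sl3_bracket X Y) \<in> U_rels"
  unfolding U_rels_def by blast+

quotient_type Ug = "sl3 free_alg" / "qcong U_rels"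
  by (rule equivp_qcong)

instantiation Ug :: complex_algebra
begin

lift_definition zero_Ug :: Ug is 0 .
lift_definition one_Ug :: Ug is 1 .
lift_definition plus_Ug :: "Ug \<Rightarrow> Ug \<Rightarrow> Ug" is "(+)" by (rule qcong_add)
lift_definition uminus_Ug :: "Ug \<Rightarrow> Ug" is uminus by (rule qcong_uminus)
lift_definition minus_Ug :: "Ug \<Rightarrow> Ug \<Rightarrow> Ug" is "(-)" by (rule qcong_diff)
lift_definition times_Ug :: "Ug \<Rightarrow> Ug \<Rightarrow> Ug" is "(*)" by (rule qcong_mult)
lift_definition cscale_Ug :: "complex \<Rightarrow> Ug \<Rightarrow> Ug" is pm_scale by (rule qcong_pm_scale)

instance
  by intro_classes
     (transfer, rule qcong_eqI, simp add: algebra_simps pm_scale_simps pm_scale_commute)+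

end

lemma push_word_map_one: "push (word_map f) 1 = 1"
  using push_single[of "word_map f" 0 1] by (simp add: word_map_zero)

lemmas push_word_map_simps = push_diff push_add push_letter push_mult[of "word_map f" for f, OF word_map_plus]
  push_word_map_one push_pm_scale[of "word_map f" for f, OF word_map_plus word_map_zero]

lift_definition Ad_U :: "Kgrp \<Rightarrow> Ug \<Rightarrow> Ug" is "\<lambda>k. push (word_map (Ad_g k))"
proof (rule push_qcong[of "word_map f" for f, OF word_map_plus])
  fix k s assume "s \<in> U_rels"
  then consider
      X Y where "s = letter (sl3_add X Y) - (letter X + letter Y)"
    | z X where "s = letter (sl3_scale z X) - pm_scale z (letter X)"
    | X Y where "s = letter X * letter Y - letter Y * letter X - letter (sl3_bracket X Y)"
    unfolding U_rels_def by blast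
  then have "push (word_map (Ad_g k)) s \<in> U_rels"
    by cases (simp_all only: push_word_map_simps Ad_g_simps U_relsI)
  then show "push (word_map (Ad_g k)) s \<in> ideal_gen U_rels" by (rule ideal_gen_gen)
qed

text \<open>The canonical map \<open>\<gg> \<rightarrow> U(\<gg>)\<close>, to be applied to trace zero matrices only.\<close>

definition U_incl :: "sl3 \<Rightarrow> Ug" where
  "U_incl X = abs_Ug (letter X)"

definition \<iota> :: "mat3 \<Rightarrow> Ug" where
  "\<iota> A = U_incl (Abs_sl3 A)"

lemma trace_zero_elements:
  "trace mH1 = 0" "trace mH2 = 0" "trace mH = 0" "trace mE = 0" "trace mF = 0"
  "trace mE1 = 0" "trace mE2 = 0" "trace mF1 = 0" "trace mF2 = 0"
  by (simp_all add: trace_3 mH_def mH1_def mH2_def mE_def mF_def mE1_def mE2_def mF1_def mF2_def)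


section \<open>The Clifford algebra\<close>

definition C_rels :: "pspace free_alg set" where
  "C_rels =
     {letter (p_add x y) - (letter x + letter y) | x y. True} \<union>
     {letter (p_scale z x) - pm_scale z (letter x) | z x. True} \<union>
     {letter x * letter y + letter y * letter x - pm_scale (- 2 * p_form x y) 1 | x y. True}"

lemma C_relsI:
  "letter (p_add x y) - (letter x + letter y) \<in> C_rels"
  "letter (p_scale z x) - pm_scale z (letter x) \<in> C_rels"
  "letter x * letter y + letter y * letter x - pm_scale (- 2 * p_form x y) 1 \<in> C_rels"
  unfolding C_rels_def by blast+

quotient_type Cp = "pspace free_alg" / "qcong C_rels"
  by (rule equivp_qcong)

instantiation Cp :: complex_algebra
begin

lift_definition zero_Cp :: Cp is 0 .
lift_definition one_Cp :: Cp is 1 .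
lift_definition plus_Cp :: "Cp \<Rightarrow> Cp \<Rightarrow> Cp" is "(+)" by (rule qcong_add)
lift_definition uminus_Cp :: "Cp \<Rightarrow> Cp" is uminus by (rule qcong_uminus)
lift_definition minus_Cp :: "Cp \<Rightarrow> Cp \<Rightarrow> Cp" is "(-)" by (rule qcong_diff)
lift_definition times_Cp :: "Cp \<Rightarrow> Cp \<Rightarrow> Cp" is "(*)" by (rule qcong_mult)
lift_definition cscale_Cp :: "complex \<Rightarrow> Cp \<Rightarrow> Cp" is pm_scale by (rule qcong_pm_scale)

instance
  by intro_classes
     (transfer, rule qcong_eqI, simp add: algebra_simps pm_scale_simps pm_scale_commute)+

end

lift_definition Ad_C :: "Kgrp \<Rightarrow> Cp \<Rightarrow> Cp" is "\<lambda>k. push (word_map (Ad_p k))"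
proof (rule push_qcong[of "word_map f" for f, OF word_map_plus])
  fix k s assume "s \<in> C_rels"
  then consider
      x y where "s = letter (p_add x y) - (letter x + letter y)"
    | z x where "s = letter (p_scale z x) - pm_scale z (letter x)"
    | x y where "s = letter x * letter y + letter y * letter x - pm_scale (- 2 * p_form x y) 1"
    unfolding C_rels_def by blast
  then have "push (word_map (Ad_p k)) s \<in> C_rels"
  proof cases
    case (3 x y)
    then show ?thesis
      by (simp only: push_word_map_simps) (metis C_relsI(3) p_form_Ad_p)
  qed (simp_all only: push_word_map_simps Ad_p_simps C_relsI)
  then show "push (word_map (Ad_p k)) s \<in> ideal_gen C_rels" by (rule ideal_gen_gen)
qed

text \<open>The canonical map \<open>\<pp> \<rightarrow> C(\<pp>)\<close>, to be applied to elements of \<open>p_space\<close> only.\<close>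

definition C_incl :: "pspace \<Rightarrow> Cp" where
  "C_incl x = abs_Cp (letter x)"

definition \<gamma> :: "mat3 \<Rightarrow> Cp" where
  "\<gamma> A = C_incl (Abs_pspace A)"

lemma p_space_elements: "mE1 \<in> p_space" "mE2 \<in> p_space" "mF1 \<in> p_space" "mF2 \<in> p_space"
  by (simp_all add: p_space_iff mE1_def mE2_def mF1_def mF2_def)


section \<open>Tensor products of algebras\<close>

datatype ('a, 'b) pure = Pure 'a 'b

instantiation pure :: (monoid_mult, monoid_mult) monoid_add
begin

definition zero_pure :: "('a, 'b) pure" where "zero_pure = Pure 1 1"

fun plus_pure :: "('a, 'b) pure \<Rightarrow> ('a, 'b) pure \<Rightarrow> ('a, 'b) pure" where
  "plus_pure (Pure a b) (Pure a' b') = Pure (a * a') (b * b')"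

instance
proof
  fix a b c :: "('a, 'b) pure"
  show "a + b + c = a + (b + c)" by (cases a; cases b; cases c) (simp add: mult.assoc)
  show "0 + a = a" by (cases a) (simp add: zero_pure_def)
  show "a + 0 = a" by (cases a) (simp add: zero_pure_def)
qed

end

text \<open>
  \<open>A \<otimes> B\<close> is the free vector space on \<open>A \<times> B\<close> modulo the bilinearity relations, with
  \<open>(a \<otimes> b) (a' \<otimes> b') = a a' \<otimes> b b'\<close>. The set of relations is stable, up to scalars,
  under multiplication by pure tensors from either side, so the two-sided ideal which it
  generates is just its linear span.
\<close>

definition tensor_rels ::
  "(('a::complex_algebra, 'b::complex_algebra) pure \<Rightarrow>\<^sub>0 complex) set" where
  "tensor_rels =
     {basis_vec (Pure (a + a') b) - (basis_vec (Pure a b) + basis_vec (Pure a' b)) | a a' b. True} \<union>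
     {basis_vec (Pure a (b + b')) - (basis_vec (Pure a b) + basis_vec (Pure a b')) | a b b'. True} \<union>
     {basis_vec (Pure (z *\<^sub>C a) b) - pm_scale z (basis_vec (Pure a b)) | z a b. True} \<union>
     {basis_vec (Pure a (z *\<^sub>C b)) - pm_scale z (basis_vec (Pure a b)) | z a b. True}"

lemma tensor_relsI:
  "basis_vec (Pure (a + a') b) - (basis_vec (Pure a b) + basis_vec (Pure a' b)) \<in> tensor_rels"
  "basis_vec (Pure a (b + b')) - (basis_vec (Pure a b) + basis_vec (Pure a b')) \<in> tensor_rels"
  "basis_vec (Pure (z *\<^sub>C a) b) - pm_scale z (basis_vec (Pure a b)) \<in> tensor_rels"
  "basis_vec (Pure a (z *\<^sub>C b)) - pm_scale z (basis_vec (Pure a b)) \<in> tensor_rels"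
  unfolding tensor_rels_def by blast+

quotient_type (overloaded) ('a, 'b) tensor =
    "('a::complex_algebra, 'b::complex_algebra) pure \<Rightarrow>\<^sub>0 complex" / "qcong tensor_rels"
  by (rule equivp_qcong)

instantiation tensor :: (complex_algebra, complex_algebra) complex_algebra
begin

lift_definition zero_tensor :: "('a, 'b) tensor" is 0 .
lift_definition one_tensor :: "('a, 'b) tensor" is 1 .
lift_definition plus_tensor :: "('a, 'b) tensor \<Rightarrow> ('a, 'b) tensor \<Rightarrow> ('a, 'b) tensor" is "(+)"
  by (rule qcong_add)
lift_definition uminus_tensor :: "('a, 'b) tensor \<Rightarrow> ('a, 'b) tensor" is uminus
  by (rule qcong_uminus)
lift_definition minus_tensor :: "('a, 'b) tensor \<Rightarrow> ('a, 'b) tensor \<Rightarrow> ('a, 'b) tensor" is "(-)"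
  by (rule qcong_diff)
lift_definition times_tensor :: "('a, 'b) tensor \<Rightarrow> ('a, 'b) tensor \<Rightarrow> ('a, 'b) tensor" is "(*)"
  by (rule qcong_mult)
lift_definition cscale_tensor :: "complex \<Rightarrow> ('a, 'b) tensor \<Rightarrow> ('a, 'b) tensor" is pm_scale
  by (rule qcong_pm_scale)

instance
  by intro_classes
     (transfer, rule qcong_eqI, simp add: algebra_simps pm_scale_simps pm_scale_commute)+

end

lift_definition tens ::
  "'a::complex_algebra \<Rightarrow> 'b::complex_algebra \<Rightarrow> ('a, 'b) tensor" (infix \<open>\<otimes>\<^sub>T\<close> 72)
  is "\<lambda>a b. basis_vec (Pure a b)" .


section \<open>Invariants and the elements\<close>

lemma Ad_U_simps:
  "Ad_U k (a + b) = Ad_U k a + Ad_U k b"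
  "Ad_U k (a * b) = Ad_U k a * Ad_U k b"
  "Ad_U k (z *\<^sub>C a) = z *\<^sub>C Ad_U k a"
  by (transfer, rule qcong_eqI, simp add: push_add push_mult[of "word_map f" for f, OF word_map_plus]
      push_pm_scale[of "word_map f" for f, OF word_map_plus word_map_zero])+

lemma Ad_C_simps:
  "Ad_C k (a + b) = Ad_C k a + Ad_C k b"
  "Ad_C k (a * b) = Ad_C k a * Ad_C k b"
  "Ad_C k (z *\<^sub>C a) = z *\<^sub>C Ad_C k a"
  by (transfer, rule qcong_eqI, simp add: push_add push_mult[of "word_map f" for f, OF word_map_plus]
      push_pm_scale[of "word_map f" for f, OF word_map_plus word_map_zero])+

lemma Ad_one: "Ad_U k 1 = 1" "Ad_C k 1 = 1"
  by (transfer, rule qcong_eqI, rule push_word_map_one)+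

fun pure_map :: "('a \<Rightarrow> 'c) \<Rightarrow> ('b \<Rightarrow> 'd) \<Rightarrow> ('a, 'b) pure \<Rightarrow> ('c, 'd) pure" where
  "pure_map f g (Pure a b) = Pure (f a) (g b)"

lemma pure_map_plus:
  "pure_map (Ad_U k) (Ad_C k) (m + n) = pure_map (Ad_U k) (Ad_C k) m + pure_map (Ad_U k) (Ad_C k) n"
  by (cases m; cases n) (simp add: Ad_U_simps Ad_C_simps)

lemma pure_map_zero: "pure_map (Ad_U k) (Ad_C k) 0 = 0"
  by (simp add: zero_pure_def Ad_one)

lift_definition Ad_UC :: "Kgrp \<Rightarrow> (Ug, Cp) tensor \<Rightarrow> (Ug, Cp) tensor"
  is "\<lambda>k. push (pure_map (Ad_U k) (Ad_C k))"
proof (rule push_qcong[of "pure_map (Ad_U k) (Ad_C k)" for k, OF pure_map_plus])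
  fix k and s :: "(Ug, Cp) pure \<Rightarrow>\<^sub>0 complex"
  assume "s \<in> tensor_rels"
  then consider
      a a' b where "s = basis_vec (Pure (a + a') b) - (basis_vec (Pure a b) + basis_vec (Pure a' b))"
    | a b b' where "s = basis_vec (Pure a (b + b')) - (basis_vec (Pure a b) + basis_vec (Pure a b'))"
    | z a b where "s = basis_vec (Pure (z *\<^sub>C a) b) - pm_scale z (basis_vec (Pure a b))"
    | z a b where "s = basis_vec (Pure a (z *\<^sub>C b)) - pm_scale z (basis_vec (Pure a b))"
    unfolding tensor_rels_def by blast
  then have "push (pure_map (Ad_U k) (Ad_C k)) s \<in> tensor_rels"
    by cases (simp_all only: push_diff push_add push_single push_pm_scale[of "pure_map (Ad_U k) (Ad_C k)", OF pure_map_plus pure_map_zero]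
        pure_map.simps Ad_U_simps Ad_C_simps tensor_relsI)
  then show "push (pure_map (Ad_U k) (Ad_C k)) s \<in> ideal_gen tensor_rels"
    by (rule ideal_gen_gen)
qed

lemma Ad_UC_tens: "Ad_UC k (u \<otimes>\<^sub>T c) = Ad_U k u \<otimes>\<^sub>T Ad_C k c"
  by transfer (rule qcong_eqI, simp add: push_single)

definition Ug_K :: "Ug set" where
  "Ug_K = {u. \<forall>k. Ad_U k u = u}"

definition UC_K :: "(Ug, Cp) tensor set" where
  "UC_K = {x. \<forall>k. Ad_UC k x = x}"

definition U_act :: "Ug \<Rightarrow> (Ug, Cp) tensor \<Rightarrow> (Ug, Cp) tensor" where
  "U_act u x = (u \<otimes>\<^sub>T 1) * x"

definition t_e :: "(Ug, Cp) tensor" where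
  "t_e = \<iota> mF1 \<otimes>\<^sub>T \<gamma> mE1 + \<iota> mF2 \<otimes>\<^sub>T \<gamma> mE2"

definition t_f :: "(Ug, Cp) tensor" where
  "t_f = \<iota> mE1 \<otimes>\<^sub>T \<gamma> mF1 + \<iota> mE2 \<otimes>\<^sub>T \<gamma> mF2"

definition t_g :: "(Ug, Cp) tensor" where
  "t_g = 1 \<otimes>\<^sub>T (\<gamma> mE1 * \<gamma> mF1 + \<gamma> mE2 * \<gamma> mF2)"

definition t_h :: "(Ug, Cp) tensor" where
  "t_h = (2 *\<^sub>C (\<iota> mE * \<iota> mE2) + \<iota> mH * \<iota> mE1) \<otimes>\<^sub>T \<gamma> mF1
       + (- (\<iota> mH * \<iota> mE2) + 2 *\<^sub>C (\<iota> mF * \<iota> mE1)) \<otimes>\<^sub>T \<gamma> mF2"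

definition t_i :: "(Ug, Cp) tensor" where
  "t_i = (2 *\<^sub>C \<iota> mE) \<otimes>\<^sub>T (\<gamma> mE2 * \<gamma> mF1) + \<iota> mH \<otimes>\<^sub>T (\<gamma> mE1 * \<gamma> mF1)
       - \<iota> mH \<otimes>\<^sub>T (\<gamma> mE2 * \<gamma> mF2) + (2 *\<^sub>C \<iota> mF) \<otimes>\<^sub>T (\<gamma> mE1 * \<gamma> mF2)"

definition t_j :: "(Ug, Cp) tensor" where
  "t_j = (\<iota> mH * \<iota> mF1 + 2 *\<^sub>C (\<iota> mF * \<iota> mF2)) \<otimes>\<^sub>T \<gamma> mE1
       + (2 *\<^sub>C (\<iota> mE * \<iota> mF1) - \<iota> mH * \<iota> mF2) \<otimes>\<^sub>T \<gamma> mE2"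

definition T_set :: "(Ug, Cp) tensor set" where
  "T_set = {1, t_e, t_f, t_g, t_h, t_i, t_j, t_e * t_f, t_e * t_g, t_f * t_g, t_g ^ 2,
            t_e * t_i, t_e * t_j, t_f * t_h, t_f * t_i, t_f * t_j}"

end

theory Submission
  imports Defs
begin

text \<open>
  Filter \<open>U(\<gg>)\<close> by degree and leave \<open>C(\<pp>)\<close> in degree \<open>0\<close>. By the Poincare-Birkhoff-Witt theorem the
  symbol of an element of \<open>U(\<gg>) \<otimes> C(\<pp>)\<close> is a polynomial map from \<open>\<gg> \<cong> \<gg>\<^sup>*\<close> to \<open>C(\<pp>)\<close>, and
  taking symbols is multiplicative and \<open>K\<close>-equivariant. Only the part
  \<open>((A, u), (v, 0))\<close> of a point of \<open>\<gg>\<close> matters, with \<open>A\<close> a matrix of size 2, and there \<open>K\<close> acts through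
  \<open>U(2)\<close>. An equivariant polynomial map is determined by its values where \<open>u\<close> and \<open>A u\<close> are the standard
  basis, so its components are combinations of \<open>u, A u\<close> (or \<open>v, v A\<close>, or \<open>1, A, u v, A u v\<close>, or
  \<open>det (u, A u)\<close>, \<open>det (v, v A)\<close>) with coefficients that are polynomials in \<open>tr A\<close>, \<open>det A\<close>, \<open>v u\<close>,
  \<open>v A u\<close>. The symbols of \<open>T_set\<close> differ from these 16 covariants by an invertible triangular change of basis
  over the invariants. The four invariants are polynomials in symbols of elements of \<open>U(\<gg>)\<^sup>K\<close>, so
  induction on the degree gives spanning; independence follows since the 16 symbols are linearly independent in
  \<open>C(\<pp>)\<close> at a generic point.
\<close>

text \<open>All the algebras are given by generators and relations, so only a representation can
  show that an element is nonzero: \<open>C(\<pp>)\<close> acts by explicit operators on functions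
  of sixteen occupation patterns, \<open>U(\<gg>)\<close> by differential operators on polynomial
  functions of a matrix, and symbols are coordinates of these actions. \<open>K\<close> is compact
  and not a complex algebraic group, but symbols are polynomial, so invariance passes to enough of
  \<open>GL(2)\<close> to move a generic point onto the section. The coefficients are polynomials
  and not merely rational functions because the section is itself polynomial in the invariants:
  restriction to it already is the coefficient. The moving matrix, which has denominators, only
  serves to check an identity on a dense set. Vector-valued covariants are reduced to scalar
  invariants by pairing them with an auxiliary row \<open>\<lambda>\<close> and column
  \<open>\<mu>\<close>, on which symbols do not depend. The four invariants have degrees 1, 2, 2, 3,
  so the coefficients found in this way need not be homogeneous, and just one component of each is
  lifted to \<open>U(\<gg>)\<close>.\<close>

lemma cscale_zero_left [simp]: "0 *\<^sub>C (x::'a::complex_algebra) = 0"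
  using cscale_add_left[of 0 0 x] by simp

lemma cscale_zero_right [simp]: "z *\<^sub>C (0::'a::complex_algebra) = 0"
  using cscale_add_right[of z 0 "0::'a"] by simp

lemma cscale_minus_left: "(- z) *\<^sub>C (x::'a::complex_algebra) = - (z *\<^sub>C x)"
  using cscale_add_left[of z "- z" x] by (simp add: minus_unique)

lemma cscale_minus_right: "z *\<^sub>C (- x::'a::complex_algebra) = - (z *\<^sub>C x)"
  using cscale_add_right[of z x "- x"] by (simp add: minus_unique)

lemma cscale_diff_left: "(z - w) *\<^sub>C (x::'a::complex_algebra) = z *\<^sub>C x - w *\<^sub>C x"
  using cscale_add_left[of z "- w" x] by (simp add: cscale_minus_left)

lemma cscale_diff_right: "z *\<^sub>C (x - y::'a::complex_algebra) = z *\<^sub>C x - z *\<^sub>C y"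
  using cscale_add_right[of z x "- y"] by (simp add: cscale_minus_right)

lemma cscale_sum_right: "z *\<^sub>C sum f A = (\<Sum>i\<in>A. z *\<^sub>C (f i :: 'a::complex_algebra))"
  by (induction A rule: infinite_finite_induct) (simp_all add: cscale_add_right)

lemmas cscale_mult = cscale_mult_left cscale_mult_right

section \<open>Maps out of the tensor product\<close>

definition lin_ext :: "('m \<Rightarrow> 'w::complex_algebra) \<Rightarrow> ('m \<Rightarrow>\<^sub>0 complex) \<Rightarrow> 'w" where
  "lin_ext f x = (\<Sum>m\<in>Poly_Mapping.keys x. Poly_Mapping.lookup x m *\<^sub>C f m)"

lemma lin_ext_superset:
  assumes "finite A" "Poly_Mapping.keys x \<subseteq> A"
  shows "lin_ext f x = (\<Sum>m\<in>A. Poly_Mapping.lookup x m *\<^sub>C f m)"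
  unfolding lin_ext_def by (rule sum.mono_neutral_left) (use assms in \<open>auto simp: in_keys_iff\<close>)

lemma lin_ext_zero [simp]: "lin_ext f 0 = 0"
  by (simp add: lin_ext_def)

lemma lin_ext_single [simp]: "lin_ext f (Poly_Mapping.single m z) = z *\<^sub>C f m"
  by (simp add: lin_ext_def)

lemma lin_ext_add: "lin_ext f (x + y) = lin_ext f x + lin_ext f y"
proof -
  let ?A = "Poly_Mapping.keys x \<union> Poly_Mapping.keys y"
  have "lin_ext f (x + y) = (\<Sum>m\<in>?A. Poly_Mapping.lookup (x + y) m *\<^sub>C f m)"
    by (rule lin_ext_superset) (use keys_add[of x y] in auto)
  also have "\<dots> = lin_ext f x + lin_ext f y"
    by (simp add: lin_ext_superset[of ?A x] lin_ext_superset[of ?A y] lookup_add cscale_add_left sum.distrib)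
  finally show ?thesis .
qed

lemma lin_ext_uminus: "lin_ext f (- x) = - lin_ext f x"
  using lin_ext_add[of f x "- x"] by (simp add: minus_unique)

lemma lin_ext_diff: "lin_ext f (x - y) = lin_ext f x - lin_ext f y"
  using lin_ext_add[of f x "- y"] by (simp add: lin_ext_uminus)

definition bilinear_map :: "('a::complex_algebra \<Rightarrow> 'b::complex_algebra \<Rightarrow> 'w::complex_algebra) \<Rightarrow> bool" where
  "bilinear_map \<beta> \<longleftrightarrow>
     (\<forall>a a' b. \<beta> (a + a') b = \<beta> a b + \<beta> a' b) \<and> (\<forall>a b b'. \<beta> a (b + b') = \<beta> a b + \<beta> a b') \<and>
     (\<forall>z a b. \<beta> (z *\<^sub>C a) b = z *\<^sub>C \<beta> a b) \<and> (\<forall>z a b. \<beta> a (z *\<^sub>C b) = z *\<^sub>C \<beta> a b)"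

lemma bilinear_mapD:
  assumes "bilinear_map \<beta>"
  shows "\<beta> (a + a') b = \<beta> a b + \<beta> a' b" "\<beta> a (b + b') = \<beta> a b + \<beta> a b'"
    "\<beta> (z *\<^sub>C a) b = z *\<^sub>C \<beta> a b" "\<beta> a (z *\<^sub>C b) = z *\<^sub>C \<beta> a b"
  using assms unfolding bilinear_map_def by blast+

definition pure_ext :: "('a \<Rightarrow> 'b \<Rightarrow> 'w) \<Rightarrow> (('a, 'b) pure \<Rightarrow>\<^sub>0 complex) \<Rightarrow> 'w::complex_algebra" where
  "pure_ext \<beta> = lin_ext (\<lambda>p. case p of Pure a b \<Rightarrow> \<beta> a b)"

lemma pure_ext_simps:
  "pure_ext \<beta> 0 = 0"
  "pure_ext \<beta> (x + y) = pure_ext \<beta> x + pure_ext \<beta> y"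
  "pure_ext \<beta> (x - y) = pure_ext \<beta> x - pure_ext \<beta> y"
  "pure_ext \<beta> (Poly_Mapping.single (Pure a b) z) = z *\<^sub>C \<beta> a b"
  by (simp_all add: pure_ext_def lin_ext_add lin_ext_diff)

text \<open>Multiplying a bilinearity relation by pure tensors on both sides yields a multiple of a
  relation of the same kind, and \<open>a\<close>, \<open>b\<close> are sums of such tensors. So
  bilinearity of \<open>\<beta>\<close> suffices for vanishing on the two-sided ideal, without any
  multiplicativity.\<close>

lemma pure_ext_rels:
  assumes \<beta>: "bilinear_map \<beta>" and x: "x \<in> ideal_gen tensor_rels"
  shows "pure_ext \<beta> x = 0"
  using x
proof (induction rule: ideal_gen.induct)
  case (step s x a b)
  have "pure_ext \<beta> (a * s * b) = 0"
  proof (induction a rule: pm_induct)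
    case (single m c)
    obtain p q where m: "m = Pure p q" by (cases m)
    show ?case
    proof (induction b rule: pm_induct)
      case (single n d)
      obtain p' q' where n: "n = Pure p' q'" by (cases n)
      from step(1) consider
          a a' b where "s = basis_vec (Pure (a + a') b) - (basis_vec (Pure a b) + basis_vec (Pure a' b))"
        | a b b' where "s = basis_vec (Pure a (b + b')) - (basis_vec (Pure a b) + basis_vec (Pure a b'))"
        | z a b where "s = basis_vec (Pure (z *\<^sub>C a) b) - pm_scale z (basis_vec (Pure a b))"
        | z a b where "s = basis_vec (Pure a (z *\<^sub>C b)) - pm_scale z (basis_vec (Pure a b))"
        unfolding tensor_rels_def by blast
      then show ?case
        by cases (simp_all add: m n ring_distribs mult_single pm_scale_single pure_ext_simps
            bilinear_mapD[OF \<beta>] cscale_mult cscale_add_right cscale_cscale mult.assoc mult.left_commute mult.commute)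
    qed (simp_all add: pure_ext_simps distrib_left)
  qed (simp_all add: pure_ext_simps distrib_right)
  then show ?case using step by (simp add: pure_ext_simps)
qed (simp add: pure_ext_simps)

text \<open>The universal property as a total function: the value 0 for \<open>\<beta>\<close> that
  are not bilinear makes the map respect the quotient for every argument.\<close>

lift_definition tensor_lift ::
  "('a::complex_algebra \<Rightarrow> 'b::complex_algebra \<Rightarrow> 'w::complex_algebra) \<Rightarrow> ('a, 'b) tensor \<Rightarrow> 'w"
  is "\<lambda>\<beta> x. if bilinear_map \<beta> then pure_ext \<beta> x else 0"
  by (metis pure_ext_rels pure_ext_simps(3) qcong_def right_minus_eq)

lemma pure_ext_pm_scale: "pure_ext \<beta> (pm_scale z x) = z *\<^sub>C pure_ext \<beta> x"
proof (induction x rule: pm_induct)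
  case (single m c)
  then show ?case by (cases m) (simp add: pm_scale_single pure_ext_simps cscale_cscale)
qed (simp_all add: pure_ext_simps pm_scale_simps cscale_add_right, simp add: pm_scale_def pure_ext_simps)

lemma tensor_lift_tens: "bilinear_map \<beta> \<Longrightarrow> tensor_lift \<beta> (a \<otimes>\<^sub>T b) = \<beta> a b"
  by transfer (simp add: pure_ext_simps cscale_one)

lemma tensor_lift_simps:
  "tensor_lift \<beta> 0 = 0"
  "tensor_lift \<beta> (x + y) = tensor_lift \<beta> x + tensor_lift \<beta> y"
  "tensor_lift \<beta> (x - y) = tensor_lift \<beta> x - tensor_lift \<beta> y"
  "tensor_lift \<beta> (z *\<^sub>C x) = z *\<^sub>C tensor_lift \<beta> x"
  by (transfer, simp add: pure_ext_simps pure_ext_pm_scale)+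

lemma tens_simps:
  "(a + a') \<otimes>\<^sub>T b = a \<otimes>\<^sub>T b + a' \<otimes>\<^sub>T b"
  "a \<otimes>\<^sub>T (b + b') = a \<otimes>\<^sub>T b + a \<otimes>\<^sub>T b'"
  "(z *\<^sub>C a) \<otimes>\<^sub>T b = z *\<^sub>C (a \<otimes>\<^sub>T b)"
  "a \<otimes>\<^sub>T (z *\<^sub>C b) = z *\<^sub>C (a \<otimes>\<^sub>T b)"
  by (transfer, simp add: qcong_def, rule ideal_gen_gen, rule tensor_relsI)+

lemma tens_zero [simp]: "0 \<otimes>\<^sub>T b = 0" "a \<otimes>\<^sub>T 0 = 0"
  using tens_simps(1)[of 0 0 b] tens_simps(2)[of a 0 0] by simp_all

lemma tens_diff:
  "(a - a') \<otimes>\<^sub>T b = a \<otimes>\<^sub>T b - a' \<otimes>\<^sub>T b"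
  "a \<otimes>\<^sub>T (b - b') = a \<otimes>\<^sub>T b - a \<otimes>\<^sub>T b'"
  using tens_simps(1)[of "a - a'" a' b] tens_simps(2)[of a "b - b'" b'] by (simp_all add: eq_diff_eq)

lemma tens_minus: "(- a) \<otimes>\<^sub>T b = - (a \<otimes>\<^sub>T b)" "a \<otimes>\<^sub>T (- b) = - (a \<otimes>\<^sub>T b)"
  using tens_diff(1)[of 0 a b] tens_diff(2)[of a 0 b] by simp_all

lemma tens_sum: "sum f A \<otimes>\<^sub>T b = (\<Sum>i\<in>A. f i \<otimes>\<^sub>T b)" "a \<otimes>\<^sub>T sum g A = (\<Sum>i\<in>A. a \<otimes>\<^sub>T g i)"
  by (induction A rule: infinite_finite_induct) (simp_all add: tens_simps)

lemma tens_mult: "(a \<otimes>\<^sub>T b) * (a' \<otimes>\<^sub>T b') = (a * a') \<otimes>\<^sub>T (b * b')"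
  by transfer (simp add: mult_single qcong_eqI)

lemma tens_one: "1 \<otimes>\<^sub>T 1 = 1"
  by transfer (rule qcong_eqI, simp flip: single_one zero_pure_def)

text \<open>Zero and scalar multiples need no cases of their own, since
  \<open>0 \<otimes>\<^sub>T 0\<close> is zero and scalars are absorbed into the first
  factor.\<close>

lemma tensor_induct [case_names tens add]:
  assumes s: "\<And>a b. P (a \<otimes>\<^sub>T b)" and a: "\<And>x y. P x \<Longrightarrow> P y \<Longrightarrow> P (x + y)"
  shows "P (x :: ('a::complex_algebra, 'b::complex_algebra) tensor)"
proof -
  have "P (abs_tensor y)" for y :: "('a, 'b) pure \<Rightarrow>\<^sub>0 complex"
  proof (induction y rule: pm_induct)
    case zero
    show ?case using s[of 0 0] by (simp add: zero_tensor_def[symmetric])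
  next
    case (single m c)
    obtain p q where m: "m = Pure p q" by (cases m)
    have "abs_tensor (Poly_Mapping.single m c) = (c *\<^sub>C p) \<otimes>\<^sub>T q"
      unfolding tens_simps m by (simp add: tens_def cscale_tensor.abs_eq pm_scale_single)
    then show ?case using s by simp
  next
    case (add x y)
    then show ?case using a[OF add] by (simp add: plus_tensor.abs_eq)
  qed
  then show ?thesis by (metis Quotient_abs_rep Quotient_tensor)
qed

section \<open>Representations of free algebras on function spaces\<close>

fun word_act :: "('a \<Rightarrow> 'v \<Rightarrow> 'v) \<Rightarrow> 'a word \<Rightarrow> 'v \<Rightarrow> 'v" where
  "word_act op (Word xs) v = foldr op xs v"

definition free_act :: "('a \<Rightarrow> ('i \<Rightarrow> complex) \<Rightarrow> 'i \<Rightarrow> complex) \<Rightarrow> 'a free_alg \<Rightarrow> ('i \<Rightarrow> complex) \<Rightarrow> 'i \<Rightarrow> complex" where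
  "free_act op x v i = (\<Sum>w\<in>Poly_Mapping.keys x. Poly_Mapping.lookup x w * word_act op w v i)"

lemma free_act_superset:
  assumes "finite A" "Poly_Mapping.keys x \<subseteq> A"
  shows "free_act op x v i = (\<Sum>m\<in>A. Poly_Mapping.lookup x m * word_act op m v i)"
  unfolding free_act_def by (rule sum.mono_neutral_left) (use assms in \<open>auto simp: in_keys_iff\<close>)

lemma free_act_zero [simp]: "free_act op 0 v = (\<lambda>i. 0)"
  by (rule ext) (simp add: free_act_def)

lemma free_act_single: "free_act op (Poly_Mapping.single m z) v = (\<lambda>i. z * word_act op m v i)"
  by (rule ext) (simp add: free_act_def)

lemma free_act_add: "free_act op (x + y) v = (\<lambda>i. free_act op x v i + free_act op y v i)"
proof
  fix i
  let ?A = "Poly_Mapping.keys x \<union> Poly_Mapping.keys y"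
  have "free_act op (x + y) v i = (\<Sum>m\<in>?A. Poly_Mapping.lookup (x + y) m * word_act op m v i)"
    by (rule free_act_superset) (use keys_add[of x y] in auto)
  also have "\<dots> = free_act op x v i + free_act op y v i"
    by (simp add: free_act_superset[of ?A x] free_act_superset[of ?A y] lookup_add distrib_right sum.distrib)
  finally show "free_act op (x + y) v i = free_act op x v i + free_act op y v i" .
qed

lemma free_act_uminus: "free_act op (- x) v = (\<lambda>i. - free_act op x v i)"
proof
  fix i show "free_act op (- x) v i = - free_act op x v i"
    using fun_cong[OF free_act_add[of op x "- x" v], of i] by (simp add: minus_unique)
qed

lemma free_act_diff: "free_act op (x - y) v = (\<lambda>i. free_act op x v i - free_act op y v i)"
  using free_act_add[of op x "- y" v] by (simp add: free_act_uminus)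

lemma free_act_letter: "free_act op (letter a) v = op a v"
  by (simp add: letter_def free_act_single)

text \<open>Linearity and the relations are required on \<open>V\<close> only: \<open>deriv\<close>
  is additive on differentiable functions but not on all functions, so the operators for
  \<open>U(\<gg>)\<close> are well behaved only on polynomial ones.\<close>

locale free_rep =
  fixes opr :: "'a \<Rightarrow> ('i \<Rightarrow> complex) \<Rightarrow> 'i \<Rightarrow> complex" and V :: "('i \<Rightarrow> complex) set"
    and rels :: "'a free_alg set"
  assumes V_zero: "(\<lambda>i. 0) \<in> V"
    and V_add: "\<And>v w. v \<in> V \<Longrightarrow> w \<in> V \<Longrightarrow> (\<lambda>i. v i + w i) \<in> V"
    and V_scale: "\<And>z v. v \<in> V \<Longrightarrow> (\<lambda>i. z * v i) \<in> V"
    and V_op: "\<And>a v. v \<in> V \<Longrightarrow> opr a v \<in> V"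
    and op_add: "\<And>a v w. v \<in> V \<Longrightarrow> w \<in> V \<Longrightarrow> opr a (\<lambda>i. v i + w i) = (\<lambda>i. opr a v i + opr a w i)"
    and op_scale: "\<And>a z v. v \<in> V \<Longrightarrow> opr a (\<lambda>i. z * v i) = (\<lambda>i. z * opr a v i)"
    and rels_zero: "\<And>s v. s \<in> rels \<Longrightarrow> v \<in> V \<Longrightarrow> free_act opr s v = (\<lambda>i. 0)"
begin

lemma word_act_V: "v \<in> V \<Longrightarrow> word_act opr w v \<in> V"
proof (cases w)
  case (Word xs)
  assume "v \<in> V"
  then have "foldr opr xs v \<in> V" by (induction xs) (auto intro: V_op)
  then show ?thesis by (simp add: Word)
qed

lemma word_act_add:
  assumes "u \<in> V" "v \<in> V"
  shows "word_act opr w (\<lambda>i. u i + v i) = (\<lambda>i. word_act opr w u i + word_act opr w v i)"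
proof (cases w)
  case (Word xs)
  have "foldr opr xs (\<lambda>i. u i + v i) = (\<lambda>i. foldr opr xs u i + foldr opr xs v i)"
    by (induction xs) (use assms word_act_V[of _ "Word _"] in \<open>simp_all add: op_add\<close>)
  then show ?thesis by (simp add: Word)
qed

lemma word_act_scale:
  assumes "v \<in> V"
  shows "word_act opr w (\<lambda>i. z * v i) = (\<lambda>i. z * word_act opr w v i)"
proof (cases w)
  case (Word xs)
  have "foldr opr xs (\<lambda>i. z * v i) = (\<lambda>i. z * foldr opr xs v i)"
    by (induction xs) (use assms word_act_V[of _ "Word _"] in \<open>simp_all add: op_scale\<close>)
  then show ?thesis by (simp add: Word)
qed

lemma free_act_V: "v \<in> V \<Longrightarrow> free_act opr x v \<in> V"
  by (induction x rule: pm_induct)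
     (auto simp: free_act_single free_act_add V_zero intro: V_add V_scale word_act_V)

lemma word_act_plus: "word_act opr (w + w') v = word_act opr w (word_act opr w' v)"
  by (cases w; cases w') simp

lemma word_act_zero: "word_act opr w (\<lambda>i. 0) = (\<lambda>i. 0)"
  using word_act_scale[OF V_zero, of w 0] by simp

lemma free_act_mult:
  assumes "v \<in> V"
  shows "free_act opr (x * y) v = free_act opr x (free_act opr y v)"
proof (induction x rule: pm_induct)
  case (single m c)
  show ?case
  proof (induction y rule: pm_induct)
    case zero
    then show ?case by (simp add: free_act_single word_act_zero)
  next
    case (single n d)
    then show ?case using assms
      by (simp add: mult_single free_act_single word_act_scale word_act_plus word_act_V mult.assoc)
  next
    case (add x y)
    have "free_act opr (Poly_Mapping.single m c) (free_act opr (x + y) v)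
        = (\<lambda>i. c * word_act opr m (free_act opr x v) i + c * word_act opr m (free_act opr y v) i)"
      using assms by (simp add: free_act_single free_act_add word_act_add free_act_V distrib_left)
    then show ?case using add by (simp add: distrib_left free_act_add free_act_single)
  qed
qed (simp_all add: distrib_right free_act_add)

lemma free_act_vec_zero: "free_act opr x (\<lambda>i. 0) = (\<lambda>i. 0)"
  by (induction x rule: pm_induct) (simp_all add: free_act_add free_act_single word_act_zero)

lemma free_act_ideal:
  assumes "x \<in> ideal_gen rels" "v \<in> V"
  shows "free_act opr x v = (\<lambda>i. 0)"
  using assms
  by (induction rule: ideal_gen.induct)
     (simp_all add: free_act_add free_act_mult free_act_V rels_zero free_act_vec_zero)

lemma free_act_qcong: "qcong rels x y \<Longrightarrow> v \<in> V \<Longrightarrow> free_act opr x v = free_act opr y v"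
  using free_act_ideal[of "x - y" v] by (simp add: qcong_def free_act_diff fun_eq_iff)

lemma free_act_one: "free_act opr 1 v = v"
  by (simp add: free_act_single zero_word_def flip: single_one)

lemma free_act_pm_scale: "v \<in> V \<Longrightarrow> free_act opr (pm_scale z x) v = (\<lambda>i. z * free_act opr x v i)"
  by (simp add: pm_scale_def free_act_mult free_act_single zero_word_def)

end

section \<open>The Clifford algebra in normal order\<close>

type_synonym occ = "bool \<times> bool \<times> bool \<times> bool"

definition parity_sign :: "bool \<Rightarrow> complex" where "parity_sign a = (if a then - 1 else 1)"

lemma parity_sign_simps [simp]: "parity_sign True = - 1" "parity_sign False = 1"
  by (simp_all add: parity_sign_def)

text \<open>
  The operators of left multiplication by \<open>E\<^sub>1, E\<^sub>2, F\<^sub>1, F\<^sub>2\<close> in the normally ordered basis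
  \<open>E\<^sub>1\<^sup>a E\<^sub>2\<^sup>b F\<^sub>1\<^sup>c F\<^sub>2\<^sup>d\<close>.
\<close>

definition opE1 :: "(occ \<Rightarrow> complex) \<Rightarrow> occ \<Rightarrow> complex" where
  "opE1 v = (\<lambda>(a, b, c, d). if a then v (False, b, c, d) else 0)"
definition opE2 :: "(occ \<Rightarrow> complex) \<Rightarrow> occ \<Rightarrow> complex" where
  "opE2 v = (\<lambda>(a, b, c, d). if b then parity_sign a * v (a, False, c, d) else 0)"
definition opF1 :: "(occ \<Rightarrow> complex) \<Rightarrow> occ \<Rightarrow> complex" where
  "opF1 v = (\<lambda>(a, b, c, d). (if c then parity_sign a * parity_sign b * v (a, b, False, d) else 0)
     + (if a then 0 else - 2 * v (True, b, c, d)))"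
definition opF2 :: "(occ \<Rightarrow> complex) \<Rightarrow> occ \<Rightarrow> complex" where
  "opF2 v = (\<lambda>(a, b, c, d). (if d then parity_sign a * parity_sign b * parity_sign c * v (a, b, c, False) else 0)
     + (if b then 0 else - 2 * parity_sign a * v (a, True, c, d)))"

lemmas op_defs = opE1_def opE2_def opF1_def opF2_def

definition opP :: "pspace \<Rightarrow> (occ \<Rightarrow> complex) \<Rightarrow> occ \<Rightarrow> complex" where
  "opP x v = (\<lambda>i. Rep_pspace x $ 1 $ 3 * opE1 v i + Rep_pspace x $ 2 $ 3 * opE2 v i
                + Rep_pspace x $ 3 $ 1 * opF1 v i + Rep_pspace x $ 3 $ 2 * opF2 v i)"

lemma Rep_pspace_zero:
  "Rep_pspace x $ 1 $ 1 = 0" "Rep_pspace x $ 1 $ 2 = 0" "Rep_pspace x $ 2 $ 1 = 0"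
  "Rep_pspace x $ 2 $ 2 = 0" "Rep_pspace x $ 3 $ 3 = 0"
  using Rep_pspace[of x] by (simp_all add: p_space_iff)

lemma p_form_nth:
  "p_form x y = Rep_pspace x $ 1 $ 3 * Rep_pspace y $ 3 $ 1 + Rep_pspace x $ 2 $ 3 * Rep_pspace y $ 3 $ 2
     + Rep_pspace x $ 3 $ 1 * Rep_pspace y $ 1 $ 3 + Rep_pspace x $ 3 $ 2 * Rep_pspace y $ 2 $ 3"
  by (simp add: p_form.rep_eq trace_3 mult_nth_3 Rep_pspace_zero)

text \<open>In \<open>opF1\<close> and \<open>opF2\<close> one summand moves the new letter to its
  place, with a sign for every letter passed, and the other is the contraction with the dual letter,
  where the factor is -2 times the form. The identity is checked on the sixteen occupation
  patterns.\<close>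

lemma opP_anticommutator: "opP x (opP y v) i + opP y (opP x v) i = - 2 * p_form x y * v i"
proof -
  obtain a b c d where i: "i = (a, b, c, d)" by (cases i)
  show ?thesis
    unfolding i p_form_nth
    by (cases a; cases b; cases c; cases d; simp add: opP_def op_defs algebra_simps)
qed

lemma opP_linear:
  "opP x (\<lambda>i. v i + w i) = (\<lambda>i. opP x v i + opP x w i)"
  "opP x (\<lambda>i. z * v i) = (\<lambda>i. z * opP x v i)"
  by (auto simp: opP_def op_defs fun_eq_iff algebra_simps)

interpretation Cl: free_rep opP UNIV C_rels
proof
  fix s :: "pspace free_alg" and v :: "occ \<Rightarrow> complex"
  assume "s \<in> C_rels"
  then consider
      x y where "s = letter (p_add x y) - (letter x + letter y)"
    | z x where "s = letter (p_scale z x) - pm_scale z (letter x)"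
    | x y where "s = letter x * letter y + letter y * letter x - pm_scale (- 2 * p_form x y) 1"
    unfolding C_rels_def by blast
  then show "free_act opP s v = (\<lambda>i. 0)"
  proof cases
    case (1 x y)
    then show ?thesis
      by (simp add: free_act_diff free_act_add free_act_letter opP_def p_add.rep_eq distrib_right)
  next
    case (2 z x)
    show ?thesis
      unfolding 2 by (simp add: free_act_diff pm_scale_single letter_def free_act_single opP_def
          p_scale.rep_eq algebra_simps)
  next
    case (3 x y)
    have "s = Poly_Mapping.single (Word [x, y]) 1 + Poly_Mapping.single (Word [y, x]) 1
        - Poly_Mapping.single (Word []) (- 2 * p_form x y)"
      unfolding 3 letter_def by (simp add: mult_single pm_scale_def zero_word_def)
    then show ?thesis
      using opP_anticommutator[of x y v]
      by (simp add: free_act_diff free_act_add free_act_single fun_eq_iff)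
  qed
qed (auto simp: opP_linear)

lift_definition Cp_act :: "Cp \<Rightarrow> (occ \<Rightarrow> complex) \<Rightarrow> occ \<Rightarrow> complex" is "free_act opP"
  by (rule ext, rule Cl.free_act_qcong) auto

lemma Cp_act_simps:
  "Cp_act (x + y) v = (\<lambda>i. Cp_act x v i + Cp_act y v i)"
  "Cp_act (x - y) v = (\<lambda>i. Cp_act x v i - Cp_act y v i)"
  "Cp_act (- x) v = (\<lambda>i. - Cp_act x v i)"
  "Cp_act (x * y) v = Cp_act x (Cp_act y v)"
  "Cp_act (z *\<^sub>C x) v = (\<lambda>i. z * Cp_act x v i)"
  "Cp_act 1 v = v"
  "Cp_act 0 v = (\<lambda>i. 0)"
  by (transfer, simp add: free_act_add free_act_diff free_act_uminus Cl.free_act_mult Cl.free_act_one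
      Cl.free_act_pm_scale)+

lemma Cp_act_C_incl: "Cp_act (C_incl x) v = opP x v"
  unfolding C_incl_def by transfer (simp add: free_act_letter)

lemma Cp_act_\<gamma>:
  "Cp_act (\<gamma> mE1) v = opE1 v" "Cp_act (\<gamma> mE2) v = opE2 v"
  "Cp_act (\<gamma> mF1) v = opF1 v" "Cp_act (\<gamma> mF2) v = opF2 v"
  unfolding \<gamma>_def Cp_act_C_incl opP_def
  by (simp_all add: Abs_pspace_inverse p_space_elements)
     (simp_all add: mE1_def mE2_def mF1_def mF2_def)

lemma C_incl_linear:
  "C_incl (p_add x y) = C_incl x + C_incl y"
  "C_incl (p_scale z x) = z *\<^sub>C C_incl x"
  by (simp_all add: C_incl_def plus_Cp.abs_eq cscale_Cp.abs_eq Cp.abs_eq_iff qcong_def ideal_gen_gen C_relsI)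

lemma C_incl_anticommutator: "C_incl x * C_incl y + C_incl y * C_incl x = (- 2 * p_form x y) *\<^sub>C 1"
  unfolding C_incl_def one_Cp_def plus_Cp.abs_eq times_Cp.abs_eq cscale_Cp.abs_eq Cp.abs_eq_iff qcong_def
  by (rule ideal_gen_gen) (rule C_relsI)

lemma C_incl_expand:
  "C_incl x = Rep_pspace x $ 1 $ 3 *\<^sub>C \<gamma> mE1 + Rep_pspace x $ 2 $ 3 *\<^sub>C \<gamma> mE2
     + Rep_pspace x $ 3 $ 1 *\<^sub>C \<gamma> mF1 + Rep_pspace x $ 3 $ 2 *\<^sub>C \<gamma> mF2"
proof -
  let ?s = "\<lambda>z A. p_scale z (Abs_pspace A)"
  have "x = p_add (p_add (p_add (?s (Rep_pspace x $ 1 $ 3) mE1) (?s (Rep_pspace x $ 2 $ 3) mE2))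
      (?s (Rep_pspace x $ 3 $ 1) mF1)) (?s (Rep_pspace x $ 3 $ 2) mF2)"
    unfolding Rep_pspace_inject[symmetric] p_add.rep_eq p_scale.rep_eq
    by (simp add: Abs_pspace_inverse p_space_elements)
       (simp add: mat3_eq_iff forall_3 Rep_pspace_zero mE1_def mE2_def mF1_def mF2_def)
  then have "C_incl x = C_incl (p_add (p_add (p_add (?s (Rep_pspace x $ 1 $ 3) mE1) (?s (Rep_pspace x $ 2 $ 3) mE2))
      (?s (Rep_pspace x $ 3 $ 1) mF1)) (?s (Rep_pspace x $ 3 $ 2) mF2))"
    by simp
  then show ?thesis by (simp add: C_incl_linear \<gamma>_def)
qed

lemma \<gamma>_anticommutator:
  assumes "A \<in> p_space" "B \<in> p_space"
  shows "\<gamma> A * \<gamma> B + \<gamma> B * \<gamma> A = (- 2 * trace (A ** B)) *\<^sub>C 1"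
  using assms by (simp add: \<gamma>_def C_incl_anticommutator p_form.rep_eq Abs_pspace_inverse)

lemma \<gamma>_square:
  assumes "A \<in> p_space"
  shows "\<gamma> A * \<gamma> A = (- trace (A ** A)) *\<^sub>C 1"
proof -
  have "(1/2) *\<^sub>C (\<gamma> A * \<gamma> A + \<gamma> A * \<gamma> A) = (1/2) *\<^sub>C ((- 2 * trace (A ** A)) *\<^sub>C 1)"
    using \<gamma>_anticommutator[OF assms assms] by simp
  moreover have "(1/2) *\<^sub>C (x + x) = x" for x :: Cp
    by (simp add: cscale_add_right cscale_one flip: cscale_add_left)
  ultimately show ?thesis by (simp add: cscale_cscale)
qed

lemma \<gamma>_swap:
  assumes "A \<in> p_space" "B \<in> p_space"
  shows "\<gamma> A * \<gamma> B = (- 2 * trace (A ** B)) *\<^sub>C 1 - \<gamma> B * \<gamma> A"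
  using \<gamma>_anticommutator[OF assms] by (simp add: eq_diff_eq)

lemma clifford_swap:
  "\<gamma> mE2 * \<gamma> mE1 = - (\<gamma> mE1 * \<gamma> mE2)"
  "\<gamma> mF2 * \<gamma> mF1 = - (\<gamma> mF1 * \<gamma> mF2)"
  "\<gamma> mF1 * \<gamma> mE1 = (- 2) *\<^sub>C 1 - \<gamma> mE1 * \<gamma> mF1"
  "\<gamma> mF2 * \<gamma> mE2 = (- 2) *\<^sub>C 1 - \<gamma> mE2 * \<gamma> mF2"
  "\<gamma> mF1 * \<gamma> mE2 = - (\<gamma> mE2 * \<gamma> mF1)"
  "\<gamma> mF2 * \<gamma> mE1 = - (\<gamma> mE1 * \<gamma> mF2)"
  by (simp_all add: \<gamma>_swap[of mE2 mE1] \<gamma>_swap[of mF2 mF1] \<gamma>_swap[of mF1 mE1] \<gamma>_swap[of mF2 mE2]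
       \<gamma>_swap[of mF1 mE2] \<gamma>_swap[of mF2 mE1] p_space_elements trace_3 mult_nth_3)
     (simp_all add: mE1_def mE2_def mF1_def mF2_def)

lemma clifford_square:
  "\<gamma> mE1 * \<gamma> mE1 = 0" "\<gamma> mE2 * \<gamma> mE2 = 0" "\<gamma> mF1 * \<gamma> mF1 = 0" "\<gamma> mF2 * \<gamma> mF2 = 0"
  by (simp_all add: \<gamma>_square p_space_elements trace_3 mult_nth_3)
     (simp_all add: mE1_def mE2_def mF1_def mF2_def)

text \<open>Lets a rewrite rule for two adjacent generators fire inside a longer right-nested
  product, so that \<open>clifford_rules\<close> brings words into normal order.\<close>

lemma assoc_rule: "a * b = c \<Longrightarrow> a * (b * x) = c * (x :: 'a :: semigroup_mult)"
  by (simp add: mult.assoc[symmetric])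

lemmas clifford_rules = clifford_swap clifford_square
  clifford_swap[THEN assoc_rule] clifford_square[THEN assoc_rule]

definition opt_factor :: "bool \<Rightarrow> 'a::monoid_mult \<Rightarrow> 'a" where "opt_factor a x = (if a then x else 1)"

lemma opt_factor_simps [simp]: "opt_factor True x = x" "opt_factor False x = 1"
  by (simp_all add: opt_factor_def)

fun cbasis :: "occ \<Rightarrow> Cp" where
  "cbasis (a, b, c, d) =
     opt_factor a (\<gamma> mE1) * (opt_factor b (\<gamma> mE2) * (opt_factor c (\<gamma> mF1) * opt_factor d (\<gamma> mF2)))"

definition vacuum :: "occ \<Rightarrow> complex" where
  "vacuum = (\<lambda>(a, b, c, d). if a \<or> b \<or> c \<or> d then 0 else 1)"

text \<open>The operators model left multiplication and \<open>vacuum\<close> stands for 1, so these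
  are the coordinates of \<open>x\<close> in the basis \<open>cbasis\<close>.\<close>

definition cvec :: "Cp \<Rightarrow> occ \<Rightarrow> complex" where "cvec x = Cp_act x vacuum"

lemma cvec_simps:
  "cvec (x + y) i = cvec x i + cvec y i" "cvec (x - y) i = cvec x i - cvec y i"
  "cvec (- x) i = - cvec x i" "cvec (z *\<^sub>C x) i = z * cvec x i" "cvec 0 i = 0"
  by (simp_all add: cvec_def Cp_act_simps)

lemma cvec_sum: "cvec (sum f A) i = (\<Sum>j\<in>A. cvec (f j) i)"
  by (induction A rule: infinite_finite_induct) (simp_all add: cvec_simps)

lemma sum_bool: "(\<Sum>a\<in>UNIV. f a) = f True + (f False :: 'a::comm_monoid_add)"
  by (simp add: UNIV_bool add.commute)

lemma sum_occ:
  "(\<Sum>i\<in>UNIV. f i) = (\<Sum>a\<in>UNIV. \<Sum>b\<in>UNIV. \<Sum>c\<in>UNIV. \<Sum>d\<in>UNIV. f (a, b, c, d :: bool) :: 'a::comm_monoid_add)"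
  by (simp add: UNIV_Times_UNIV[symmetric] sum.cartesian_product' del: UNIV_Times_UNIV)

lemma cvec_cbasis: "cvec (cbasis j) i = (if i = j then 1 else 0)"
proof -
  obtain a b c d where i: "i = (a, b, c, d)" by (cases i)
  obtain a' b' c' d' where j: "j = (a', b', c', d')" by (cases j)
  show ?thesis
    unfolding i j
    by (cases a'; cases b'; cases c'; cases d';
        simp add: cvec_def Cp_act_simps Cp_act_\<gamma>; auto simp: op_defs vacuum_def)
qed

lemma \<gamma>_mult_cbasis:
  "\<gamma> mE1 * (\<Sum>i\<in>UNIV. v i *\<^sub>C cbasis i) = (\<Sum>i\<in>UNIV. opE1 v i *\<^sub>C cbasis i)"
  "\<gamma> mE2 * (\<Sum>i\<in>UNIV. v i *\<^sub>C cbasis i) = (\<Sum>i\<in>UNIV. opE2 v i *\<^sub>C cbasis i)"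
  "\<gamma> mF1 * (\<Sum>i\<in>UNIV. v i *\<^sub>C cbasis i) = (\<Sum>i\<in>UNIV. opF1 v i *\<^sub>C cbasis i)"
  "\<gamma> mF2 * (\<Sum>i\<in>UNIV. v i *\<^sub>C cbasis i) = (\<Sum>i\<in>UNIV. opF2 v i *\<^sub>C cbasis i)"
  by (simp_all add: sum_occ sum_bool distrib_left cscale_mult op_defs clifford_rules
      mult.assoc cscale_minus_left cscale_minus_right cscale_add_left cscale_add_right left_diff_distrib
      right_diff_distrib cscale_diff_right cscale_cscale minus_mult_left[symmetric] minus_mult_right[symmetric] mult.commute)

text \<open>The elements that equal their expansion form a subspace which contains 1 and is stable
  under left multiplication by generators, because the operators were read off from the normally
  ordered products. Together with \<open>cvec_cbasis\<close> this makes \<open>cbasis\<close> a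
  basis.\<close>

lemma Cp_expand: "x = (\<Sum>i\<in>UNIV. cvec x i *\<^sub>C cbasis i)"
proof -
  let ?P = "\<lambda>x. x = (\<Sum>i\<in>UNIV. cvec x i *\<^sub>C cbasis i)"
  have one: "?P 1"
    by (simp add: cvec_def Cp_act_simps vacuum_def sum_occ sum_bool cscale_one)
  have add_closed: "?P (x + y)" if "?P x" "?P y" for x y
  proof -
    have "(\<Sum>i\<in>UNIV. cvec (x + y) i *\<^sub>C cbasis i) = (\<Sum>i\<in>UNIV. cvec x i *\<^sub>C cbasis i) + (\<Sum>i\<in>UNIV. cvec y i *\<^sub>C cbasis i)"
      by (simp add: cvec_simps cscale_add_left sum.distrib)
    with that show ?thesis by metis
  qed
  have scale: "?P (z *\<^sub>C x)" if "?P x" for x z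
  proof -
    have "(\<Sum>i\<in>UNIV. cvec (z *\<^sub>C x) i *\<^sub>C cbasis i) = z *\<^sub>C (\<Sum>i\<in>UNIV. cvec x i *\<^sub>C cbasis i)"
      by (simp add: cvec_simps cscale_sum_right cscale_cscale)
    with that show ?thesis by metis
  qed
  have mult: "?P (C_incl p * x)" if "?P x" for x p
  proof -
    have "C_incl p * (\<Sum>i\<in>UNIV. cvec x i *\<^sub>C cbasis i) = (\<Sum>i\<in>UNIV. opP p (cvec x) i *\<^sub>C cbasis i)"
      by (simp add: C_incl_expand[of p] distrib_right cscale_mult_left \<gamma>_mult_cbasis opP_def
          cscale_add_left sum.distrib cscale_sum_right cscale_cscale)
    also have "opP p (cvec x) = cvec (C_incl p * x)"
      by (simp add: cvec_def Cp_act_simps Cp_act_C_incl)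
    finally show ?thesis using that by simp
  qed
  have word: "?P (abs_Cp (basis_vec (Word xs)))" for xs
  proof (induction xs)
    case Nil
    then show ?case using one by (simp add: one_Cp_def zero_word_def flip: single_one)
  next
    case (Cons p xs)
    have "abs_Cp (basis_vec (Word (p # xs))) = C_incl p * abs_Cp (basis_vec (Word xs))"
      by (simp add: C_incl_def letter_def times_Cp.abs_eq mult_single)
    then show ?case using mult[OF Cons, of p] by simp
  qed
  have "?P (abs_Cp y)" for y
  proof (induction y rule: pm_induct)
    case zero
    show ?case by (simp add: cvec_simps flip: zero_Cp_def)
  next
    case (single m c)
    obtain xs where m: "m = Word xs" by (cases m)
    have "abs_Cp (Poly_Mapping.single m c) = c *\<^sub>C abs_Cp (basis_vec (Word xs))"
      by (simp add: cscale_Cp.abs_eq pm_scale_single m)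
    then show ?case using scale[OF word] by metis
  next
    case (add x y)
    then show ?case using add_closed[of "abs_Cp x" "abs_Cp y"] by (simp only: plus_Cp.abs_eq)
  qed
  then show ?thesis by (metis Quotient_abs_rep Quotient_Cp)
qed

lemma Cp_eqI: "(\<And>i. cvec x i = cvec y i) \<Longrightarrow> x = y"
  by (metis (no_types, lifting) Cp_expand sum.cong)

section \<open>A representation of the enveloping algebra\<close>

text \<open>Polynomial functions of a matrix. Linear functions are written through the trace form
  because differentiation along \<open>X\<close> then only replaces \<open>M\<close> by
  \<open>X ** M\<close>.\<close>

inductive_set mat_pf :: "(mat3 \<Rightarrow> complex) set" where
  const: "(\<lambda>y. c) \<in> mat_pf"
| trace: "(\<lambda>y. trace (y ** M)) \<in> mat_pf"
| add: "f \<in> mat_pf \<Longrightarrow> g \<in> mat_pf \<Longrightarrow> (\<lambda>y. f y + g y) \<in> mat_pf"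
| mult: "f \<in> mat_pf \<Longrightarrow> g \<in> mat_pf \<Longrightarrow> (\<lambda>y. f y * g y) \<in> mat_pf"

text \<open>The line \<open>y (1 + t X)\<close> has the same velocity at 0 as
  \<open>y exp (t X)\<close>, so this is the left invariant vector field of \<open>X\<close>, but
  along the line polynomial functions stay polynomial in \<open>t\<close>.\<close>

definition rderiv :: "mat3 \<Rightarrow> (mat3 \<Rightarrow> complex) \<Rightarrow> mat3 \<Rightarrow> complex" where
  "rderiv X f y = deriv (\<lambda>t. f (y + mscale t (y ** X))) 0"

lemma trace_line: "trace ((y + mscale t Z) ** M) = trace (y ** M) + t * trace ((Z :: mat3) ** M)"
  by (simp add: trace_3 mult_nth_3 algebra_simps)

lemma mat_pf_differentiable:
  "f \<in> mat_pf \<Longrightarrow> (\<lambda>t. f (y + mscale t Z)) field_differentiable at 0"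
proof (induction rule: mat_pf.induct)
  case (trace M)
  then show ?case unfolding trace_line by (intro derivative_intros)
qed (auto intro!: derivative_intros)

lemma rderiv_const: "rderiv X (\<lambda>y. c) = (\<lambda>y. 0)"
  by (rule ext) (simp add: rderiv_def)

lemma rderiv_trace: "rderiv X (\<lambda>y. trace (y ** M)) = (\<lambda>y. trace (y ** (X ** M)))"
proof
  fix y
  have "((\<lambda>t. trace (y ** M) + t * trace (y ** X ** M)) has_field_derivative trace (y ** X ** M)) (at 0)"
    by (auto intro!: derivative_eq_intros)
  then show "rderiv X (\<lambda>y. trace (y ** M)) y = trace (y ** (X ** M))"
    unfolding rderiv_def trace_line by (simp add: DERIV_imp_deriv matrix_mul_assoc)
qed

lemma rderiv_add:
  assumes "f \<in> mat_pf" "g \<in> mat_pf"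
  shows "rderiv X (\<lambda>y. f y + g y) = (\<lambda>y. rderiv X f y + rderiv X g y)"
  unfolding rderiv_def by (rule ext) (intro deriv_add mat_pf_differentiable assms)

lemma mscale_zero [simp]: "mscale 0 A = 0"
  by (simp add: mat3_eq_iff)

lemma rderiv_mult:
  assumes "f \<in> mat_pf" "g \<in> mat_pf"
  shows "rderiv X (\<lambda>y. f y * g y) = (\<lambda>y. f y * rderiv X g y + rderiv X f y * g y)"
  unfolding rderiv_def by (rule ext) (subst deriv_mult, auto intro: mat_pf_differentiable assms)

lemma rderiv_mat_pf: "f \<in> mat_pf \<Longrightarrow> rderiv X f \<in> mat_pf"
proof (induction rule: mat_pf.induct)
  case (mult f g)
  then show ?case by (auto simp: rderiv_mult intro!: mat_pf.intros)
qed (auto simp: rderiv_const rderiv_trace rderiv_add intro!: mat_pf.intros)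

lemma rderiv_scale: "f \<in> mat_pf \<Longrightarrow> rderiv X (\<lambda>y. c * f y) = (\<lambda>y. c * rderiv X f y)"
  by (simp add: rderiv_mult[OF mat_pf.const] rderiv_const)

lemma trace_mult_linear:
  "trace ((y :: mat3) ** (A + B)) = trace (y ** A) + trace (y ** B)"
  "trace ((y :: mat3) ** (A - B)) = trace (y ** A) - trace (y ** B)"
  "trace ((y :: mat3) ** mscale z A) = z * trace (y ** A)"
  by (simp_all add: trace_3 mult_nth_3 algebra_simps)

lemma rderiv_linear:
  assumes "f \<in> mat_pf"
  shows "rderiv (X + Y) f = (\<lambda>y. rderiv X f y + rderiv Y f y)"
    and "rderiv (mscale z X) f = (\<lambda>y. z * rderiv X f y)"
proof -
  have *: "(A + B) ** C = A ** C + B ** C" "mscale z A ** B = mscale z (A ** B)" for A B C :: mat3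
    by (simp_all add: mat3_eq_iff mult_nth_3 algebra_simps)
  show "rderiv (X + Y) f = (\<lambda>y. rderiv X f y + rderiv Y f y)"
    using assms
    by (induction rule: mat_pf.induct)
       (simp_all add: rderiv_const rderiv_trace rderiv_add rderiv_mult * trace_mult_linear algebra_simps)
  show "rderiv (mscale z X) f = (\<lambda>y. z * rderiv X f y)"
    using assms
    by (induction rule: mat_pf.induct)
       (simp_all add: rderiv_const rderiv_trace rderiv_add rderiv_mult * trace_mult_linear algebra_simps)
qed

text \<open>Both sides are derivations in \<open>f\<close>, so it is enough to compare them on
  linear functions, where they are products of matrices.\<close>

lemma rderiv_bracket:
  assumes "f \<in> mat_pf"
  shows "rderiv (X ** Y - Y ** X) f = (\<lambda>y. rderiv X (rderiv Y f) y - rderiv Y (rderiv X f) y)"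
proof -
  have *: "(A - B) ** C = A ** C - B ** C" for A B C :: mat3
    by (simp add: mat3_eq_iff mult_nth_3 algebra_simps)
  show ?thesis
    using assms
  proof (induction rule: mat_pf.induct)
    case (mult f g)
    then show ?case
      by (simp add: rderiv_mult rderiv_add rderiv_mat_pf mat_pf.intros algebra_simps)
  next
    case (add f g)
    then show ?case by (simp add: rderiv_add rderiv_mat_pf algebra_simps)
  qed (simp_all add: rderiv_const rderiv_trace * trace_mult_linear matrix_mul_assoc[symmetric])
qed

text \<open>
  Conjugating the left invariant vector fields \<open>rderiv X\<close> by \<open>exp (s * trace y)\<close>, with \<open>s\<close> a formal
  parameter, adds the multiplication by \<open>s * trace (y ** X)\<close>. A vector is the sequence of the
  coefficients of the powers of \<open>s\<close>; the top coefficient of an element of \<open>U(\<gg>)\<close> applied to \<open>1\<close>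
  is its symbol.
\<close>

definition opU :: "sl3 \<Rightarrow> (nat \<times> mat3 \<Rightarrow> complex) \<Rightarrow> nat \<times> mat3 \<Rightarrow> complex" where
  "opU X v = (\<lambda>(m, y). rderiv (Rep_sl3 X) (\<lambda>y. v (m, y)) y +
     (case m of 0 \<Rightarrow> 0 | Suc m' \<Rightarrow> trace (y ** Rep_sl3 X) * v (m', y)))"

definition mat_pf_seq :: "(nat \<times> mat3 \<Rightarrow> complex) set" where
  "mat_pf_seq = {v. \<forall>m. (\<lambda>y. v (m, y)) \<in> mat_pf}"

lemma opU_nth:
  "opU X v (0, y) = rderiv (Rep_sl3 X) (\<lambda>y. v (0, y)) y"
  "opU X v (Suc m, y) = rderiv (Rep_sl3 X) (\<lambda>y. v (Suc m, y)) y + trace (y ** Rep_sl3 X) * v (m, y)"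
  by (simp_all add: opU_def)

lemma opU_pf_seq:
  assumes "v \<in> mat_pf_seq"
  shows "opU X v \<in> mat_pf_seq"
proof -
  have "(\<lambda>y. opU X v (m, y)) \<in> mat_pf" for m
    using assms by (cases m) (auto simp: mat_pf_seq_def opU_nth intro!: mat_pf.intros rderiv_mat_pf)
  then show ?thesis by (simp add: mat_pf_seq_def)
qed

text \<open>The multiplication operators commute with each other. Differentiating
  \<open>trace (y ** Y)\<close> along \<open>X\<close> gives \<open>trace (y ** (X ** Y))\<close>,
  so the mixed terms add up to the multiplication operator of the bracket.\<close>

lemma opU_commutator:
  assumes v: "v \<in> mat_pf_seq"
  shows "opU X (opU Y v) i - opU Y (opU X v) i = opU (sl3_bracket X Y) v i"
proof -
  obtain m y where i: "i = (m, y)" by (cases i)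
  have mat_pf: "(\<lambda>y. v (m, y)) \<in> mat_pf" for m using v by (simp add: mat_pf_seq_def)
  show ?thesis
    unfolding i
    by (cases m)
       (auto simp: opU_def sl3_bracket.rep_eq mat_pf rderiv_bracket rderiv_add rderiv_mult rderiv_trace
          rderiv_mat_pf mat_pf.intros trace_mult_linear algebra_simps split: nat.split)
qed

interpretation Uact: free_rep opU mat_pf_seq U_rels
proof
  fix s :: "sl3 free_alg" and v :: "nat \<times> mat3 \<Rightarrow> complex"
  assume v: "v \<in> mat_pf_seq"
  then have mat_pf: "(\<lambda>y. v (m, y)) \<in> mat_pf" for m by (simp add: mat_pf_seq_def)
  assume "s \<in> U_rels"
  then consider
      X Y where "s = letter (sl3_add X Y) - (letter X + letter Y)"
    | z X where "s = letter (sl3_scale z X) - pm_scale z (letter X)"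
    | X Y where "s = letter X * letter Y - letter Y * letter X - letter (sl3_bracket X Y)"
    unfolding U_rels_def by blast
  then show "free_act opU s v = (\<lambda>i. 0)"
  proof cases
    case (1 X Y)
    show ?thesis
      unfolding 1
      by (auto simp: free_act_diff free_act_add free_act_letter opU_def sl3_add.rep_eq fun_eq_iff
           rderiv_linear mat_pf trace_mult_linear distrib_right split: nat.split)
  next
    case (2 z X)
    show ?thesis
      unfolding 2
      by (auto simp: free_act_diff pm_scale_single letter_def free_act_single opU_def fun_eq_iff
           sl3_scale.rep_eq rderiv_linear mat_pf trace_mult_linear algebra_simps split: nat.split)
  next
    case (3 X Y)
    have "s = Poly_Mapping.single (Word [X, Y]) 1 - Poly_Mapping.single (Word [Y, X]) 1
        - letter (sl3_bracket X Y)"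
      unfolding 3 letter_def by (simp add: mult_single)
    then show ?thesis
      using opU_commutator[OF v, of X Y]
      by (simp add: free_act_diff free_act_letter free_act_single fun_eq_iff)
  qed
next
  fix a v and w :: "nat \<times> mat3 \<Rightarrow> complex"
  assume vw: "v \<in> mat_pf_seq" "w \<in> mat_pf_seq"
  then show "opU a (\<lambda>i. v i + w i) = (\<lambda>i. opU a v i + opU a w i)"
    by (auto simp: mat_pf_seq_def opU_def rderiv_add fun_eq_iff distrib_left split: nat.split)
next
  fix a z and v :: "nat \<times> mat3 \<Rightarrow> complex"
  assume "v \<in> mat_pf_seq"
  then show "opU a (\<lambda>i. z * v i) = (\<lambda>i. z * opU a v i)"
    by (auto simp: mat_pf_seq_def opU_def rderiv_scale fun_eq_iff algebra_simps split: nat.split)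
qed (auto simp: opU_pf_seq, auto simp: mat_pf_seq_def intro: mat_pf.intros)

definition unit_seq :: "nat \<times> mat3 \<Rightarrow> complex" where
  "unit_seq = (\<lambda>(m, y). if m = 0 then 1 else 0)"

lemma unit_seq: "unit_seq \<in> mat_pf_seq"
  by (auto simp: mat_pf_seq_def unit_seq_def intro: mat_pf.intros)

text \<open>The coefficient of the \<open>n\<close>-th power of the formal parameter. It is the
  symbol of degree \<open>n\<close> only for arguments of filtration degree at most
  \<open>n\<close>.\<close>

lift_definition Usym :: "nat \<Rightarrow> Ug \<Rightarrow> mat3 \<Rightarrow> complex" is "\<lambda>n x y. free_act opU x unit_seq (n, y)"
  using Uact.free_act_qcong[OF _ unit_seq] by (simp add: fun_eq_iff)

lemma Usym_simps:
  "Usym n (u + v) y = Usym n u y + Usym n v y"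
  "Usym n (u - v) y = Usym n u y - Usym n v y"
  "Usym n (z *\<^sub>C u) y = z * Usym n u y"
  "Usym n 0 y = 0"
  by (transfer, simp add: free_act_add free_act_diff Uact.free_act_pm_scale unit_seq)+

lemma Usym_sum: "Usym n (sum f A) y = (\<Sum>i\<in>A. Usym n (f i) y)"
  by (induction A rule: infinite_finite_induct) (simp_all add: Usym_simps)

section \<open>Words and the degree filtration\<close>

definition Uword :: "sl3 list \<Rightarrow> Ug" where "Uword xs = prod_list (map U_incl xs)"

lemma Uword_simps: "Uword [] = 1" "Uword (X # xs) = U_incl X * Uword xs"
  "Uword (xs @ ys) = Uword xs * Uword ys"
  by (simp_all add: Uword_def)

lemma Uword_abs: "Uword xs = abs_Ug (basis_vec (Word xs))"
  by (induction xs)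
     (simp_all add: Uword_simps one_Ug_def U_incl_def letter_def times_Ug.abs_eq mult_single zero_word_def
        flip: single_one)

text \<open>Each letter raises the power of the parameter by at most one. A word of length
  \<open>n\<close> reaches the power \<open>n\<close> only if every letter acts by multiplication,
  and shorter words do not reach it at all.\<close>

lemma Usym_Uword_aux:
  "length xs \<le> n \<Longrightarrow> foldr opU xs unit_seq (n, y) =
     (if length xs = n then (\<Prod>X\<leftarrow>xs. trace (y ** Rep_sl3 X)) else 0)"
proof (induction xs arbitrary: n y)
  case (Cons X xs)
  then obtain m where n: "n = Suc m" "length xs \<le> m" by (cases n) auto
  \<comment> \<open>The shorter word \<open>xs\<close> does not reach the power \<open>n\<close>, so
    the derivative term of the first letter vanishes.\<close>
  have "(\<lambda>y. foldr opU xs unit_seq (n, y)) = (\<lambda>y. 0)" using Cons.IH[of n] n by auto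
  then show ?case using Cons.IH[of m] n by (simp add: opU_nth rderiv_const)
qed (simp add: unit_seq_def)

lemma Usym_Uword:
  "length xs \<le> n \<Longrightarrow> Usym n (Uword xs) y = (if length xs = n then (\<Prod>X\<leftarrow>xs. trace (y ** Rep_sl3 X)) else 0)"
  unfolding Uword_abs by transfer (simp add: free_act_single Usym_Uword_aux)

inductive_set Ufil :: "nat \<Rightarrow> Ug set" for n where
  zero: "0 \<in> Ufil n"
| step: "length xs \<le> n \<Longrightarrow> x \<in> Ufil n \<Longrightarrow> z *\<^sub>C Uword xs + x \<in> Ufil n"

lemma Ufil_scaled_word: "length xs \<le> n \<Longrightarrow> z *\<^sub>C Uword xs \<in> Ufil n"
  using Ufil.step[OF _ Ufil.zero] by fastforce

lemma Ufil_word: "length xs \<le> n \<Longrightarrow> Uword xs \<in> Ufil n"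
  using Ufil_scaled_word[of xs n 1] by (simp add: cscale_one)

lemma Ufil_add: "x \<in> Ufil n \<Longrightarrow> y \<in> Ufil n \<Longrightarrow> x + y \<in> Ufil n"
  by (induction rule: Ufil.induct) (auto simp: add.assoc intro: Ufil.step)

lemma Ufil_scale: "x \<in> Ufil n \<Longrightarrow> z *\<^sub>C x \<in> Ufil n"
  by (induction rule: Ufil.induct) (auto simp: cscale_add_right cscale_cscale intro: Ufil.intros)

lemma Ufil_uminus: "x \<in> Ufil n \<Longrightarrow> - x \<in> Ufil n"
  using Ufil_scale[of x n "- 1"] by (simp add: cscale_minus_left cscale_one)

lemma Ufil_diff: "x \<in> Ufil n \<Longrightarrow> y \<in> Ufil n \<Longrightarrow> x - y \<in> Ufil n"
  using Ufil_add[OF _ Ufil_uminus] by fastforce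

lemma Ufil_mono: "x \<in> Ufil m \<Longrightarrow> m \<le> n \<Longrightarrow> x \<in> Ufil n"
  by (induction rule: Ufil.induct) (auto intro: Ufil.intros)

lemma Ufil_mult: "x \<in> Ufil m \<Longrightarrow> y \<in> Ufil n \<Longrightarrow> x * y \<in> Ufil (m + n)"
proof (induction rule: Ufil.induct)
  case (step xs x z)
  have "Uword xs * y \<in> Ufil (m + n)"
    using step(4) step(1)
  proof (induction rule: Ufil.induct)
    case (step ys y w)
    then have "w *\<^sub>C Uword (xs @ ys) + Uword xs * y \<in> Ufil (m + n)"
      by (intro Ufil.step) auto
    then show ?case by (simp add: distrib_left cscale_mult Uword_simps)
  qed (simp add: Ufil.zero)
  then show ?case using step by (simp add: distrib_right cscale_mult Ufil_add Ufil_scale)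
qed (simp add: Ufil.zero)

lemma Ufil_exists: "\<exists>n. x \<in> Ufil n"
proof -
  have "\<exists>n. abs_Ug y \<in> Ufil n" for y
  proof (induction y rule: pm_induct)
    case zero
    show ?case using Ufil.zero by (auto simp flip: zero_Ug_def)
  next
    case (single m c)
    obtain xs where m: "m = Word xs" by (cases m)
    have "abs_Ug (Poly_Mapping.single m c) = c *\<^sub>C Uword xs"
      by (simp add: cscale_Ug.abs_eq pm_scale_single m Uword_abs)
    then show ?case using Ufil_scaled_word[of xs "length xs" c] by auto
  next
    case (add x y)
    then obtain m n where "abs_Ug x \<in> Ufil m" "abs_Ug y \<in> Ufil n" by blast
    then have "abs_Ug x + abs_Ug y \<in> Ufil (max m n)"
      by (meson Ufil_add Ufil_mono max.cobounded1 max.cobounded2)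
    then show ?case by (auto simp: plus_Ug.abs_eq)
  qed
  then show ?thesis by (metis Quotient_abs_rep Quotient_Ug)
qed

text \<open>On words of full length this is the splitting of a product over a concatenation; if
  either word is too short, both sides vanish.\<close>

lemma Usym_mult:
  assumes "u \<in> Ufil m" "v \<in> Ufil n"
  shows "Usym (m + n) (u * v) y = Usym m u y * Usym n v y"
  using assms(1)
proof (induction rule: Ufil.induct)
  case (step xs x z)
  have "Usym (m + n) (Uword xs * v) y = Usym m (Uword xs) y * Usym n v y"
    using assms(2)
  proof (induction rule: Ufil.induct)
    case (step ys x z)
    with \<open>length xs \<le> m\<close> show ?case
      by (simp add: distrib_left cscale_mult Usym_simps Usym_Uword flip: Uword_simps(3))
  qed (simp add: Usym_simps)
  with step show ?case by (simp add: distrib_right cscale_mult Usym_simps)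
qed (simp add: Usym_simps)

lemma Usym_lower: "u \<in> Ufil m \<Longrightarrow> m < n \<Longrightarrow> Usym n u y = 0"
  by (induction rule: Ufil.induct) (simp_all add: Usym_simps Usym_Uword)

lemma Usym_one: "Usym 0 1 y = 1"
  using Usym_Uword[of "[]" 0 y] by (simp add: Uword_simps)

lemma U_incl_Ufil: "U_incl X \<in> Ufil 1"
  using Ufil_word[of "[X]" 1] by (simp add: Uword_simps)

lemma Usym_U_incl: "Usym 1 (U_incl X) y = trace (y ** Rep_sl3 X)"
  using Usym_Uword[of "[X]" 1] by (simp add: Uword_simps)

lemma U_incl_linear:
  "U_incl (sl3_add x y) = U_incl x + U_incl y"
  "U_incl (sl3_scale z x) = z *\<^sub>C U_incl x"
  by (simp_all add: U_incl_def plus_Ug.abs_eq cscale_Ug.abs_eq Ug.abs_eq_iff qcong_def ideal_gen_gen U_relsI)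

lemma U_incl_bracket: "U_incl X * U_incl Y - U_incl Y * U_incl X = U_incl (sl3_bracket X Y)"
  unfolding U_incl_def minus_Ug.abs_eq times_Ug.abs_eq Ug.abs_eq_iff qcong_def
  by (rule ideal_gen_gen) (rule U_relsI)

text \<open>The associated graded algebra is commutative: exchanging two letters leaves a bracket,
  which is a single letter. The successors in the statement let the degree drop by one without
  truncated subtraction.\<close>

lemma Ufil_commutator:
  assumes "u \<in> Ufil (Suc m)" "v \<in> Ufil (Suc n)"
  shows "u * v - v * u \<in> Ufil (Suc (m + n))"
proof -
  have letter_word: "U_incl X * Uword ys - Uword ys * U_incl X \<in> Ufil (length ys)" for X ys
  proof (induction ys)
    case (Cons Y ys)
    have "U_incl X * Uword (Y # ys) - Uword (Y # ys) * U_incl X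
        = (U_incl X * U_incl Y - U_incl Y * U_incl X) * Uword ys + U_incl Y * (U_incl X * Uword ys - Uword ys * U_incl X)"
      by (simp add: Uword_simps algebra_simps)
    also have "\<dots> \<in> Ufil (1 + length ys)"
      unfolding U_incl_bracket using Cons by (intro Ufil_add Ufil_mult U_incl_Ufil Ufil_word) auto
    finally show ?case by simp
  qed (simp add: Uword_simps Ufil.zero)
  \<comment> \<open>Truncation of the subtraction is harmless: if both words are empty the
    commutator is 0.\<close>
  have word_word: "Uword xs * Uword ys - Uword ys * Uword xs \<in> Ufil (length xs + length ys - 1)" for xs ys
  proof (induction xs)
    case (Cons X xs)
    have eq: "Uword (X # xs) * Uword ys - Uword ys * Uword (X # xs)
        = U_incl X * (Uword xs * Uword ys - Uword ys * Uword xs) + (U_incl X * Uword ys - Uword ys * U_incl X) * Uword xs"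
      by (simp add: Uword_simps algebra_simps)
    show ?case
    proof (cases "xs = [] \<or> ys = []")
      case True
      then show ?thesis using letter_word[of X ys] by (auto simp: Uword_simps Ufil.zero)
    next
      case False
      then have "1 + (length xs + length ys - 1) = length ys + length xs" by (cases xs) auto
      then show ?thesis
        unfolding eq using Ufil_mult[OF U_incl_Ufil Cons, of X] Ufil_mult[OF letter_word Ufil_word[of xs "length xs"], of X ys]
        by (auto intro!: Ufil_add simp: add.commute)
    qed
  qed (simp add: Uword_simps Ufil.zero)
  have word: "Uword xs * v - v * Uword xs \<in> Ufil (Suc (m + n))" if "length xs \<le> Suc m" for xs
    using assms(2)
  proof (induction rule: Ufil.induct)
    case (step ys y z)
    have "Uword xs * (z *\<^sub>C Uword ys + y) - (z *\<^sub>C Uword ys + y) * Uword xs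
        = z *\<^sub>C (Uword xs * Uword ys - Uword ys * Uword xs) + (Uword xs * y - y * Uword xs)"
      by (simp add: algebra_simps cscale_mult cscale_diff_right)
    moreover have "Uword xs * Uword ys - Uword ys * Uword xs \<in> Ufil (Suc (m + n))"
      by (rule Ufil_mono[OF word_word]) (use that step in auto)
    ultimately show ?case using step by (auto intro: Ufil_add Ufil_scale)
  qed (simp add: Ufil.zero)
  show ?thesis
    using assms(1)
  proof (induction rule: Ufil.induct)
    case (step xs x z)
    have "(z *\<^sub>C Uword xs + x) * v - v * (z *\<^sub>C Uword xs + x)
        = z *\<^sub>C (Uword xs * v - v * Uword xs) + (x * v - v * x)"
      by (simp add: algebra_simps cscale_mult cscale_diff_right)
    then show ?case using step word[of xs] by (auto intro: Ufil_add Ufil_scale)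
  qed (simp add: Ufil.zero)
qed

section \<open>The symbol determines an element up to lower order\<close>

text \<open>Induction on the number of variables: for fixed values of the others, the sum is a
  polynomial in the last variable that vanishes everywhere, so each of its coefficients
  vanishes.\<close>

lemma monomials_independent:
  fixes c :: "(nat \<Rightarrow> nat) \<Rightarrow> complex"
  assumes "finite A" "\<And>\<alpha> j. \<alpha> \<in> A \<Longrightarrow> k \<le> j \<Longrightarrow> \<alpha> j = 0"
    and "\<And>z. (\<Sum>\<alpha>\<in>A. c \<alpha> * (\<Prod>j<k. z j ^ \<alpha> j)) = 0" and "\<alpha> \<in> A"
  shows "c \<alpha> = 0"
  using assms
proof (induction k arbitrary: A c \<alpha>)
  case 0
  then have "\<beta> = (\<lambda>j. 0)" if "\<beta> \<in> A" for \<beta> using that by auto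
  with 0(4) have "\<alpha> = (\<lambda>j. 0)" "A = {\<lambda>j. 0}" by auto
  with 0(3) show ?case by auto
next
  case (Suc k)
  define e where "e = \<alpha> k"
  define B where "B = {\<beta> \<in> A. \<beta> k = e}"
  have zero: "(\<Sum>\<beta>\<in>B. c \<beta> * (\<Prod>j<k. z j ^ \<beta> j)) = 0" for z
  proof -
    define P where "P = (\<Sum>\<beta>\<in>A. Polynomial.monom (c \<beta> * (\<Prod>j<k. z j ^ \<beta> j)) (\<beta> k))"
    have "poly P t = 0" for t
      using Suc.prems(3)[of "z(k := t)"]
      by (simp add: P_def poly_sum poly_monom mult.assoc)
    then have "P = 0" using poly_all_0_iff_0 by blast
    then have "coeff P e = 0" by simp
    then show ?thesis
      using Suc.prems(1) by (simp add: P_def coeff_sum B_def sum.inter_filter)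
  qed
  \<comment> \<open>On \<open>B\<close> the last exponent is always \<open>e\<close>; erasing it is
    injective and leaves exponents of monomials in one variable fewer.\<close>
  define red where "red = (\<lambda>\<beta> :: nat \<Rightarrow> nat. \<beta>(k := 0))"
  have inj: "inj_on red B"
  proof (rule inj_onI)
    fix x y assume "x \<in> B" "y \<in> B" "red x = red y"
    then have "x k = y k" "x(k := 0) = y(k := 0)" by (auto simp: B_def red_def)
    then show "x = y" by (metis fun_upd_triv fun_upd_upd)
  qed
  have restore: "(red \<beta>)(k := e) = \<beta>" if "\<beta> \<in> B" for \<beta>
    using that by (auto simp: B_def red_def)
  have "c ((red \<alpha>)(k := e)) = 0"
  proof (rule Suc.IH[of "red ` B" "\<lambda>\<beta>. c (\<beta>(k := e))"])
    show "finite (red ` B)" using Suc.prems(1) by (simp add: B_def)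
    show "\<beta> j = 0" if "\<beta> \<in> red ` B" "k \<le> j" for \<beta> j
      using that Suc.prems(2) by (cases "j = k") (auto simp: red_def B_def)
    show "red \<alpha> \<in> red ` B" using Suc.prems(4) by (simp add: B_def e_def)
    show "(\<Sum>\<beta>\<in>red ` B. c (\<beta>(k := e)) * (\<Prod>j<k. z j ^ \<beta> j)) = 0" for z
      using zero[of z] by (simp add: sum.reindex[OF inj] restore red_def[symmetric])
        (simp add: red_def)
  qed
  then show ?case using restore[of \<alpha>] Suc.prems(4) by (simp add: B_def e_def)
qed

text \<open>Matrices of trace 0 pair with \<open>y\<close> only modulo scalar matrices, so the lower
  right entry can be normalised to 0. Conjugation by the block diagonal group \<open>K\<close>
  preserves this.\<close>

definition ymat :: "(nat \<Rightarrow> complex) \<Rightarrow> mat3" where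
  "ymat z = (\<chi> i j. if i = 1 then (if j = 1 then z 0 else if j = 2 then z 1 else z 4)
                    else if i = 2 then (if j = 1 then z 2 else if j = 2 then z 3 else z 5)
                    else (if j = 1 then z 6 else if j = 2 then z 7 else 0))"

text \<open>The basis of \<open>\<gg>\<close> dual, under the trace form, to the coordinates \<open>z 0, \<dots>, z 7\<close> of \<open>ymat z\<close>.\<close>

definition dual_mat :: "nat \<Rightarrow> mat3" where
  "dual_mat j = [munit 1 1 - munit 3 3, mF, mE, munit 2 2 - munit 3 3, mF1, mF2, mE1, mE2] ! j"

lemma less_8: "(j :: nat) < 8 \<longleftrightarrow> j \<in> {0, 1, 2, 3, 4, 5, 6, 7}"
  by auto

lemma three_distinct [simp]: "(1::3) \<noteq> 2" "(2::3) \<noteq> 1" "(1::3) \<noteq> 3" "(3::3) \<noteq> 1" "(2::3) \<noteq> 3" "(3::3) \<noteq> 2"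
  by simp_all

lemma trace_dual_mat: "j < 8 \<Longrightarrow> trace (dual_mat j) = 0"
  unfolding less_8
  by (auto simp: dual_mat_def trace_3 mF_def mE_def mF1_def mF2_def mE1_def mE2_def)

lemma trace_ymat_dual_mat: "j < 8 \<Longrightarrow> trace (ymat z ** dual_mat j) = z j"
  unfolding less_8
  by (auto simp: dual_mat_def trace_3 mult_nth_3 ymat_def mF_def mE_def mF1_def mF2_def mE1_def mE2_def)

definition dual_elt :: "nat \<Rightarrow> Ug" where "dual_elt j = U_incl (Abs_sl3 (dual_mat j))"

lemma dual_elt_Ufil: "dual_elt j \<in> Ufil 1"
  unfolding dual_elt_def by (rule U_incl_Ufil)

lemma Usym_dual_elt: "j < 8 \<Longrightarrow> Usym 1 (dual_elt j) (ymat z) = z j"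
  unfolding dual_elt_def Usym_U_incl by (simp add: Abs_sl3_inverse trace_dual_mat trace_ymat_dual_mat)

lemma U_incl_zero: "U_incl (Abs_sl3 0) = 0"
proof -
  have "sl3_scale 0 (Abs_sl3 0) = Abs_sl3 0"
    unfolding Rep_sl3_inject[symmetric] sl3_scale.rep_eq
    by (simp add: Abs_sl3_inverse trace_3 mat3_eq_iff)
  then show ?thesis using U_incl_linear(2)[of 0 "Abs_sl3 0"] by simp
qed

lemma Rep_sl3_trace: "trace (Rep_sl3 X) = 0"
  using Rep_sl3[of X] by simp

lemma U_incl_sum:
  assumes "finite J" "\<And>j. j \<in> J \<Longrightarrow> trace (A j) = 0"
  shows "trace (\<Sum>j\<in>J. mscale (c j) (A j)) = 0 \<and>
    U_incl (Abs_sl3 (\<Sum>j\<in>J. mscale (c j) (A j))) = (\<Sum>j\<in>J. c j *\<^sub>C U_incl (Abs_sl3 (A j)))"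
  using assms
proof (induction J rule: finite_induct)
  case (insert j J)
  then have "Abs_sl3 (mscale (c j) (A j) + (\<Sum>j\<in>J. mscale (c j) (A j)))
      = sl3_add (sl3_scale (c j) (Abs_sl3 (A j))) (Abs_sl3 (\<Sum>j\<in>J. mscale (c j) (A j)))"
    unfolding Rep_sl3_inject[symmetric] sl3_scale.rep_eq sl3_add.rep_eq
    by (simp add: Abs_sl3_inverse trace_linear)
  then show ?case using insert by (simp add: U_incl_linear trace_linear)
qed (simp_all add: U_incl_zero trace_3)

lemma U_incl_dual_expand: "\<exists>c. U_incl X = (\<Sum>j<8. c j *\<^sub>C dual_elt j)"
proof -
  let ?X = "Rep_sl3 X"
  define c where "c j = [?X $ 1 $ 1, ?X $ 2 $ 1, ?X $ 1 $ 2, ?X $ 2 $ 2, ?X $ 3 $ 1, ?X $ 3 $ 2, ?X $ 1 $ 3, ?X $ 2 $ 3] ! j" for j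
  have "?X = (\<Sum>j<8. mscale (c j) (dual_mat j))"
  proof -
    have "?X $ 3 $ 3 = trace ?X - ?X $ 2 $ 2 - ?X $ 1 $ 1" by (simp add: trace_3)
    then have "?X $ 3 $ 3 = - ?X $ 2 $ 2 - ?X $ 1 $ 1" by (simp add: Rep_sl3_trace)
    then show ?thesis
      by (simp add: mat3_eq_iff forall_3 numeral_nat lessThan_Suc c_def dual_mat_def mF_def mE_def
          mF1_def mF2_def mE1_def mE2_def)
  qed
  then have "X = Abs_sl3 (\<Sum>j<8. mscale (c j) (dual_mat j))" by (metis Rep_sl3_inverse)
  then show ?thesis
    using U_incl_sum[of "{..<8}" dual_mat c] by (auto simp: trace_dual_mat dual_elt_def)
qed

section \<open>Ordered monomials and the graded pieces\<close>

definition mon_list :: "nat list \<Rightarrow> (nat \<Rightarrow> nat) \<Rightarrow> Ug" where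
  "mon_list js \<alpha> = prod_list (map (\<lambda>j. dual_elt j ^ \<alpha> j) js)"

lemma Ufil_one: "1 \<in> Ufil n"
  using Ufil_word[of "[]" n] by (simp add: Uword_simps)

lemma Ufil_power: "u \<in> Ufil m \<Longrightarrow> u ^ k \<in> Ufil (k * m)"
  by (induction k) (auto intro: Ufil_one Ufil_mult)

lemma dual_elt_power_Ufil: "dual_elt j ^ k \<in> Ufil k"
  using Ufil_power[OF dual_elt_Ufil, of j k] by simp

lemma Usym_power: "u \<in> Ufil m \<Longrightarrow> Usym (k * m) (u ^ k) y = Usym m u y ^ k"
proof (induction k)
  case 0
  then show ?case using Usym_one by simp
next
  case (Suc k)
  then show ?case using Usym_mult[OF _ Ufil_power, of u m u m k y] by simp
qed

lemma mon_list_Ufil: "mon_list js \<alpha> \<in> Ufil (\<Sum>j\<leftarrow>js. \<alpha> j)"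
  by (induction js) (auto simp: mon_list_def intro: Ufil_one Ufil_mult dual_elt_power_Ufil)

lemma Usym_mon_list:
  "(\<And>j. j \<in> set js \<Longrightarrow> j < 8) \<Longrightarrow> Usym (\<Sum>j\<leftarrow>js. \<alpha> j) (mon_list js \<alpha>) (ymat z) = (\<Prod>j\<leftarrow>js. z j ^ \<alpha> j)"
proof (induction js)
  case Nil
  then show ?case by (simp add: mon_list_def Usym_one)
next
  case (Cons j js)
  have "Usym (\<alpha> j) (dual_elt j ^ \<alpha> j) (ymat z) = z j ^ \<alpha> j"
    using Usym_power[OF dual_elt_Ufil, of "\<alpha> j" j "ymat z"] Usym_dual_elt[of j] Cons.prems by simp
  moreover have "mon_list (j # js) \<alpha> = dual_elt j ^ \<alpha> j * mon_list js \<alpha>" by (simp add: mon_list_def)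
  ultimately show ?case
    using Cons Usym_mult[OF dual_elt_power_Ufil[of j "\<alpha> j"] mon_list_Ufil[of js \<alpha>], of "ymat z"] by simp
qed

text \<open>Moving the new letter past the powers in front of its place costs only commutators,
  which lie one step lower in the filtration.\<close>

lemma dual_elt_mult_mon_list:
  assumes "distinct js" "i \<in> set js"
  shows "dual_elt i * mon_list js \<alpha> - mon_list js (\<alpha>(i := Suc (\<alpha> i))) \<in> Ufil (\<Sum>j\<leftarrow>js. \<alpha> j)"
  using assms
proof (induction js)
  case (Cons j js)
  have mon: "mon_list (j # js) \<alpha> = dual_elt j ^ \<alpha> j * mon_list js \<alpha>" for \<alpha> by (simp add: mon_list_def)
  show ?case
  proof (cases "j = i")
    case True
    then have "mon_list js (\<alpha>(i := Suc (\<alpha> i))) = mon_list js \<alpha>"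
      using Cons.prems by (auto simp: mon_list_def intro!: arg_cong[where f = prod_list])
    then show ?thesis unfolding mon by (simp add: True mult.assoc Ufil.zero)
  next
    case False
    let ?d = "dual_elt i * dual_elt j ^ \<alpha> j - dual_elt j ^ \<alpha> j * dual_elt i"
    have eq: "dual_elt i * mon_list (j # js) \<alpha> - mon_list (j # js) (\<alpha>(i := Suc (\<alpha> i)))
        = ?d * mon_list js \<alpha> + dual_elt j ^ \<alpha> j * (dual_elt i * mon_list js \<alpha> - mon_list js (\<alpha>(i := Suc (\<alpha> i))))"
      using False by (simp add: mon algebra_simps)
    have "?d \<in> Ufil (\<alpha> j)"
    proof (cases "\<alpha> j")
      case (Suc a)
      then show ?thesis
        using Ufil_commutator[of "dual_elt i" 0 "dual_elt j ^ \<alpha> j" a] dual_elt_Ufil dual_elt_power_Ufil[of j "\<alpha> j"]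
        by simp
    qed (simp add: Ufil.zero)
    then show ?thesis
      unfolding eq using Ufil_mult[OF _ mon_list_Ufil] Ufil_mult[OF dual_elt_power_Ufil] Cons False
      by (auto intro!: Ufil_add simp del: fun_upd_apply)
  qed
qed simp

text \<open>The filtration step before \<open>n\<close>, with zero in place of step -1. Inductions
  on the degree thus end at the zero element.\<close>

definition Ulow :: "nat \<Rightarrow> Ug set" where
  "Ulow n = (case n of 0 \<Rightarrow> {0} | Suc m \<Rightarrow> Ufil m)"

lemma Ulow_simps [simp]: "Ulow 0 = {0}" "Ulow (Suc m) = Ufil m"
  by (simp_all add: Ulow_def)

lemma Ulow_closed:
  "0 \<in> Ulow n" "x \<in> Ulow n \<Longrightarrow> y \<in> Ulow n \<Longrightarrow> x + y \<in> Ulow n" "x \<in> Ulow n \<Longrightarrow> z *\<^sub>C x \<in> Ulow n"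
  by (cases n; auto intro: Ufil.zero Ufil_add Ufil_scale)+

lemma Ulow_mult: "u \<in> Ufil m \<Longrightarrow> v \<in> Ulow n \<Longrightarrow> u * v \<in> Ulow (m + n)"
  by (cases n) (auto intro: Ufil_mult Ulow_closed)

abbreviation mon :: "(nat \<Rightarrow> nat) \<Rightarrow> Ug" where "mon \<equiv> mon_list [0..<8]"

definition expo :: "nat \<Rightarrow> (nat \<Rightarrow> nat) set" where
  "expo n = {\<alpha>. (\<Sum>j<8. \<alpha> j) = n \<and> (\<forall>j\<ge>8. \<alpha> j = 0)}"

lemma sum_list_upt_8: "(\<Sum>j\<leftarrow>[0..<8]. \<alpha> j) = (\<Sum>j<8. \<alpha> j)" for \<alpha> :: "nat \<Rightarrow> nat"
  by (simp add: sum_list_distinct_conv_sum_set atLeast0LessThan)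

lemma prod_list_upt_8: "(\<Prod>j\<leftarrow>[0..<8]. f j) = (\<Prod>j<8. f j)" for f :: "nat \<Rightarrow> complex"
  using prod.distinct_set_conv_list[of "[0..<8]" f] by (simp add: atLeast0LessThan)

definition ordered_mod :: "nat \<Rightarrow> Ug set" where
  "ordered_mod n = {u. \<exists>p. Poly_Mapping.keys p \<subseteq> expo n \<and> u - lin_ext mon p \<in> Ulow n}"

lemma ordered_mod_low: "u \<in> Ulow n \<Longrightarrow> u \<in> ordered_mod n"
  unfolding ordered_mod_def by (auto intro!: exI[of _ 0])

lemma ordered_mod_add:
  assumes "u \<in> ordered_mod n" "v \<in> ordered_mod n" shows "u + v \<in> ordered_mod n"
proof -
  obtain p q where p: "Poly_Mapping.keys p \<subseteq> expo n" "u - lin_ext mon p \<in> Ulow n"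
    and q: "Poly_Mapping.keys q \<subseteq> expo n" "v - lin_ext mon q \<in> Ulow n"
    using assms unfolding ordered_mod_def by blast
  have "Poly_Mapping.keys (p + q) \<subseteq> expo n" using keys_add[of p q] p(1) q(1) by blast
  moreover have "u + v - lin_ext mon (p + q) \<in> Ulow n"
    using Ulow_closed(2)[OF p(2) q(2)] by (simp add: lin_ext_add algebra_simps)
  ultimately show ?thesis unfolding ordered_mod_def by blast
qed

lemma ordered_mod_mon: "\<alpha> \<in> expo n \<Longrightarrow> z *\<^sub>C mon \<alpha> \<in> ordered_mod n"
  unfolding ordered_mod_def
  by (auto intro!: exI[of _ "Poly_Mapping.single \<alpha> z"] Ulow_closed split: if_splits)

lemma ordered_mod_scale:
  assumes "u \<in> ordered_mod n" shows "z *\<^sub>C u \<in> ordered_mod n"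
proof -
  obtain p where p: "Poly_Mapping.keys p \<subseteq> expo n" "u - lin_ext mon p \<in> Ulow n"
    using assms unfolding ordered_mod_def by blast
  have 1: "z *\<^sub>C (u - lin_ext mon p) \<in> ordered_mod n"
    using Ulow_closed(3)[OF p(2)] by (rule ordered_mod_low)
  have "(\<Sum>\<alpha>\<in>A. (z * Poly_Mapping.lookup p \<alpha>) *\<^sub>C mon \<alpha>) \<in> ordered_mod n" if "finite A" "A \<subseteq> expo n" for A
    using that
    by (induction A rule: finite_induct) (auto intro: ordered_mod_low Ulow_closed ordered_mod_add ordered_mod_mon)
  from this[OF finite_keys p(1)] have 2: "z *\<^sub>C lin_ext mon p \<in> ordered_mod n"
    by (simp add: lin_ext_def cscale_sum_right cscale_cscale)
  show ?thesis using ordered_mod_add[OF 1 2] by (simp flip: cscale_add_right)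
qed

lemma ordered_mod_sum: "(\<And>i. i \<in> I \<Longrightarrow> f i \<in> ordered_mod n) \<Longrightarrow> sum f I \<in> ordered_mod n"
  by (induction I rule: infinite_finite_induct) (auto intro: ordered_mod_low Ulow_closed ordered_mod_add)

lemma dual_elt_mult_mon:
  assumes "\<alpha> \<in> expo n" "i < 8" shows "dual_elt i * mon \<alpha> \<in> ordered_mod (Suc n)"
proof -
  let ?\<beta> = "\<alpha>(i := Suc (\<alpha> i))"
  have "(\<Sum>j<8. ?\<beta> j) = Suc (\<Sum>j<8. \<alpha> j)"
    using assms(2) by (simp add: sum.remove[of "{..<8}" i])
  then have "?\<beta> \<in> expo (Suc n)" using assms by (auto simp: expo_def)
  moreover have "dual_elt i * mon \<alpha> - mon ?\<beta> \<in> Ulow (Suc n)"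
    using dual_elt_mult_mon_list[of "[0..<8]" i \<alpha>] assms by (simp add: sum_list_upt_8 expo_def)
  ultimately show ?thesis
    using ordered_mod_add[OF ordered_mod_low ordered_mod_mon[of ?\<beta> "Suc n" 1],
        of "dual_elt i * mon \<alpha> - mon ?\<beta>"] by (simp add: cscale_one)
qed

lemma U_incl_mult_ordered_mod:
  assumes "u \<in> ordered_mod n" shows "U_incl X * u \<in> ordered_mod (Suc n)"
proof -
  obtain p where p: "Poly_Mapping.keys p \<subseteq> expo n" "u - lin_ext mon p \<in> Ulow n"
    using assms unfolding ordered_mod_def by blast
  obtain c where c: "U_incl X = (\<Sum>j<8. c j *\<^sub>C dual_elt j)" using U_incl_dual_expand by blast
  have 1: "U_incl X * (u - lin_ext mon p) \<in> ordered_mod (Suc n)"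
    using Ulow_mult[OF U_incl_Ufil p(2)] by (auto intro: ordered_mod_low)
  have 2: "U_incl X * lin_ext mon p \<in> ordered_mod (Suc n)"
    unfolding c lin_ext_def sum_product using p(1)
    by (auto simp: cscale_mult intro!: ordered_mod_sum ordered_mod_scale dual_elt_mult_mon)
  show ?thesis using ordered_mod_add[OF 1 2] by (simp flip: distrib_left)
qed

lemma Uword_ordered_mod: "Uword xs \<in> ordered_mod (length xs)"
proof (induction xs)
  case Nil
  have "mon_list js (\<lambda>j. 0) = 1" for js by (induction js) (simp_all add: mon_list_def)
  moreover have "(\<lambda>j. 0) \<in> expo 0" by (simp add: expo_def)
  ultimately show ?case using ordered_mod_mon[of "\<lambda>j. 0" 0 1] by (simp add: Uword_simps cscale_one)
qed (simp add: Uword_simps U_incl_mult_ordered_mod)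

lemma Ufil_ordered_mod: "u \<in> Ufil n \<Longrightarrow> u \<in> ordered_mod n"
proof (induction rule: Ufil.induct)
  case (step xs x z)
  have "Uword xs \<in> ordered_mod n"
  proof (cases "length xs = n")
    case False
    with step(1) have "Uword xs \<in> Ulow n" by (cases n) (auto intro: Ufil_word)
    then show ?thesis by (rule ordered_mod_low)
  qed (use Uword_ordered_mod in auto)
  then show ?case using step by (auto intro: ordered_mod_add ordered_mod_scale)
qed (auto intro: ordered_mod_low Ulow_closed)

text \<open>This is where the Poincare-Birkhoff-Witt theorem enters: modulo lower degree,
  \<open>u\<close> is a combination of ordered monomials, whose symbols are distinct monomials in
  the coordinates, so a vanishing symbol makes every coefficient vanish.\<close>

lemma Usym_eq_0_imp_Ulow:
  assumes u: "u \<in> Ufil n" and zero: "\<And>z. Usym n u (ymat z) = 0"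
  shows "u \<in> Ulow n"
proof -
  obtain p where p: "Poly_Mapping.keys p \<subseteq> expo n" "u - lin_ext mon p \<in> Ulow n"
    using Ufil_ordered_mod[OF u] unfolding ordered_mod_def by blast
  have low: "Usym n v y = 0" if "v \<in> Ulow n" for v y
    using that by (cases n) (auto simp: Usym_simps Usym_lower)
  have "(\<Sum>\<alpha>\<in>Poly_Mapping.keys p. Poly_Mapping.lookup p \<alpha> * (\<Prod>j<8. z j ^ \<alpha> j)) = 0" for z
  proof -
    have "Usym n (mon \<alpha>) (ymat z) = (\<Prod>j<8. z j ^ \<alpha> j)" if "\<alpha> \<in> Poly_Mapping.keys p" for \<alpha>
      using that p(1) Usym_mon_list[of "[0..<8]" \<alpha> z] by (auto simp: sum_list_upt_8 prod_list_upt_8 expo_def)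
    then have "(\<Sum>\<alpha>\<in>Poly_Mapping.keys p. Poly_Mapping.lookup p \<alpha> * (\<Prod>j<8. z j ^ \<alpha> j)) = Usym n (lin_ext mon p) (ymat z)"
      by (simp add: lin_ext_def Usym_sum Usym_simps)
    also have "\<dots> = 0" using low[OF p(2), of "ymat z"] zero[of z] by (simp add: Usym_simps)
    finally show ?thesis .
  qed
  from monomials_independent[OF finite_keys _ this] p(1)
  have "Poly_Mapping.lookup p \<alpha> = 0" if "\<alpha> \<in> Poly_Mapping.keys p" for \<alpha>
    using that by (auto simp: expo_def)
  then have "p = 0" by (metis in_keys_iff poly_mapping_eqI lookup_zero)
  then show ?thesis using p(2) by simp
qed

section \<open>Polynomial functions\<close>

type_synonym point = "nat \<Rightarrow> complex"

inductive_set PF :: "(point \<Rightarrow> complex) set" where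
  const: "(\<lambda>z. c) \<in> PF"
| var: "(\<lambda>z. z j) \<in> PF"
| add: "f \<in> PF \<Longrightarrow> g \<in> PF \<Longrightarrow> (\<lambda>z. f z + g z) \<in> PF"
| mult: "f \<in> PF \<Longrightarrow> g \<in> PF \<Longrightarrow> (\<lambda>z. f z * g z) \<in> PF"

lemma PF_uminus: "f \<in> PF \<Longrightarrow> (\<lambda>z. - f z) \<in> PF"
  using PF.mult[OF PF.const[of "- 1"]] by simp

lemma PF_diff: "f \<in> PF \<Longrightarrow> g \<in> PF \<Longrightarrow> (\<lambda>z. f z - g z) \<in> PF"
  using PF.add[OF _ PF_uminus] by simp

lemmas PF_intros = PF.intros PF_uminus PF_diff

lemma PF_comp: "f \<in> PF \<Longrightarrow> (\<And>j. g j \<in> PF) \<Longrightarrow> (\<lambda>z. f (\<lambda>j. g j z)) \<in> PF"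
  by (induction rule: PF.induct) (auto intro: PF.intros)

lemma PF_poly_curve:
  assumes "f \<in> PF" shows "\<exists>Q. \<forall>t. f (\<lambda>j. poly (P j) t) = poly Q t"
  using assms
proof (induction rule: PF.induct)
  case (const c)
  show ?case by (rule exI[of _ "[:c:]"]) simp
next
  case (add f g)
  then show ?case by (metis poly_add)
next
  case (mult f g)
  then show ?case by (metis poly_mult)
qed auto

text \<open>Meant for one-parameter tori: these multiply each coordinate by \<open>t\<close>, 1 or
  \<open>1 / t\<close>, so each becomes a polynomial in \<open>t\<close> divided by
  \<open>t\<close>.\<close>

lemma PF_laurent_curve:
  assumes "f \<in> PF" shows "\<exists>N Q. \<forall>t. t \<noteq> 0 \<longrightarrow> f (\<lambda>j. poly (P j) t / t) * t ^ N = poly Q t"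
  using assms
proof (induction rule: PF.induct)
  case (const c)
  show ?case by (rule exI[of _ 0], rule exI[of _ "[:c:]"]) simp
next
  case (var j)
  show ?case by (rule exI[of _ 1], rule exI[of _ "P j"]) simp
next
  case (add f g)
  then obtain N Q M R where
    "\<forall>t. t \<noteq> 0 \<longrightarrow> f (\<lambda>j. poly (P j) t / t) * t ^ N = poly Q t"
    "\<forall>t. t \<noteq> 0 \<longrightarrow> g (\<lambda>j. poly (P j) t / t) * t ^ M = poly R t" by blast
  note * = this[rule_format, symmetric]
  show ?case
    by (rule exI[of _ "N + M"], rule exI[of _ "Q * Polynomial.monom 1 M + R * Polynomial.monom 1 N"])
       (simp add: poly_monom * power_add algebra_simps)
next
  case (mult f g)
  then obtain N Q M R where
    "\<forall>t. t \<noteq> 0 \<longrightarrow> f (\<lambda>j. poly (P j) t / t) * t ^ N = poly Q t"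
    "\<forall>t. t \<noteq> 0 \<longrightarrow> g (\<lambda>j. poly (P j) t / t) * t ^ M = poly R t" by blast
  note * = this[rule_format, symmetric]
  show ?case
    by (rule exI[of _ "N + M"], rule exI[of _ "Q * R"]) (simp add: * power_add algebra_simps)
qed

text \<open>On the line through \<open>z\<close> and \<open>z0\<close> the product of
  \<open>f\<close> and \<open>g\<close> is a zero polynomial in one variable, and \<open>g\<close>
  is not.\<close>

lemma PF_zero_dense:
  assumes "f \<in> PF" "g \<in> PF" "g z0 \<noteq> 0" "\<And>z. g z \<noteq> 0 \<Longrightarrow> f z = 0"
  shows "f z = 0"
proof -
  let ?P = "\<lambda>j. [:z j, z0 j - z j:]"
  obtain Q where Q: "\<And>t. f (\<lambda>j. poly (?P j) t) = poly Q t" using PF_poly_curve[OF assms(1), of ?P] by blast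
  obtain R where R: "\<And>t. g (\<lambda>j. poly (?P j) t) = poly R t" using PF_poly_curve[OF assms(2), of ?P] by blast
  have "poly (Q * R) t = 0" for t
    using assms(4)[of "\<lambda>j. poly (?P j) t"] Q[of t] R[of t] by (auto simp del: poly_pCons)
  then have "Q * R = 0" using poly_all_0_iff_0 by blast
  moreover have "poly R 1 \<noteq> 0" using R[of 1] assms(3) by simp
  ultimately have "Q = 0" by auto
  then show ?thesis using Q[of 0] by simp
qed

lemma PF_eq_dense:
  assumes "f \<in> PF" "h \<in> PF" "g \<in> PF" "g z0 \<noteq> 0" "\<And>z. g z \<noteq> 0 \<Longrightarrow> f z = h z"
  shows "f z = h z"
  using PF_zero_dense[of "\<lambda>z. f z - h z" g z0 z] assms PF_diff by simp

lemma PF_divide: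
  assumes "f \<in> PF" shows "\<exists>q\<in>PF. \<forall>z. f z = f (z(j := 0)) + z j * q z"
  using assms
proof (induction rule: PF.induct)
  case (const c)
  show ?case by (rule bexI[of _ "\<lambda>z. 0"]) (auto intro: PF.intros)
next
  case (var i)
  show ?case
    by (rule bexI[of _ "\<lambda>z. if i = j then 1 else 0"]) (auto intro: PF.intros)
next
  case (add f g)
  then obtain q r where q: "q \<in> PF" "\<forall>z. f z = f (z(j := 0)) + z j * q z"
    and r: "r \<in> PF" "\<forall>z. g z = g (z(j := 0)) + z j * r z" by blast
  have "f z + g z = f (z(j := 0)) + g (z(j := 0)) + z j * (q z + r z)" for z
  proof -
    have "f z + g z = f (z(j := 0)) + z j * q z + (g (z(j := 0)) + z j * r z)"
      by (rule arg_cong2[where f = "(+)", OF q(2)[rule_format] r(2)[rule_format]])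
    then show ?thesis by (simp only: algebra_simps)
  qed
  then show ?case using PF.add[OF q(1) r(1)] by (intro bexI[of _ "\<lambda>z. q z + r z"] allI)
next
  case (mult f g)
  then obtain q r where q: "q \<in> PF" "\<forall>z. f z = f (z(j := 0)) + z j * q z"
    and r: "r \<in> PF" "\<forall>z. g z = g (z(j := 0)) + z j * r z" by blast
  have "f z * g z = f (z(j := 0)) * g (z(j := 0)) + z j * (q z * g z + f (z(j := 0)) * r z)" for z
  proof -
    have split: "x * y = x0 * y0 + t * (a * y + x0 * b)" if "x = x0 + t * a" "y = y0 + t * b"
      for x y x0 y0 t a b :: complex
      unfolding that by (simp add: algebra_simps)
    show ?thesis by (rule split[OF q(2)[rule_format] r(2)[rule_format]])
  qed
  moreover have "(\<lambda>z. f (\<lambda>i. (z(j := 0)) i)) \<in> PF"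
  proof (rule PF_comp[OF mult.hyps(1)])
    show "(\<lambda>z. (z(j := 0)) i) \<in> PF" for i by (cases "i = j") (auto intro: PF.intros)
  qed
  ultimately show ?case
    using PF.add[OF PF.mult[OF q(1) mult.hyps(2)] PF.mult[OF _ r(1)]]
    by (intro bexI[of _ "\<lambda>z. q z * g z + f (z(j := 0)) * r z"] allI)
qed

section \<open>Covariants of \<open>GL(2)\<close>\<close>

text \<open>
  A point is a tuple \<open>(A, u, v, \<lambda>, \<mu>)\<close> of a matrix \<open>A = ((z 0, z 1), (z 2, z 3))\<close>, the columns
  \<open>u = (z 4, z 5)\<close>, \<open>\<mu> = (z 10, z 11)\<close> and the rows \<open>v = (z 6, z 7)\<close>, \<open>\<lambda> = (z 8, z 9)\<close>. An
  invertible matrix \<open>k = ((a, b), (c, d))\<close> with inverse \<open>k' = ((a', b'), (c', d'))\<close> sends it to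
  \<open>(k A k', k u, v k', \<lambda> k', k \<mu>)\<close>.
\<close>

definition gl_act where
  "gl_act a b c d a' b' c' d' z = (\<lambda>j :: nat. if j < 12 then
     [(a * z 0 + b * z 2) * a' + (a * z 1 + b * z 3) * c',
      (a * z 0 + b * z 2) * b' + (a * z 1 + b * z 3) * d',
      (c * z 0 + d * z 2) * a' + (c * z 1 + d * z 3) * c',
      (c * z 0 + d * z 2) * b' + (c * z 1 + d * z 3) * d',
      a * z 4 + b * z 5, c * z 4 + d * z 5,
      z 6 * a' + z 7 * c', z 6 * b' + z 7 * d',
      z 8 * a' + z 9 * c', z 8 * b' + z 9 * d',
      a * z 10 + b * z 11, c * z 10 + d * z 11] ! j else z j :: complex)"

lemma gl_act_nth:
  "gl_act a b c d a' b' c' d' z 0 = (a * z 0 + b * z 2) * a' + (a * z 1 + b * z 3) * c'"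
  "gl_act a b c d a' b' c' d' z (Suc 0) = (a * z 0 + b * z 2) * b' + (a * z 1 + b * z 3) * d'"
  "gl_act a b c d a' b' c' d' z 2 = (c * z 0 + d * z 2) * a' + (c * z 1 + d * z 3) * c'"
  "gl_act a b c d a' b' c' d' z 3 = (c * z 0 + d * z 2) * b' + (c * z 1 + d * z 3) * d'"
  "gl_act a b c d a' b' c' d' z 4 = a * z 4 + b * z 5"
  "gl_act a b c d a' b' c' d' z 5 = c * z 4 + d * z 5"
  "gl_act a b c d a' b' c' d' z 6 = z 6 * a' + z 7 * c'"
  "gl_act a b c d a' b' c' d' z 7 = z 6 * b' + z 7 * d'"
  "gl_act a b c d a' b' c' d' z 8 = z 8 * a' + z 9 * c'"
  "gl_act a b c d a' b' c' d' z 9 = z 8 * b' + z 9 * d'"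
  "gl_act a b c d a' b' c' d' z 10 = a * z 10 + b * z 11"
  "gl_act a b c d a' b' c' d' z 11 = c * z 10 + d * z 11"
  by (simp_all add: gl_act_def)

lemma less_12_cases:
  assumes "(j :: nat) < 12" shows "j \<in> {0, 1, 2, 3, 4, 5, 6, 7, 8, 9, 10, 11}"
proof -
  have "j \<in> set [0..<12]" using assms by simp
  also have "[0..<12] = [0, 1, 2, 3, 4, 5, 6, 7, 8, 9, 10, 11]" by (simp add: upt_rec)
  finally show ?thesis by simp
qed

lemma gl_act_ge: "\<not> j < 12 \<Longrightarrow> gl_act a b c d a' b' c' d' z j = z j"
  by (simp add: gl_act_def)

lemma point_eqI:
  fixes z w :: "nat \<Rightarrow> complex"
  assumes "z 0 = w 0" "z 1 = w 1" "z 2 = w 2" "z 3 = w 3" "z 4 = w 4" "z 5 = w 5" "z 6 = w 6" "z 7 = w 7"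
    "z 8 = w 8" "z 9 = w 9" "z 10 = w 10" "z 11 = w 11" "\<And>j. \<not> j < 12 \<Longrightarrow> z j = w j"
  shows "z = w"
proof
  fix j show "z j = w j"
    using assms(1-12) assms(13)[of j] less_12_cases[of j]
    by (cases "j < 12") (auto simp only: insert_iff empty_iff simp_thms)
qed

lemma gl_act_comp:
  "gl_act a b c d a' b' c' d' (gl_act p q r s p' q' r' s' z) =
   gl_act (a * p + b * r) (a * q + b * s) (c * p + d * r) (c * q + d * s)
     (p' * a' + q' * c') (p' * b' + q' * d') (r' * a' + s' * c') (r' * b' + s' * d') z"
  by (rule point_eqI; simp add: gl_act_nth gl_act_ge algebra_simps)

lemma gl_act_cong:
  "a = p \<Longrightarrow> b = q \<Longrightarrow> c = r \<Longrightarrow> d = s \<Longrightarrow> a' = p' \<Longrightarrow> b' = q' \<Longrightarrow> c' = r' \<Longrightarrow> d' = s' \<Longrightarrow>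
   gl_act a b c d a' b' c' d' z = gl_act p q r s p' q' r' s' z"
  by simp

definition unitary2 :: "complex \<Rightarrow> complex \<Rightarrow> complex \<Rightarrow> complex \<Rightarrow> bool" where
  "unitary2 a b c d \<longleftrightarrow> a * cnj a + b * cnj b = 1 \<and> a * cnj c + b * cnj d = 0 \<and>
     c * cnj a + d * cnj b = 0 \<and> c * cnj c + d * cnj d = 1 \<and>
     cnj a * a + cnj c * c = 1 \<and> cnj a * b + cnj c * d = 0 \<and>
     cnj b * a + cnj d * c = 0 \<and> cnj b * b + cnj d * d = 1"

abbreviation u_act where "u_act a b c d \<equiv> gl_act a b c d (cnj a) (cnj c) (cnj b) (cnj d)"

definition unitary_invariant :: "(point \<Rightarrow> complex) \<Rightarrow> bool" where
  "unitary_invariant f \<longleftrightarrow> (\<forall>a b c d z. unitary2 a b c d \<longrightarrow>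
     f (u_act a b c d z) = f z)"

section \<open>From the unitary group to invertible matrices\<close>

lemma infinite_unit_circle: "infinite {t :: complex. norm t = 1}"
proof
  assume "finite {t :: complex. norm t = 1}"
  moreover have "inj_on cis {0..<1}"
  proof (rule inj_onI)
    fix x y :: real assume "x \<in> {0..<1}" "y \<in> {0..<1}" "cis x = cis y"
    moreover from this have "cos x = cos y" by (metis cis.sel(1))
    ultimately show "x = y" using cos_inj_pi[of x y] pi_gt3 by simp
  qed
  moreover have "cis ` {0..<1} \<subseteq> {t. norm t = 1}" by auto
  ultimately have "finite {0..<1 :: real}" by (meson finite_imageD finite_subset)
  then show False using infinite_Ico[of 0 "1 :: real"] by simp
qed

text \<open>A Laurent polynomial that is constant on the infinite set of numbers of modulus 1 is
  constant. This passes from the compact torus to the complex one.\<close>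

lemma laurent_constant:
  assumes f: "f \<in> PF" and unit: "\<And>t. norm t = 1 \<Longrightarrow> f (\<lambda>j. poly (P j) t / t) = w" and "t \<noteq> 0"
  shows "f (\<lambda>j. poly (P j) t / t) = w"
proof -
  obtain N Q where Q: "\<And>t. t \<noteq> 0 \<Longrightarrow> f (\<lambda>j. poly (P j) t / t) * t ^ N = poly Q t"
    using PF_laurent_curve[OF f] by blast
  let ?R = "Q - Polynomial.monom w N"
  have "{t. norm t = 1} \<subseteq> {t. poly ?R t = 0}"
  proof
    fix t :: complex assume t: "t \<in> {t. norm t = 1}"
    then have "t \<noteq> 0" by auto
    then show "t \<in> {t. poly ?R t = 0}" using t Q[of t] unit[of t] by (simp add: poly_monom)
  qed
  then have "infinite {t. poly ?R t = 0}" using infinite_unit_circle infinite_super by blast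
  then have "?R = 0" using poly_roots_finite by blast
  then have "poly Q t = w * t ^ N" by (simp add: poly_monom)
  then show ?thesis using Q[OF \<open>t \<noteq> 0\<close>] \<open>t \<noteq> 0\<close> by simp
qed

lemma unit_cnj: "norm t = 1 \<Longrightarrow> t * cnj t = 1 \<and> cnj t = 1 / t"
proof -
  assume "norm t = 1"
  then have "t * cnj t = 1" by (simp add: complex_norm_square[symmetric])
  moreover from this have "t \<noteq> 0" by auto
  ultimately show ?thesis by (simp add: field_simps)
qed

lemma unitary_invariant_torus:
  assumes f: "f \<in> PF" "unitary_invariant f" and "s \<noteq> 0" "t \<noteq> 0"
  shows "f (gl_act s 0 0 t (1 / s) 0 0 (1 / t) z) = f z"
proof -
  have 1: "f (gl_act s 0 0 1 (1 / s) 0 0 1 z) = f z" if "s \<noteq> 0" for s z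
  proof -
    \<comment> \<open>The power of \<open>t\<close> is the weight of the coordinate plus one, since
      everything is divided by \<open>t\<close> afterwards. Fixed coordinates, including those from
      12 on, therefore get the factor \<open>t\<close>.\<close>
    define P where "P j = [[:0, z 0:], [:0, 0, z 1:], [:z 2:], [:0, z 3:], [:0, 0, z 4:], [:0, z 5:], [:z 6:], [:0, z 7:],
        [:z 8:], [:0, z 9:], [:0, 0, z 10:], [:0, z 11:]] ! j" for j
    define P' where "P' j = (if j < 12 then P j else [:0, z j:])" for j
    have eq: "gl_act t 0 0 1 (1 / t) 0 0 1 z = (\<lambda>j. poly (P' j) t / t)" if "t \<noteq> 0" for t
      by (rule point_eqI) (use that in \<open>simp_all add: gl_act_nth P'_def P_def gl_act_def\<close>)
    have "f (\<lambda>j. poly (P' j) t / t) = f z" if "norm t = 1" for t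
    proof -
      have t: "t \<noteq> 0" and u: "unitary2 t 0 0 1" using that unit_cnj[of t] by (auto simp: unitary2_def mult.commute)
      show ?thesis
        using f(2)[unfolded unitary_invariant_def, rule_format, OF u, of z] unit_cnj[OF that]
        by (simp add: t flip: eq)
    qed
    from laurent_constant[OF f(1) this \<open>s \<noteq> 0\<close>] show ?thesis by (simp add: eq that)
  qed
  have 2: "f (gl_act 1 0 0 s 1 0 0 (1 / s) z) = f z" if "s \<noteq> 0" for s z
  proof -
    define P where "P j = [[:0, z 0:], [:z 1:], [:0, 0, z 2:], [:0, z 3:], [:0, z 4:], [:0, 0, z 5:], [:0, z 6:], [:z 7:],
        [:0, z 8:], [:z 9:], [:0, z 10:], [:0, 0, z 11:]] ! j" for j
    define P' where "P' j = (if j < 12 then P j else [:0, z j:])" for j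
    have eq: "gl_act 1 0 0 t 1 0 0 (1 / t) z = (\<lambda>j. poly (P' j) t / t)" if "t \<noteq> 0" for t
      by (rule point_eqI) (use that in \<open>simp_all add: gl_act_nth P'_def P_def gl_act_def\<close>)
    have "f (\<lambda>j. poly (P' j) t / t) = f z" if "norm t = 1" for t
    proof -
      have t: "t \<noteq> 0" and u: "unitary2 1 0 0 t" using that unit_cnj[of t] by (auto simp: unitary2_def mult.commute)
      show ?thesis
        using f(2)[unfolded unitary_invariant_def, rule_format, OF u, of z] unit_cnj[OF that]
        by (simp add: t flip: eq)
    qed
    from laurent_constant[OF f(1) this \<open>s \<noteq> 0\<close>] show ?thesis by (simp add: eq that)
  qed
  show ?thesis
    using 1[OF \<open>s \<noteq> 0\<close>, of "gl_act 1 0 0 t 1 0 0 (1 / t) z"] 2[OF \<open>t \<noteq> 0\<close>, of z]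
    by (simp add: gl_act_comp)
qed

text \<open>
  The group generated by the complex torus and the unitary matrix \<open>((1, 1), (1, -1)) / sqrt 2\<close>
  contains \<open>((1, q), (q, 1))\<close>, hence every invertible matrix without zero entries.
\<close>

lemma unitary_invariant_imp_gl_invariant:
  assumes f: "f \<in> PF" "unitary_invariant f"
    and nz: "a \<noteq> 0" "b \<noteq> 0" "c \<noteq> 0" "d \<noteq> 0" and D: "a * d - b * c \<noteq> 0"
  shows "f (gl_act a b c d (d / (a * d - b * c)) (- b / (a * d - b * c)) (- c / (a * d - b * c))
      (a / (a * d - b * c)) z) = f z"
proof -
  define h :: complex where "h = of_real (1 / sqrt 2)"
  have h: "h * h = 1 / 2" "cnj h = h"
    unfolding h_def of_real_mult[symmetric] by (simp_all add: real_div_sqrt field_simps)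
  \<comment> \<open>The product of \<open>diag (1, c / (q a))\<close>,
    \<open>((1, q), (q, 1))\<close> and \<open>diag (a, b / q)\<close> has the entries
    \<open>a\<close>, \<open>b\<close>, \<open>c\<close> and \<open>b c / (q q a)\<close>; the last
    one has to be \<open>d\<close>.\<close>
  define q where "q = csqrt (b * c / (a * d))"
  have q2: "q * q = b * c / (a * d)" by (metis q_def power2_csqrt power2_eq_square)
  have q0: "q \<noteq> 0" using q2 nz by auto
  have q1: "1 - q * q = (a * d - b * c) / (a * d)" using q2 nz by (simp add: field_simps)
  then have "1 - q * q \<noteq> 0" using D nz by simp
  then have "q \<noteq> 1" "q \<noteq> - 1" by auto
  then have q: "1 + q \<noteq> 0" "1 - q \<noteq> 0" using add_eq_0_iff[of 1 q] by auto
  have uh: "unitary2 h h h (- h)" by (simp add: unitary2_def h)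
  have had: "f (gl_act h h h (- h) h h h (- h) z) = f z" for z
    using f(2)[unfolded unitary_invariant_def, rule_format, OF uh, of z] by (simp add: h)
  have tor: "f (gl_act s 0 0 t (1 / s) 0 0 (1 / t) z) = f z" if "s \<noteq> 0" "t \<noteq> 0" for s t z
    using unitary_invariant_torus[OF f that] .
  \<comment> \<open>The matrix \<open>((1, q), (q, 1))\<close> is \<open>diag (1 + q, 1 - q)\<close>
    conjugated by the unitary matrix \<open>((h, h), (h, - h))\<close>, which is its own
    inverse.\<close>
  have mid: "f (gl_act 1 q q 1 (1 / (1 - q * q)) (- q / (1 - q * q)) (- q / (1 - q * q)) (1 / (1 - q * q)) w) = f w" for w
  proof -
    have 1: "1 - q * q = (1 + q) * (1 - q)" by algebra
    have hh: "h * x * h = x / 2" for x using h(1) by (metis mult.assoc mult.commute mult_1 times_divide_eq_left)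
    have i1: "1 / (1 + q) / 2 + 1 / (1 - q) / 2 = 1 / (1 - q * q)"
      and i2: "1 / (1 + q) / 2 - 1 / (1 - q) / 2 = - q / (1 - q * q)"
    proof -
      have "1 / x / 2 + 1 / y / 2 = (x + y) / 2 / (x * y)" "1 / x / 2 - 1 / y / 2 = (y - x) / 2 / (x * y)"
        if "x \<noteq> 0" "y \<noteq> 0" for x y :: complex
        using that by (simp_all add: field_simps)
      from this[OF q] show "1 / (1 + q) / 2 + 1 / (1 - q) / 2 = 1 / (1 - q * q)"
        "1 / (1 + q) / 2 - 1 / (1 - q) / 2 = - q / (1 - q * q)"
        unfolding 1 by simp_all
    qed
    have h2: "h * (h * 2) = 1" using h(1) by (simp add: mult.assoc[symmetric])
    have "gl_act h h h (- h) h h h (- h) (gl_act (1 + q) 0 0 (1 - q) (1 / (1 + q)) 0 0 (1 / (1 - q))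
      (gl_act h h h (- h) h h h (- h) w)) =
      gl_act 1 q q 1 (1 / (1 - q * q)) (- q / (1 - q * q)) (- q / (1 - q * q)) (1 / (1 - q * q)) w"
      unfolding gl_act_comp
      by (rule gl_act_cong; simp only: mult_zero_right mult_zero_left add_0_right add_0_left mult_minus_left
          mult_minus_right minus_minus hh i1[symmetric] i2[symmetric]; simp add: hh field_simps h2)
    then show ?thesis using had tor[OF q] by metis
  qed
  have "gl_act 1 0 0 (c / (q * a)) (1 / 1) 0 0 (1 / (c / (q * a)))
      (gl_act 1 q q 1 (1 / (1 - q * q)) (- q / (1 - q * q)) (- q / (1 - q * q)) (1 / (1 - q * q))
        (gl_act a 0 0 (b / q) (1 / a) 0 0 (1 / (b / q)) z))
     = gl_act a b c d (d / (a * d - b * c)) (- b / (a * d - b * c)) (- c / (a * d - b * c))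
      (a / (a * d - b * c)) z"
    unfolding gl_act_comp q1
    by (rule gl_act_cong) (use nz q0 D q2 in \<open>simp_all add: divide_simps, simp_all add: mult_ac\<close>)
  then show ?thesis using mid tor[of 1 "c / (q * a)"] tor[of a "b / q"] nz q0
    by (metis divide_eq_0_iff mult_eq_0_iff zero_neq_one)
qed

section \<open>A section for the group action\<close>

definition inv_pt :: "(nat \<Rightarrow> complex) \<Rightarrow> nat \<Rightarrow> complex" where
  "inv_pt z = (\<lambda>i. if i < 4 then
     [z 0 + z 3, z 0 * z 3 - z 1 * z 2, z 6 * z 4 + z 7 * z 5,
      z 6 * (z 0 * z 4 + z 1 * z 5) + z 7 * (z 2 * z 4 + z 3 * z 5)] ! i else 0)"

text \<open>
  Where \<open>u\<close> and \<open>A u\<close> are linearly independent, \<open>section_move\<close> takes them to the standard basis: \<open>A\<close>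
  becomes a companion matrix and the remaining coordinates are the invariants \<open>inv_pt\<close>.
\<close>

definition section_pt :: "(nat \<Rightarrow> complex) \<Rightarrow> nat \<Rightarrow> complex" where
  "section_pt \<tau> = (\<lambda>j. if j < 8 then [0, - \<tau> 1, 1, \<tau> 0, 1, 0, \<tau> 2, \<tau> 3] ! j else 0)"

definition Au1 :: "point \<Rightarrow> complex" where "Au1 z = z 0 * z 4 + z 1 * z 5"
definition Au2 :: "point \<Rightarrow> complex" where "Au2 z = z 2 * z 4 + z 3 * z 5"
definition vA1 :: "point \<Rightarrow> complex" where "vA1 z = z 6 * z 0 + z 7 * z 2"
definition vA2 :: "point \<Rightarrow> complex" where "vA2 z = z 6 * z 1 + z 7 * z 3"
definition \<Delta>u :: "point \<Rightarrow> complex" where "\<Delta>u z = z 4 * Au2 z - z 5 * Au1 z"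
definition \<Delta>v :: "point \<Rightarrow> complex" where "\<Delta>v z = z 6 * vA2 z - z 7 * vA1 z"

lemmas cov_defs = Au1_def Au2_def vA1_def vA2_def \<Delta>u_def \<Delta>v_def

lemma inv_pt_nth:
  "inv_pt z 0 = z 0 + z 3" "inv_pt z (Suc 0) = z 0 * z 3 - z 1 * z 2"
  "inv_pt z 2 = z 6 * z 4 + z 7 * z 5" "inv_pt z 3 = z 6 * Au1 z + z 7 * Au2 z"
  by (simp_all add: inv_pt_def Au1_def Au2_def)

lemma less_4: "(j :: nat) < 4 \<longleftrightarrow> j \<in> {0, 1, 2, 3}"
  by auto

lemma inv_pt_eqI:
  assumes "inv_pt z 0 = inv_pt w 0" "inv_pt z 1 = inv_pt w 1" "inv_pt z 2 = inv_pt w 2" "inv_pt z 3 = inv_pt w 3"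
  shows "inv_pt z = inv_pt w"
proof
  fix i show "inv_pt z i = inv_pt w i"
  proof (cases "i < 4")
    case True
    then show ?thesis using assms unfolding less_4 by auto
  qed (simp add: inv_pt_def)
qed

lemma PF_cov [intro]: "Au1 \<in> PF" "Au2 \<in> PF" "vA1 \<in> PF" "vA2 \<in> PF" "\<Delta>u \<in> PF" "\<Delta>v \<in> PF"
  unfolding cov_defs by (intro PF_intros)+

lemma PF_inv_pt: "(\<lambda>z. inv_pt z i) \<in> PF"
proof (cases "i < 4")
  case True
  then show ?thesis unfolding inv_pt_def less_4 by (auto intro!: PF_intros)
qed (auto simp: inv_pt_def intro: PF.intros)

lemma PF_section_pt: "(\<lambda>\<tau>. section_pt \<tau> j) \<in> PF"
proof (cases "j < 8")
  case True
  then show ?thesis unfolding section_pt_def less_8 by (auto intro!: PF_intros)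
qed (auto simp: section_pt_def intro: PF.intros)

text \<open>Symbols are functions of \<open>(A, u, v)\<close> alone; the later coordinates are
  reserved for the auxiliary row and column.\<close>

definition depends8 :: "(point \<Rightarrow> complex) \<Rightarrow> bool" where
  "depends8 f \<longleftrightarrow> (\<forall>z w. (\<forall>j<8. z j = w j) \<longrightarrow> f z = f w)"

lemma depends8D: "depends8 f \<Longrightarrow> (\<And>j. j < 8 \<Longrightarrow> z j = w j) \<Longrightarrow> f z = f w"
  unfolding depends8_def by blast

lemma inv_pt_cong:
  assumes "\<And>j. j < 8 \<Longrightarrow> z j = w j" shows "inv_pt z = inv_pt w"
proof -
  have eq: "z 0 = w 0" "z 1 = w 1" "z 2 = w 2" "z 3 = w 3" "z 4 = w 4" "z 5 = w 5" "z 6 = w 6" "z 7 = w 7"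
    by (rule assms, simp)+
  show ?thesis by (simp only: inv_pt_def eq)
qed

text \<open>The second group of four entries is the matrix with columns \<open>u\<close> and
  \<open>A u\<close>, the first group is its inverse.\<close>

definition section_move :: "(nat \<Rightarrow> complex) \<Rightarrow> nat \<Rightarrow> complex" where
  "section_move z = gl_act (Au2 z / \<Delta>u z) (- Au1 z / \<Delta>u z) (- z 5 / \<Delta>u z) (z 4 / \<Delta>u z) (z 4) (Au1 z) (z 5) (Au2 z) z"

text \<open>The factor \<open>z 6\<close> is needed in \<open>det_form\<close> only.\<close>

definition genericity :: "point \<Rightarrow> complex" where
  "genericity z = z 4 * z 5 * Au1 z * Au2 z * \<Delta>u z * z 6"

lemma PF_genericity: "genericity \<in> PF"
  unfolding genericity_def by (intro PF_intros PF_cov)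

lemma genericity_nonzero: "genericity ((\<lambda>j. 0)(0 := 1, 3 := 2, 4 := 1, 5 := 1, 6 := 1)) \<noteq> 0"
  by (simp add: genericity_def cov_defs)

lemma section_move_low:
  assumes "genericity z \<noteq> 0" "j < 8"
  shows "section_move z j = section_pt (inv_pt z) j"
proof -
  have nz: "\<Delta>u z \<noteq> 0" using assms by (auto simp: genericity_def)
  have "section_move z 0 = 0" "section_move z 2 = 1" "section_move z 4 = 1" "section_move z 5 = 0"
    "section_move z 6 = inv_pt z 2" "section_move z 7 = inv_pt z 3"
    using nz by (simp_all add: section_move_def gl_act_nth inv_pt_nth divide_simps)
      (simp_all add: cov_defs algebra_simps)
  moreover have "section_move z 1 = - inv_pt z 1" "section_move z 3 = inv_pt z 0"
    using nz by (simp_all add: section_move_def gl_act_nth inv_pt_nth divide_simps)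
      (simp_all add: cov_defs algebra_simps)
  ultimately show ?thesis
    using assms(2) unfolding less_8 by (auto simp: section_pt_def)
qed

lemma section_move_row:
  "section_move z 8 = z 8 * z 4 + z 9 * z 5" "section_move z 9 = z 8 * Au1 z + z 9 * Au2 z"
  by (simp_all add: section_move_def gl_act_nth)

text \<open>The factors of \<open>genericity\<close> make the moving matrix invertible and all its
  entries nonzero, as the passage from unitary matrices demands.\<close>

lemma section_move_invariant:
  assumes "f \<in> PF" "unitary_invariant f" and g: "genericity z \<noteq> 0"
  shows "f (section_move z) = f z"
proof -
  have nz: "z 4 \<noteq> 0" "z 5 \<noteq> 0" "Au1 z \<noteq> 0" "Au2 z \<noteq> 0" "\<Delta>u z \<noteq> 0"
    using g by (auto simp: genericity_def)
  let ?D = "Au2 z / \<Delta>u z * (z 4 / \<Delta>u z) - (- Au1 z / \<Delta>u z) * (- z 5 / \<Delta>u z)"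
  have D: "?D = 1 / \<Delta>u z"
    using nz(5) by (simp add: \<Delta>u_def divide_simps)
  have "f (section_move z) = f (gl_act (Au2 z / \<Delta>u z) (- Au1 z / \<Delta>u z) (- z 5 / \<Delta>u z) (z 4 / \<Delta>u z)
     ((z 4 / \<Delta>u z) / ?D) (- (- Au1 z / \<Delta>u z) / ?D) (- (- z 5 / \<Delta>u z) / ?D) ((Au2 z / \<Delta>u z) / ?D) z)"
    unfolding section_move_def D using nz by simp
  also have "\<dots> = f z"
    by (rule unitary_invariant_imp_gl_invariant[OF assms(1,2)]) (use nz D in auto)
  finally show ?thesis .
qed

text \<open>The required \<open>F\<close> is the restriction of \<open>f\<close> to the section, a
  polynomial because \<open>section_pt\<close> is one. The identity holds at generic points and
  extends by density.\<close>

lemma invariant_form: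
  assumes f: "f \<in> PF" "depends8 f" "unitary_invariant f"
  shows "\<exists>F\<in>PF. \<forall>z. f z = F (inv_pt z)"
proof (intro bexI allI)
  show F: "(\<lambda>\<tau>. f (section_pt \<tau>)) \<in> PF"
    using PF_comp[OF f(1) PF_section_pt] by simp
  fix z
  show "f z = f (section_pt (inv_pt z))"
  proof (rule PF_eq_dense[OF f(1) _ PF_genericity genericity_nonzero])
    show "(\<lambda>z. f (section_pt (inv_pt z))) \<in> PF" using PF_comp[OF F PF_inv_pt] by simp
    show "f z = f (section_pt (inv_pt z))" if "genericity z \<noteq> 0" for z
      using section_move_invariant[OF f(1,3) that] section_move_low[OF that]
        depends8D[OF f(2), of "section_move z" "section_pt (inv_pt z)"] by simp
  qed
qed

text \<open>Pairing with the free row \<open>\<lambda>\<close> makes the equivariant column a scalar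
  invariant. On the section \<open>u\<close> and \<open>A u\<close> are the standard basis, so the
  components there are the coefficients, while \<open>\<lambda>\<close> moves to the row with
  entries \<open>\<lambda> u\<close> and \<open>\<lambda> A u\<close>.\<close>

lemma column_form:
  assumes f: "f1 \<in> PF" "depends8 f1" "f2 \<in> PF" "depends8 f2"
    and inv: "unitary_invariant (\<lambda>z. z 8 * f1 z + z 9 * f2 z)"
  shows "\<exists>F1\<in>PF. \<exists>F2\<in>PF. \<forall>z. f1 z = F1 (inv_pt z) * z 4 + F2 (inv_pt z) * Au1 z \<and>
           f2 z = F1 (inv_pt z) * z 5 + F2 (inv_pt z) * Au2 z"
proof -
  have F: "(\<lambda>\<tau>. f1 (section_pt \<tau>)) \<in> PF" "(\<lambda>\<tau>. f2 (section_pt \<tau>)) \<in> PF"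
    using PF_comp[OF f(1) PF_section_pt] PF_comp[OF f(3) PF_section_pt] by simp_all
  have PF: "(\<lambda>z. z 8 * f1 z + z 9 * f2 z) \<in> PF" by (intro PF_intros f)
  have key: "z 8 * f1 z + z 9 * f2 z = (z 8 * z 4 + z 9 * z 5) * f1 (section_pt (inv_pt z))
      + (z 8 * Au1 z + z 9 * Au2 z) * f2 (section_pt (inv_pt z))" for z
  proof (rule PF_eq_dense[OF PF _ PF_genericity genericity_nonzero])
    show "(\<lambda>z. (z 8 * z 4 + z 9 * z 5) * f1 (section_pt (inv_pt z))
        + (z 8 * Au1 z + z 9 * Au2 z) * f2 (section_pt (inv_pt z))) \<in> PF"
      by (intro PF_intros PF_cov PF_comp[OF F(1) PF_inv_pt] PF_comp[OF F(2) PF_inv_pt])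
    show "z 8 * f1 z + z 9 * f2 z = (z 8 * z 4 + z 9 * z 5) * f1 (section_pt (inv_pt z))
      + (z 8 * Au1 z + z 9 * Au2 z) * f2 (section_pt (inv_pt z))" if "genericity z \<noteq> 0" for z
      using section_move_invariant[OF PF inv that] section_move_low[OF that]
        depends8D[OF f(2), of "section_move z" "section_pt (inv_pt z)"]
        depends8D[OF f(4), of "section_move z" "section_pt (inv_pt z)"] by (simp add: section_move_row)
  qed
  have eq: "f1 (z(8 := s, 9 := t)) = f1 z" "f2 (z(8 := s, 9 := t)) = f2 z"
    "inv_pt (z(8 := s, 9 := t)) = inv_pt z" for s t z
    by (rule depends8D[OF f(2)], simp) (rule depends8D[OF f(4)], simp, rule inv_pt_cong, simp)
  have main: "f1 z = f1 (section_pt (inv_pt z)) * z 4 + f2 (section_pt (inv_pt z)) * Au1 z \<and>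
      f2 z = f1 (section_pt (inv_pt z)) * z 5 + f2 (section_pt (inv_pt z)) * Au2 z" for z
    \<comment> \<open>The components are recovered by taking for \<open>\<lambda>\<close> the two
      standard rows.\<close>
    using key[of "z(8 := 1, 9 := 0)"] key[of "z(8 := 0, 9 := 1)"]
    unfolding eq by (simp add: cov_defs mult.commute)
  show ?thesis
    by (rule bexI[of _ "\<lambda>\<tau>. f1 (section_pt \<tau>)"], rule bexI[of _ "\<lambda>\<tau>. f2 (section_pt \<tau>)"])
       (intro allI F main)+
qed

text \<open>Here \<open>f\<close> transforms by the determinant, which the determinant of the rows
  \<open>v\<close> and \<open>\<lambda>\<close> compensates. The value of \<open>f\<close> on the
  section is the coefficient of \<open>\<Delta>u\<close>, which equals 1 there.\<close>

lemma det_form: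
  assumes f: "f \<in> PF" "depends8 f" and inv: "unitary_invariant (\<lambda>z. f z * (z 6 * z 9 - z 7 * z 8))"
  shows "\<exists>F\<in>PF. \<forall>z. f z = F (inv_pt z) * \<Delta>u z"
proof (intro bexI allI)
  show F: "(\<lambda>\<tau>. f (section_pt \<tau>)) \<in> PF"
    using PF_comp[OF f(1) PF_section_pt] by simp
  have PF: "(\<lambda>z. f z * (z 6 * z 9 - z 7 * z 8)) \<in> PF" by (intro PF_intros f)
  fix z
  show "f z = f (section_pt (inv_pt z)) * \<Delta>u z"
  proof (rule PF_eq_dense[OF f(1) _ PF_genericity genericity_nonzero])
    show "(\<lambda>z. f (section_pt (inv_pt z)) * \<Delta>u z) \<in> PF"
      by (intro PF_intros PF_cov PF_comp[OF F PF_inv_pt])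
    fix z assume g: "genericity z \<noteq> 0"
    \<comment> \<open>With \<open>\<lambda> = (0, 1)\<close> the determinant of \<open>v\<close> and
      \<open>\<lambda>\<close> is \<open>z 6\<close>, by which one can divide at generic
      points.\<close>
    define w where "w = z(8 := 0, 9 := 1)"
    have w: "f w = f z" "inv_pt w = inv_pt z" "genericity w = genericity z" "Au1 w = Au1 z" "Au2 w = Au2 z"
      unfolding w_def
      by (rule depends8D[OF f(2)], simp) (rule inv_pt_cong, simp, simp_all add: genericity_def cov_defs)
    have gw: "genericity w \<noteq> 0" using g w by simp
    have "f w * (w 6 * w 9 - w 7 * w 8) = f (section_pt (inv_pt w)) *
        (section_pt (inv_pt w) 6 * section_move w 9 - section_pt (inv_pt w) 7 * section_move w 8)"
      using section_move_invariant[OF PF inv gw] section_move_low[OF gw]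
        depends8D[OF f(2), of "section_move w" "section_pt (inv_pt w)"] by simp
    moreover have "w 6 = z 6" "w 7 = z 7" "w 8 = 0" "w 9 = 1" "w 4 = z 4" "w 5 = z 5"
      by (simp_all add: w_def)
    moreover have "section_pt \<tau> 6 = \<tau> 2" "section_pt \<tau> 7 = \<tau> 3" for \<tau> by (simp_all add: section_pt_def)
    ultimately have "f z * z 6 = f (section_pt (inv_pt z)) * (inv_pt z 2 * Au2 z - inv_pt z 3 * z 5)"
      by (simp add: w section_move_row)
    also have "inv_pt z 2 * Au2 z - inv_pt z 3 * z 5 = \<Delta>u z * z 6"
      by (simp add: inv_pt_nth \<Delta>u_def algebra_simps)
    finally have "f z * z 6 = f (section_pt (inv_pt z)) * \<Delta>u z * z 6" by simp
    then show "f z = f (section_pt (inv_pt z)) * \<Delta>u z" using g by (simp add: genericity_def)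
  qed
qed

section \<open>Rows by transposition\<close>

definition swap_pt :: "(nat \<Rightarrow> complex) \<Rightarrow> nat \<Rightarrow> complex" where
  "swap_pt z = (\<lambda>j. if j < 12 then [z 0, z 2, z 1, z 3, z 6, z 7, z 4, z 5, z 10, z 11, z 8, z 9] ! j else z j)"

lemma swap_pt_nth:
  "swap_pt z 0 = z 0" "swap_pt z (Suc 0) = z 2" "swap_pt z 2 = z 1" "swap_pt z 3 = z 3" "swap_pt z 4 = z 6"
  "swap_pt z 5 = z 7" "swap_pt z 6 = z 4" "swap_pt z 7 = z 5" "swap_pt z 8 = z 10" "swap_pt z 9 = z 11"
  "swap_pt z 10 = z 8" "swap_pt z 11 = z 9" "\<not> j < 12 \<Longrightarrow> swap_pt z j = z j"
  by (simp_all add: swap_pt_def)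

lemma swap_swap_pt: "swap_pt (swap_pt z) = z"
  by (rule point_eqI) (simp_all add: swap_pt_nth)

lemma swap_pt_gl_act:
  "swap_pt (gl_act a b c d a' b' c' d' z) = gl_act a' c' b' d' a c b d (swap_pt z)"
  by (rule point_eqI; simp add: swap_pt_nth gl_act_nth gl_act_ge algebra_simps)

text \<open>Transposition turns the action of \<open>k\<close> into that of its transposed inverse,
  which for unitary \<open>k\<close> is the entrywise conjugate and again unitary.\<close>

lemma unitary_invariant_transp:
  assumes "unitary_invariant f" shows "unitary_invariant (\<lambda>z. f (swap_pt z))"
  unfolding unitary_invariant_def
proof (intro allI impI)
  fix a b c d z assume "unitary2 a b c d"
  then have "unitary2 (cnj a) (cnj b) (cnj c) (cnj d)"
    unfolding unitary2_def by (simp add: mult.commute add.commute)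
  from assms[unfolded unitary_invariant_def, rule_format, OF this, of "swap_pt z"]
  show "f (swap_pt (u_act a b c d z)) = f (swap_pt z)"
    by (simp add: swap_pt_gl_act)
qed

lemma PF_transp:
  assumes "f \<in> PF" shows "(\<lambda>z. f (swap_pt z)) \<in> PF"
proof (rule PF_comp[OF assms])
  show "(\<lambda>z. swap_pt z j) \<in> PF" for j
  proof (cases "j < 12")
    case True
    then show ?thesis using less_12_cases[OF True] by (auto simp: swap_pt_nth intro: PF.intros)
  qed (simp add: swap_pt_nth PF.intros)
qed

lemma depends8_transp:
  assumes "depends8 f" shows "depends8 (\<lambda>z. f (swap_pt z))"
  unfolding depends8_def
proof (intro allI impI)
  fix z w :: "nat \<Rightarrow> complex" assume eq: "\<forall>j<8. z j = w j"
  have e: "z 0 = w 0" "z (Suc 0) = w (Suc 0)" "z 2 = w 2" "z 3 = w 3" "z 4 = w 4" "z 5 = w 5" "z 6 = w 6" "z 7 = w 7"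
    by (rule eq[rule_format], simp)+
  have "swap_pt z j = swap_pt w j" if "j < 8" for j
    using that[unfolded less_8] by (elim insertE emptyE) (simp_all add: swap_pt_nth e)
  then show "f (swap_pt z) = f (swap_pt w)" by (rule depends8D[OF assms])
qed

lemma inv_pt_transp: "inv_pt (swap_pt z) = inv_pt z"
  by (rule inv_pt_eqI) (simp_all add: inv_pt_nth cov_defs swap_pt_nth algebra_simps)

lemma cov_transp:
  "Au1 (swap_pt z) = vA1 z" "Au2 (swap_pt z) = vA2 z" "vA1 (swap_pt z) = Au1 z" "vA2 (swap_pt z) = Au2 z"
  "\<Delta>u (swap_pt z) = \<Delta>v z"
  by (simp_all add: cov_defs swap_pt_nth mult.commute)

lemma row_form:
  assumes f: "f1 \<in> PF" "depends8 f1" "f2 \<in> PF" "depends8 f2"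
    and inv: "unitary_invariant (\<lambda>z. z 10 * f1 z + z 11 * f2 z)"
  shows "\<exists>F1\<in>PF. \<exists>F2\<in>PF. \<forall>z. f1 z = F1 (inv_pt z) * z 6 + F2 (inv_pt z) * vA1 z \<and>
           f2 z = F1 (inv_pt z) * z 7 + F2 (inv_pt z) * vA2 z"
proof -
  obtain F1 F2 where F: "F1 \<in> PF" "F2 \<in> PF"
    and eq: "f1 (swap_pt z) = F1 (inv_pt z) * z 4 + F2 (inv_pt z) * Au1 z \<and>
        f2 (swap_pt z) = F1 (inv_pt z) * z 5 + F2 (inv_pt z) * Au2 z" for z
    using column_form[of "\<lambda>z. f1 (swap_pt z)" "\<lambda>z. f2 (swap_pt z)"] f unitary_invariant_transp[OF inv]
    by (auto simp: PF_transp depends8_transp swap_pt_nth)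
  show ?thesis
    using F eq[of "swap_pt z" for z] by (auto simp: swap_swap_pt inv_pt_transp cov_transp swap_pt_nth)
qed

lemma codet_form:
  assumes f: "f \<in> PF" "depends8 f" and inv: "unitary_invariant (\<lambda>z. f z * (z 4 * z 11 - z 5 * z 10))"
  shows "\<exists>F\<in>PF. \<forall>z. f z = F (inv_pt z) * \<Delta>v z"
proof -
  obtain F where F: "F \<in> PF" and eq: "f (swap_pt z) = F (inv_pt z) * \<Delta>u z" for z
    using det_form[of "\<lambda>z. f (swap_pt z)"] f unitary_invariant_transp[OF inv]
    by (auto simp: PF_transp depends8_transp swap_pt_nth)
  show ?thesis
    using F eq[of "swap_pt z" for z] by (auto simp: swap_swap_pt inv_pt_transp cov_transp)
qed

section \<open>Matrix covariants\<close>

lemma contract: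
  assumes "unitary2 a b c d"
  shows "(x1 * cnj a + x2 * cnj b) * (a * y1 + b * y2) + (x1 * cnj c + x2 * cnj d) * (c * y1 + d * y2)
    = x1 * y1 + x2 * y2"
proof -
  have "(x1 * cnj a + x2 * cnj b) * (a * y1 + b * y2) + (x1 * cnj c + x2 * cnj d) * (c * y1 + d * y2)
    = x1 * y1 * (cnj a * a + cnj c * c) + x1 * y2 * (cnj a * b + cnj c * d)
      + x2 * y1 * (cnj b * a + cnj d * c) + x2 * y2 * (cnj b * b + cnj d * d)"
    by (simp add: algebra_simps)
  then show ?thesis using assms by (simp add: unitary2_def)
qed

lemma matrix_column_act:
  fixes a b c d z
  defines "w \<equiv> u_act a b c d z"
  assumes u: "unitary2 a b c d"
  shows "w 0 * (a * y1 + b * y2) + w 1 * (c * y1 + d * y2) = a * (z 0 * y1 + z 1 * y2) + b * (z 2 * y1 + z 3 * y2)"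
    and "w 2 * (a * y1 + b * y2) + w 3 * (c * y1 + d * y2) = c * (z 0 * y1 + z 1 * y2) + d * (z 2 * y1 + z 3 * y2)"
  using contract[OF u, of "a * z 0 + b * z 2" "a * z 1 + b * z 3" y1 y2]
    contract[OF u, of "c * z 0 + d * z 2" "c * z 1 + d * z 3" y1 y2]
  by (simp_all add: w_def gl_act_nth algebra_simps)

lemma inv_pt_act:
  assumes u: "unitary2 a b c d"
  shows "inv_pt (u_act a b c d z) = inv_pt z"
proof -
  let ?w = "u_act a b c d z"
  have Au: "Au1 ?w = a * Au1 z + b * Au2 z" "Au2 ?w = c * Au1 z + d * Au2 z"
    using matrix_column_act[OF u, of z "z 4" "z 5"] by (simp_all add: cov_defs gl_act_nth)
  have "?w 0 + ?w 3 = z 0 * (cnj a * a + cnj c * c) + z 2 * (cnj a * b + cnj c * d)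
      + z 1 * (cnj b * a + cnj d * c) + z 3 * (cnj b * b + cnj d * d)"
    by (simp add: gl_act_nth algebra_simps)
  then have 0: "inv_pt ?w 0 = inv_pt z 0" using u by (simp add: inv_pt_nth unitary2_def)
  have "?w 0 * ?w 3 - ?w 1 * ?w 2 = (z 0 * z 3 - z 1 * z 2) *
      ((a * cnj a + b * cnj b) * (c * cnj c + d * cnj d) - (a * cnj c + b * cnj d) * (c * cnj a + d * cnj b))"
    by (simp add: gl_act_nth algebra_simps)
  then have 1: "inv_pt ?w 1 = inv_pt z 1" using u by (simp add: inv_pt_nth unitary2_def)
  have 2: "inv_pt ?w 2 = inv_pt z 2" using contract[OF u, of "z 6" "z 7" "z 4" "z 5"]
    by (simp add: inv_pt_nth gl_act_nth)
  have 3: "inv_pt ?w 3 = inv_pt z 3" using contract[OF u, of "z 6" "z 7" "Au1 z" "Au2 z"]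
    by (simp add: inv_pt_nth gl_act_nth Au)
  show ?thesis by (rule inv_pt_eqI) (fact 0 1 2 3)+
qed

lemma PF_gl_act: "(\<lambda>z. gl_act a b c d a' b' c' d' z j) \<in> PF"
proof (cases "j < 12")
  case True
  from less_12_cases[OF True] show ?thesis
    by (elim insertE emptyE) (simp_all add: gl_act_nth PF_intros)
qed (simp add: gl_act_ge PF.intros)

text \<open>A row that annihilates the column \<open>u\<close> is a multiple of
  \<open>(- u2, u1)\<close>: setting \<open>u2 = 0\<close> shows that the first entry is divisible
  by \<open>u2\<close>.\<close>

lemma cross_divide:
  assumes f: "f \<in> PF" "depends8 f" and g: "g \<in> PF" and eq: "\<And>z. f z * z 4 + g z * z 5 = 0"
  shows "\<exists>w\<in>PF. depends8 w \<and> (\<forall>z. f z = - w z * z 5 \<and> g z = w z * z 4)"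
proof -
  \<comment> \<open>The quotient from \<open>PF_divide\<close> may involve any coordinate;
    evaluating it at truncated points makes it depend on the first eight only.\<close>
  define trunc where "trunc z j = (if j < 8 then z j else 0)" for z :: "nat \<Rightarrow> complex" and j :: nat
  have trunc: "(\<lambda>z. trunc z j) \<in> PF" for j by (cases "j < 8") (auto simp: trunc_def intro: PF.intros)
  have zero: "f (z(5 := 0)) = 0" for z
  proof (rule PF_zero_dense[where f = "\<lambda>z. f (z(5 := 0))" and g = "\<lambda>z. z 4" and ?z0.0 = "\<lambda>j. 1"])
    show "(\<lambda>z. f (z(5 := 0))) \<in> PF"
    proof (rule PF_comp[OF f(1)])
      show "(\<lambda>z. (z(5 := 0)) i) \<in> PF" for i by (cases "i = 5") (auto intro: PF.intros)
    qed
    show "f (z(5 := 0)) = 0" if "z 4 \<noteq> 0" for z using eq[of "z(5 := 0)"] that by simp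
  qed (auto intro: PF.intros)
  obtain q where q: "q \<in> PF" "\<And>z. f z = f (z(5 := 0)) + z 5 * q z"
    using PF_divide[OF f(1), of 5] by blast
  define w where "w z = - q (trunc z)" for z
  have wPF: "w \<in> PF" unfolding w_def by (intro PF_intros PF_comp[OF q(1) trunc])
  have wdep: "depends8 w"
    unfolding depends8_def
  proof (intro allI impI)
    fix x y :: "nat \<Rightarrow> complex" assume "\<forall>j<8. x j = y j"
    then have "trunc x = trunc y" by (simp add: fun_eq_iff trunc_def)
    then show "w x = w y" by (simp add: w_def)
  qed
  have fw: "f z = - w z * z 5" for z
  proof -
    have "f z = f (trunc z)" by (rule depends8D[OF f(2)]) (simp add: trunc_def)
    also have "\<dots> = - w z * z 5" unfolding q(2)[of "trunc z"] zero by (simp add: w_def trunc_def)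
    finally show ?thesis .
  qed
  have gw: "g z = w z * z 4" for z
  proof (rule PF_eq_dense[OF g _ PF.var[of 5], of _ "\<lambda>j. 1"])
    show "(\<lambda>z. w z * z 4) \<in> PF" by (intro PF_intros wPF)
    show "g z = w z * z 4" if "z 5 \<noteq> 0" for z
    proof -
      have "(g z - w z * z 4) * z 5 = 0" using eq[of z] fw[of z] by (simp add: algebra_simps)
      then show ?thesis using that by simp
    qed
  qed simp
  show ?thesis using wPF wdep fw gw by blast
qed

lemma depends8_intros:
  "depends8 (\<lambda>z. c)" "j < 8 \<Longrightarrow> depends8 (\<lambda>z. z j)" "depends8 (\<lambda>z. F (inv_pt z))"
  "depends8 f \<Longrightarrow> depends8 g \<Longrightarrow> depends8 (\<lambda>z. f z + g z)"
  "depends8 f \<Longrightarrow> depends8 g \<Longrightarrow> depends8 (\<lambda>z. f z - g z)"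
  "depends8 f \<Longrightarrow> depends8 g \<Longrightarrow> depends8 (\<lambda>z. f z * g z)"
  "depends8 f \<Longrightarrow> depends8 (\<lambda>z. - f z)"
  unfolding depends8_def by (simp, simp, metis inv_pt_cong, metis+)

text \<open>
  \<open>M u = \<alpha> u + \<beta> A u\<close> by \<open>column_form\<close>. The matrix \<open>M - \<alpha> - \<beta> A\<close> kills \<open>u\<close>, hence is a column
  times the row \<open>(- u\<^sub>2, u\<^sub>1)\<close>, and that column is, up to a rotation by a right angle, an equivariant row.
  The polarised Cayley-Hamilton identity turns \<open>u (v A)\<close> into \<open>(A u) v\<close>.
\<close>

lemma matrix_form:
  assumes m: "m11 \<in> PF" "m12 \<in> PF" "m21 \<in> PF" "m22 \<in> PF"
    and dep: "depends8 m11" "depends8 m12" "depends8 m21" "depends8 m22"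
    and inv: "unitary_invariant (\<lambda>z. z 8 * (m11 z * z 10 + m12 z * z 11) + z 9 * (m21 z * z 10 + m22 z * z 11))"
  shows "\<exists>F1\<in>PF. \<exists>F2\<in>PF. \<exists>F3\<in>PF. \<exists>F4\<in>PF. \<forall>z.
     m11 z = F1 (inv_pt z) + F2 (inv_pt z) * z 0 + F3 (inv_pt z) * (z 4 * z 6) + F4 (inv_pt z) * (Au1 z * z 6) \<and>
     m12 z = F2 (inv_pt z) * z 1 + F3 (inv_pt z) * (z 4 * z 7) + F4 (inv_pt z) * (Au1 z * z 7) \<and>
     m21 z = F2 (inv_pt z) * z 2 + F3 (inv_pt z) * (z 5 * z 6) + F4 (inv_pt z) * (Au2 z * z 6) \<and>
     m22 z = F1 (inv_pt z) + F2 (inv_pt z) * z 3 + F3 (inv_pt z) * (z 5 * z 7) + F4 (inv_pt z) * (Au2 z * z 7)"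
proof -
  have m_upd: "m11 (z(i := s, j := t)) = m11 z" "m12 (z(i := s, j := t)) = m12 z"
    "m21 (z(i := s, j := t)) = m21 z" "m22 (z(i := s, j := t)) = m22 z"
    if "8 \<le> i" "8 \<le> j" for z i j s t
    by (rule depends8D[OF dep(1)] depends8D[OF dep(2)] depends8D[OF dep(3)] depends8D[OF dep(4)], use that in simp)+
  define g1 where "g1 z = m11 z * z 4 + m12 z * z 5" for z
  define g2 where "g2 z = m21 z * z 4 + m22 z * z 5" for z
  have g: "g1 \<in> PF" "g2 \<in> PF" unfolding g1_def g2_def by (intro PF_intros m)+
  have gdep: "depends8 g1" "depends8 g2"
    unfolding g1_def g2_def by (intro depends8_intros dep; simp)+
  have "unitary_invariant (\<lambda>z. z 8 * g1 z + z 9 * g2 z)"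
    unfolding unitary_invariant_def
  proof (intro allI impI)
    fix a b c d z assume u: "unitary2 a b c d"
    let ?w = "u_act a b c d z"
    \<comment> \<open>The column \<open>u\<close> transforms like \<open>\<mu>\<close>, so
      \<open>\<mu> = u\<close> may be inserted into the hypothesis.\<close>
    have "u_act a b c d (z(10 := z 4, 11 := z 5)) = ?w(10 := ?w 4, 11 := ?w 5)"
      by (rule point_eqI) (simp_all add: gl_act_nth gl_act_ge)
    with inv[unfolded unitary_invariant_def, rule_format, OF u, of "z(10 := z 4, 11 := z 5)"]
    show "?w 8 * g1 ?w + ?w 9 * g2 ?w = z 8 * g1 z + z 9 * g2 z"
      by (simp add: m_upd g1_def g2_def)
  qed
  then obtain A1 A2 where A: "A1 \<in> PF" "A2 \<in> PF"
    and g1: "\<And>z. g1 z = A1 (inv_pt z) * z 4 + A2 (inv_pt z) * Au1 z"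
    and g2: "\<And>z. g2 z = A1 (inv_pt z) * z 5 + A2 (inv_pt z) * Au2 z"
    using column_form[OF g(1) gdep(1) g(2) gdep(2)] by blast
  define n11 where "n11 z = m11 z - A1 (inv_pt z) - A2 (inv_pt z) * z 0" for z
  define n12 where "n12 z = m12 z - A2 (inv_pt z) * z 1" for z
  define n21 where "n21 z = m21 z - A2 (inv_pt z) * z 2" for z
  define n22 where "n22 z = m22 z - A1 (inv_pt z) - A2 (inv_pt z) * z 3" for z
  have n: "n11 \<in> PF" "n12 \<in> PF" "n21 \<in> PF" "n22 \<in> PF"
    unfolding n11_def n12_def n21_def n22_def by (intro PF_intros m PF_comp[OF A(1) PF_inv_pt] PF_comp[OF A(2) PF_inv_pt])+
  have ndep: "depends8 n11" "depends8 n21"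
    unfolding n11_def n21_def by (intro depends8_intros dep; simp)+
  have n0: "n11 z * z 4 + n12 z * z 5 = 0" "n21 z * z 4 + n22 z * z 5 = 0" for z
    using g1[of z] g2[of z] by (simp_all add: g1_def g2_def n11_def n12_def n21_def n22_def cov_defs algebra_simps)
  obtain w1 where w1: "w1 \<in> PF" "depends8 w1" "\<And>z. n11 z = - w1 z * z 5" "\<And>z. n12 z = w1 z * z 4"
    using cross_divide[OF n(1) ndep(1) n(2) n0(1)] by blast
  obtain w2 where w2: "w2 \<in> PF" "depends8 w2" "\<And>z. n21 z = - w2 z * z 5" "\<And>z. n22 z = w2 z * z 4"
    using cross_divide[OF n(3) ndep(2) n(4) n0(2)] by blast
  \<comment> \<open>The remainder pairs with \<open>\<lambda>\<close> and \<open>\<mu>\<close> to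
    \<open>(\<lambda> w) det (u, \<mu>)\<close>. Take for \<open>\<lambda>\<close> the rotated
    column \<open>(- \<mu>2, \<mu>1)\<close>: it transforms as a row up to a determinant, which
    cancels the one gained by \<open>det (u, \<mu>)\<close>. Dividing by the latter requires
    \<open>gen\<close>.\<close>
  have act_inv: "w1 w * w 11 - w2 w * w 10 = w1 z * z 11 - w2 z * z 10"
    if u: "unitary2 a b c d" and w: "w = u_act a b c d z" and gen: "z 4 * z 11 - z 5 * z 10 \<noteq> 0"
    for a b c d z w
  proof -
    define y where "y = z(8 := - z 11, 9 := z 10)"
    let ?y = "u_act a b c d y"
    have y: "w1 y = w1 z" "w2 y = w2 z" "inv_pt y = inv_pt z"
      unfolding y_def by (rule depends8D[OF w1(2)], simp) (rule depends8D[OF w2(2)], simp, rule inv_pt_cong, simp)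
    have low: "?y j = w j" if "j < 8" for j
      using that[unfolded less_8] unfolding w by (elim insertE emptyE) (simp_all add: gl_act_nth y_def)
    have wy: "w1 ?y = w1 w" "w2 ?y = w2 w" "inv_pt ?y = inv_pt z"
      using low by (auto intro: depends8D[OF w1(2)] depends8D[OF w2(2)]) (simp add: inv_pt_act[OF u] y)
    have mu: "?y 10 = w 10" "?y 11 = w 11" by (simp_all add: w gl_act_nth y_def)
    have N: "z 8 * (n11 z * z 10 + n12 z * z 11) + z 9 * (n21 z * z 10 + n22 z * z 11)
        = (z 8 * w1 z + z 9 * w2 z) * (z 4 * z 11 - z 5 * z 10)" for z
      by (simp add: w1 w2 algebra_simps)
    have M: "z 8 * (n11 z * z 10 + n12 z * z 11) + z 9 * (n21 z * z 10 + n22 z * z 11)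
        = z 8 * (m11 z * z 10 + m12 z * z 11) + z 9 * (m21 z * z 10 + m22 z * z 11)
          - A1 (inv_pt z) * (z 8 * z 10 + z 9 * z 11)
          - A2 (inv_pt z) * (z 8 * (z 0 * z 10 + z 1 * z 11) + z 9 * (z 2 * z 10 + z 3 * z 11))" for z
      by (simp add: n11_def n12_def n21_def n22_def algebra_simps)
    have c1: "?y 8 * ?y 10 + ?y 9 * ?y 11 = y 8 * y 10 + y 9 * y 11"
      using contract[OF u, of "y 8" "y 9" "y 10" "y 11"] by (simp add: gl_act_nth)
    have c2: "?y 8 * (?y 0 * ?y 10 + ?y 1 * ?y 11) + ?y 9 * (?y 2 * ?y 10 + ?y 3 * ?y 11)
        = y 8 * (y 0 * y 10 + y 1 * y 11) + y 9 * (y 2 * y 10 + y 3 * y 11)"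
    proof -
      have "?y 0 * ?y 10 + ?y 1 * ?y 11 = a * (y 0 * y 10 + y 1 * y 11) + b * (y 2 * y 10 + y 3 * y 11)"
        "?y 2 * ?y 10 + ?y 3 * ?y 11 = c * (y 0 * y 10 + y 1 * y 11) + d * (y 2 * y 10 + y 3 * y 11)"
        using matrix_column_act[OF u, of y "y 10" "y 11"] unfolding gl_act_nth(11,12) .
      then show ?thesis
        using contract[OF u, of "y 8" "y 9" "y 0 * y 10 + y 1 * y 11" "y 2 * y 10 + y 3 * y 11"]
        by (simp only: gl_act_nth(9,10))
    qed
    have cancel: "X * D = Y" if "X * (D * g) = Y * g" "g \<noteq> 0" for X D Y g :: complex
      using that by simp
    have e1: "(?y 8 * w1 ?y + ?y 9 * w2 ?y) * (?y 4 * ?y 11 - ?y 5 * ?y 10)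
        = (y 8 * w1 y + y 9 * w2 y) * (y 4 * y 11 - y 5 * y 10)"
      unfolding N[symmetric] M c1 c2 inv[unfolded unitary_invariant_def, rule_format, OF u, of y] wy(3) y(3) ..
    have e2: "y 8 * w1 y + y 9 * w2 y = w2 z * z 10 - w1 z * z 11"
      unfolding y by (simp add: y_def mult.commute)
    have e3: "y 4 * y 11 - y 5 * y 10 = z 4 * z 11 - z 5 * z 10"
      by (simp add: y_def)
    have e4: "?y 4 * ?y 11 - ?y 5 * ?y 10 = (a * d - b * c) * (z 4 * z 11 - z 5 * z 10)"
      by (simp add: gl_act_nth y_def algebra_simps)
    have e5: "(?y 8 * w1 w + ?y 9 * w2 w) * (a * d - b * c) = w2 z * z 10 - w1 z * z 11"
      using cancel[OF e1[unfolded e2 e3 e4] gen] unfolding wy .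
    have e6: "(a * d - b * c) * ?y 8 = - w 11" "(a * d - b * c) * ?y 9 = w 10"
    proof -
      have k: "a * cnj a + b * cnj b = 1" "a * cnj c + b * cnj d = 0" "c * cnj a + d * cnj b = 0"
        "c * cnj c + d * cnj d = 1" using u by (simp_all add: unitary2_def)
      \<comment> \<open>The inverse of a unitary matrix is its adjoint and also its adjugate divided
        by the determinant.\<close>
      have i: "(a * d - b * c) * cnj a = d" "(a * d - b * c) * cnj b = - c"
        "(a * d - b * c) * cnj c = - b" "(a * d - b * c) * cnj d = a"
      proof -
        have "(a * d - b * c) * cnj a = d * (a * cnj a + b * cnj b) - b * (c * cnj a + d * cnj b)"
          "(a * d - b * c) * cnj b = a * (c * cnj a + d * cnj b) - c * (a * cnj a + b * cnj b)"
          "(a * d - b * c) * cnj c = d * (a * cnj c + b * cnj d) - b * (c * cnj c + d * cnj d)"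
          "(a * d - b * c) * cnj d = a * (c * cnj c + d * cnj d) - c * (a * cnj c + b * cnj d)"
          by (simp_all add: algebra_simps)
        then show "(a * d - b * c) * cnj a = d" "(a * d - b * c) * cnj b = - c"
          "(a * d - b * c) * cnj c = - b" "(a * d - b * c) * cnj d = a"
          unfolding k by simp_all
      qed
      have "(a * d - b * c) * ?y 8 = - z 11 * ((a * d - b * c) * cnj a) + z 10 * ((a * d - b * c) * cnj b)"
        "(a * d - b * c) * ?y 9 = - z 11 * ((a * d - b * c) * cnj c) + z 10 * ((a * d - b * c) * cnj d)"
        by (simp_all add: gl_act_nth y_def algebra_simps)
      then show "(a * d - b * c) * ?y 8 = - w 11" "(a * d - b * c) * ?y 9 = w 10"
        unfolding i by (simp_all add: w gl_act_nth algebra_simps)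
    qed
    have "(?y 8 * w1 w + ?y 9 * w2 w) * (a * d - b * c)
        = (a * d - b * c) * ?y 8 * w1 w + (a * d - b * c) * ?y 9 * w2 w"
      by (simp only: distrib_left distrib_right mult_ac)
    then show ?thesis unfolding e5 e6 by (simp add: algebra_simps)
  qed
  have "unitary_invariant (\<lambda>z. z 10 * w2 z + z 11 * - w1 z)"
    unfolding unitary_invariant_def
  proof (intro allI impI)
    fix a b c d z assume u: "unitary2 a b c d"
    let ?f = "\<lambda>z. z 10 * w2 z + z 11 * - w1 z"
    have f: "?f \<in> PF" by (intro PF_intros w1 w2)
    \<comment> \<open>\<open>act_inv\<close> assumes that \<open>u\<close> and \<open>\<mu>\<close>
      are independent; density removes this.\<close>
    show "?f (u_act a b c d z) = ?f z"
    proof (rule PF_eq_dense[where f = "\<lambda>z. ?f (u_act a b c d z)" and h = ?f and g = "\<lambda>z. z 4 * z 11 - z 5 * z 10"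
          and ?z0.0 = "(\<lambda>j. 0)(4 := 1, 11 := 1)"])
      show "(\<lambda>z. ?f (u_act a b c d z)) \<in> PF" by (rule PF_comp[OF f PF_gl_act])
      show "?f (u_act a b c d z) = ?f z" if "z 4 * z 11 - z 5 * z 10 \<noteq> 0" for z
        using act_inv[OF u refl that] by (simp add: algebra_simps)
    qed (use f in \<open>auto intro!: PF_intros\<close>)
  qed
  from row_form[OF w2(1,2) PF_uminus[OF w1(1)] depends8_intros(7)[OF w1(2)] this]
  obtain G1 G2 where G: "G1 \<in> PF" "G2 \<in> PF"
    and h2: "\<And>z. w2 z = G1 (inv_pt z) * z 6 + G2 (inv_pt z) * vA1 z"
    and h1: "\<And>z. - w1 z = G1 (inv_pt z) * z 7 + G2 (inv_pt z) * vA2 z"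
    by blast
  have w1': "w1 z = - (G1 (inv_pt z) * z 7 + G2 (inv_pt z) * vA2 z)" for z
    using h1[of z, symmetric] by simp
  show ?thesis
  \<comment> \<open>With the row \<open>r = G1 v + G2 v A\<close> the remainder is
    \<open>(r u) 1 - u r\<close>. Substituting \<open>u (v A) = - A u v + (tr A) u v + (v u) A + (v
    A u - (tr A) (v u)) 1\<close> gives these coefficients.\<close>
  proof (rule bexI[of _ "\<lambda>\<tau>. A1 \<tau> + G1 \<tau> * \<tau> 2 + G2 \<tau> * \<tau> 0 * \<tau> 2"], rule bexI[of _ "\<lambda>\<tau>. A2 \<tau> - G2 \<tau> * \<tau> 2"],
      rule bexI[of _ "\<lambda>\<tau>. - G1 \<tau> - G2 \<tau> * \<tau> 0"], rule bexI[of _ G2], rule allI)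
    fix z
    have m': "m11 z = n11 z + A1 (inv_pt z) + A2 (inv_pt z) * z 0" "m12 z = n12 z + A2 (inv_pt z) * z 1"
      "m21 z = n21 z + A2 (inv_pt z) * z 2" "m22 z = n22 z + A1 (inv_pt z) + A2 (inv_pt z) * z 3"
      by (simp_all add: n11_def n12_def n21_def n22_def)
    let ?B = "inv_pt z"
    show "m11 z = A1 ?B + G1 ?B * ?B 2 + G2 ?B * ?B 0 * ?B 2 + (A2 ?B - G2 ?B * ?B 2) * z 0
          + (- G1 ?B - G2 ?B * ?B 0) * (z 4 * z 6) + G2 ?B * (Au1 z * z 6) \<and>
        m12 z = (A2 ?B - G2 ?B * ?B 2) * z 1 + (- G1 ?B - G2 ?B * ?B 0) * (z 4 * z 7) + G2 ?B * (Au1 z * z 7) \<and>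
        m21 z = (A2 ?B - G2 ?B * ?B 2) * z 2 + (- G1 ?B - G2 ?B * ?B 0) * (z 5 * z 6) + G2 ?B * (Au2 z * z 6) \<and>
        m22 z = A1 ?B + G1 ?B * ?B 2 + G2 ?B * ?B 0 * ?B 2 + (A2 ?B - G2 ?B * ?B 2) * z 3
          + (- G1 ?B - G2 ?B * ?B 0) * (z 5 * z 7) + G2 ?B * (Au2 z * z 7)"
      unfolding m' w1(3,4) w2(3,4) w1' h2 inv_pt_nth
      by (intro conjI) (simp_all add: cov_defs algebra_simps)
  qed (intro PF_intros A G)+
qed

section \<open>Invariance of the elements\<close>

lemma Ad_UC_simps:
  "Ad_UC k (x + y) = Ad_UC k x + Ad_UC k y"
  "Ad_UC k (x * y) = Ad_UC k x * Ad_UC k y"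
  "Ad_UC k (z *\<^sub>C x) = z *\<^sub>C Ad_UC k x"
  by (transfer, rule qcong_eqI, simp add: push_add push_mult[of "pure_map (Ad_U k) (Ad_C k)" for k, OF pure_map_plus]
      push_pm_scale[of "pure_map (Ad_U k) (Ad_C k)" for k, OF pure_map_plus pure_map_zero])+

lemma cscale_exchange:
  "s *\<^sub>C (t *\<^sub>C x + t' *\<^sub>C x') + s' *\<^sub>C (t *\<^sub>C y + t' *\<^sub>C y') =
   t *\<^sub>C (s *\<^sub>C x + s' *\<^sub>C y) + t' *\<^sub>C (s *\<^sub>C x' + s' *\<^sub>C (y' :: 'a::complex_algebra))"
  by (simp add: cscale_add_right cscale_cscale mult.commute ac_simps)

text \<open>
  Families indexed by \<open>{1, 2}\<close> which an algebra endomorphism transforms like the standard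
  representation of \<open>U(2)\<close> twisted by \<open>p\<close>, like its dual, and like the matrix units.
\<close>

locale k_hom =
  fixes \<phi> :: "'w::complex_algebra \<Rightarrow> 'w" and a b c d :: complex
  assumes \<phi>_add: "\<phi> (x + y) = \<phi> x + \<phi> y" and \<phi>_mult: "\<phi> (x * y) = \<phi> x * \<phi> y"
    and \<phi>_scale: "\<phi> (z *\<^sub>C x) = z *\<^sub>C \<phi> x" and unitary: "unitary2 a b c d"
begin

definition cov :: "complex \<Rightarrow> 'w \<Rightarrow> 'w \<Rightarrow> bool" where
  "cov p P1 P2 \<longleftrightarrow> \<phi> P1 = p *\<^sub>C (a *\<^sub>C P1 + c *\<^sub>C P2) \<and> \<phi> P2 = p *\<^sub>C (b *\<^sub>C P1 + d *\<^sub>C P2)"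

definition contra :: "complex \<Rightarrow> 'w \<Rightarrow> 'w \<Rightarrow> bool" where
  "contra p R1 R2 \<longleftrightarrow> \<phi> R1 = p *\<^sub>C (cnj a *\<^sub>C R1 + cnj c *\<^sub>C R2) \<and> \<phi> R2 = p *\<^sub>C (cnj b *\<^sub>C R1 + cnj d *\<^sub>C R2)"

definition mixed :: "'w \<Rightarrow> 'w \<Rightarrow> 'w \<Rightarrow> 'w \<Rightarrow> bool" where
  "mixed L11 L12 L21 L22 \<longleftrightarrow>
     \<phi> L11 = cnj a *\<^sub>C (a *\<^sub>C L11 + c *\<^sub>C L21) + cnj c *\<^sub>C (a *\<^sub>C L12 + c *\<^sub>C L22) \<and>
     \<phi> L12 = cnj b *\<^sub>C (a *\<^sub>C L11 + c *\<^sub>C L21) + cnj d *\<^sub>C (a *\<^sub>C L12 + c *\<^sub>C L22) \<and>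
     \<phi> L21 = cnj a *\<^sub>C (b *\<^sub>C L11 + d *\<^sub>C L21) + cnj c *\<^sub>C (b *\<^sub>C L12 + d *\<^sub>C L22) \<and>
     \<phi> L22 = cnj b *\<^sub>C (b *\<^sub>C L11 + d *\<^sub>C L21) + cnj d *\<^sub>C (b *\<^sub>C L12 + d *\<^sub>C L22)"

lemma contract_scaled:
  "(a *\<^sub>C P1 + c *\<^sub>C P2) * (cnj a *\<^sub>C R1 + cnj c *\<^sub>C R2) + (b *\<^sub>C P1 + d *\<^sub>C P2) * (cnj b *\<^sub>C R1 + cnj d *\<^sub>C R2)
    = P1 * R1 + P2 * (R2 :: 'w)"
proof -
  have "(a *\<^sub>C P1 + c *\<^sub>C P2) * (cnj a *\<^sub>C R1 + cnj c *\<^sub>C R2) + (b *\<^sub>C P1 + d *\<^sub>C P2) * (cnj b *\<^sub>C R1 + cnj d *\<^sub>C R2)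
    = (a * cnj a + b * cnj b) *\<^sub>C (P1 * R1) + (a * cnj c + b * cnj d) *\<^sub>C (P1 * R2)
      + (c * cnj a + d * cnj b) *\<^sub>C (P2 * R1) + (c * cnj c + d * cnj d) *\<^sub>C (P2 * R2)"
    by (simp add: distrib_left distrib_right cscale_mult cscale_cscale cscale_add_left cscale_add_right ac_simps)
  then show ?thesis using unitary by (simp add: unitary2_def cscale_one)
qed

lemma contract_scaled_rev:
  "(cnj a *\<^sub>C R1 + cnj c *\<^sub>C R2) * (a *\<^sub>C P1 + c *\<^sub>C P2) + (cnj b *\<^sub>C R1 + cnj d *\<^sub>C R2) * (b *\<^sub>C P1 + d *\<^sub>C P2)
    = R1 * P1 + R2 * (P2 :: 'w)"
proof -
  have "(cnj a *\<^sub>C R1 + cnj c *\<^sub>C R2) * (a *\<^sub>C P1 + c *\<^sub>C P2) + (cnj b *\<^sub>C R1 + cnj d *\<^sub>C R2) * (b *\<^sub>C P1 + d *\<^sub>C P2)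
    = (a * cnj a + b * cnj b) *\<^sub>C (R1 * P1) + (a * cnj c + b * cnj d) *\<^sub>C (R2 * P1)
      + (c * cnj a + d * cnj b) *\<^sub>C (R1 * P2) + (c * cnj c + d * cnj d) *\<^sub>C (R2 * P2)"
    by (simp add: distrib_left distrib_right cscale_mult cscale_cscale cscale_add_left cscale_add_right ac_simps)
  then show ?thesis using unitary by (simp add: unitary2_def cscale_one)
qed

text \<open>The pairing is invariant in either order of the factors, without any commutation between
  the two families; the twists cancel by \<open>p * q = 1\<close>.\<close>

lemma invariant_cov_contra:
  assumes "cov p P1 P2" "contra q R1 R2" "p * q = 1"
  shows "\<phi> (P1 * R1 + P2 * R2) = P1 * R1 + P2 * R2" "\<phi> (R1 * P1 + R2 * P2) = R1 * P1 + R2 * P2"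
proof -
  have scale: "(p *\<^sub>C x) * (q *\<^sub>C y) + (p *\<^sub>C z) * (q *\<^sub>C w) = (p * q) *\<^sub>C (x * y + z * w)"
    "(q *\<^sub>C x) * (p *\<^sub>C y) + (q *\<^sub>C z) * (p *\<^sub>C w) = (p * q) *\<^sub>C (x * y + z * w)" for x y z w :: 'w
    by (simp_all add: cscale_mult cscale_add_right cscale_cscale mult.commute)
  have "\<phi> (P1 * R1 + P2 * R2) = (p * q) *\<^sub>C
     ((a *\<^sub>C P1 + c *\<^sub>C P2) * (cnj a *\<^sub>C R1 + cnj c *\<^sub>C R2) + (b *\<^sub>C P1 + d *\<^sub>C P2) * (cnj b *\<^sub>C R1 + cnj d *\<^sub>C R2))"
    using assms(1,2) by (simp only: cov_def contra_def \<phi>_add \<phi>_mult scale)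
  then show "\<phi> (P1 * R1 + P2 * R2) = P1 * R1 + P2 * R2" using assms(3) by (simp add: contract_scaled cscale_one)
  have "\<phi> (R1 * P1 + R2 * P2) = (p * q) *\<^sub>C
     ((cnj a *\<^sub>C R1 + cnj c *\<^sub>C R2) * (a *\<^sub>C P1 + c *\<^sub>C P2) + (cnj b *\<^sub>C R1 + cnj d *\<^sub>C R2) * (b *\<^sub>C P1 + d *\<^sub>C P2))"
    using assms(1,2) by (simp only: cov_def contra_def \<phi>_add \<phi>_mult scale)
  then show "\<phi> (R1 * P1 + R2 * P2) = R1 * P1 + R2 * P2" using assms(3) by (simp add: contract_scaled_rev cscale_one)
qed

lemma mixed_cov:
  assumes L: "mixed L11 L12 L21 L22" and P: "cov p P1 P2"
  shows "cov p (L11 * P1 + L12 * P2) (L21 * P1 + L22 * P2)"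
proof -
  have scale: "x * (p *\<^sub>C y) + z * (p *\<^sub>C w) = p *\<^sub>C (x * y + z * w)" for x y z w :: 'w
    by (simp add: cscale_mult cscale_add_right)
  show ?thesis
    using L P unfolding cov_def mixed_def \<phi>_add \<phi>_mult
    by (simp only: scale contract_scaled_rev)
       (simp add: distrib_right cscale_mult cscale_add_right ac_simps)
qed

lemma mixed_rows:
  assumes L: "mixed L11 L12 L21 L22"
  shows "\<phi> L11 = a *\<^sub>C (cnj a *\<^sub>C L11 + cnj c *\<^sub>C L12) + c *\<^sub>C (cnj a *\<^sub>C L21 + cnj c *\<^sub>C L22)"
    "\<phi> L12 = a *\<^sub>C (cnj b *\<^sub>C L11 + cnj d *\<^sub>C L12) + c *\<^sub>C (cnj b *\<^sub>C L21 + cnj d *\<^sub>C L22)"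
    "\<phi> L21 = b *\<^sub>C (cnj a *\<^sub>C L11 + cnj c *\<^sub>C L12) + d *\<^sub>C (cnj a *\<^sub>C L21 + cnj c *\<^sub>C L22)"
    "\<phi> L22 = b *\<^sub>C (cnj b *\<^sub>C L11 + cnj d *\<^sub>C L12) + d *\<^sub>C (cnj b *\<^sub>C L21 + cnj d *\<^sub>C L22)"
  using L unfolding mixed_def by (metis cscale_exchange)+

lemma mixed_contra:
  assumes L: "mixed L11 L12 L21 L22" and R: "contra p R1 R2"
  shows "contra p (L11 * R1 + L21 * R2) (L12 * R1 + L22 * R2)"
proof -
  have scale: "x * (p *\<^sub>C y) + z * (p *\<^sub>C w) = p *\<^sub>C (x * y + z * w)" for x y z w :: 'w
    by (simp add: cscale_mult cscale_add_right)
  show ?thesis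
    using R unfolding contra_def \<phi>_add \<phi>_mult mixed_rows[OF L]
    by (simp only: scale contract_scaled)
       (simp add: distrib_right cscale_mult cscale_add_right ac_simps)
qed

text \<open>The inner index is contracted, so the square of the matrix transforms like the matrix
  itself; its trace will be an invariant of degree 2.\<close>

lemma mixed_square:
  assumes L: "mixed L11 L12 L21 L22"
  shows "mixed (L11 * L11 + L12 * L21) (L11 * L12 + L12 * L22) (L21 * L11 + L22 * L21) (L21 * L12 + L22 * L22)"
proof -
  have key: "\<phi> (x * y + x' * y') = u1 * w1 + u2 * w2"
    if "\<phi> x = cnj a *\<^sub>C u1 + cnj c *\<^sub>C u2" "\<phi> x' = cnj b *\<^sub>C u1 + cnj d *\<^sub>C u2"
      "\<phi> y = a *\<^sub>C w1 + c *\<^sub>C w2" "\<phi> y' = b *\<^sub>C w1 + d *\<^sub>C w2" for x y x' y' u1 u2 w1 w2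
    unfolding \<phi>_add \<phi>_mult that by (rule contract_scaled_rev)
  note U = L[unfolded mixed_def, THEN conjunct1] L[unfolded mixed_def, THEN conjunct2, THEN conjunct1]
    L[unfolded mixed_def, THEN conjunct2, THEN conjunct2, THEN conjunct1]
    L[unfolded mixed_def, THEN conjunct2, THEN conjunct2, THEN conjunct2]
  note W = mixed_rows[OF L]
  have expand: "(s *\<^sub>C x + s' *\<^sub>C x') * (t *\<^sub>C y + t' *\<^sub>C y') + (s *\<^sub>C z + s' *\<^sub>C z') * (t *\<^sub>C w + t' *\<^sub>C w')
     = t *\<^sub>C (s *\<^sub>C (x * y + z * w) + s' *\<^sub>C (x' * y + z' * w)) + t' *\<^sub>C (s *\<^sub>C (x * y' + z * w') + s' *\<^sub>C (x' * y' + z' * w'))"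
    for s s' t t' and x x' y y' z z' w w' :: 'w
    by (simp add: distrib_left distrib_right cscale_mult cscale_add_right cscale_cscale mult.commute ac_simps)
  show ?thesis
    unfolding mixed_def expand[symmetric]
    using key[OF U(1,2) W(1,3)] key[OF U(1,2) W(2,4)] key[OF U(3,4) W(1,3)] key[OF U(3,4) W(2,4)]
    by blast
qed

lemma invariant_trace:
  assumes "mixed L11 L12 L21 L22" shows "\<phi> (L11 + L22) = L11 + L22"
proof -
  have "\<phi> (L11 + L22) = (cnj a * a + cnj b * b) *\<^sub>C L11 + (cnj a * c + cnj b * d) *\<^sub>C L21
     + (cnj c * a + cnj d * b) *\<^sub>C L12 + (cnj c * c + cnj d * d) *\<^sub>C L22"
    using assms by (simp add: mixed_def \<phi>_add cscale_add_right cscale_add_left cscale_cscale ac_simps)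
  then show ?thesis using unitary by (simp add: unitary2_def mult.commute cscale_one)
qed

end

text \<open>Trace-free parts of the diagonal matrix units; with \<open>\<iota> mE\<close> and
  \<open>\<iota> mF\<close> off the diagonal they fill a 2 by 2 matrix that transforms under
  \<open>K\<close> like the matrix units.\<close>

definition Lu11 :: Ug where "Lu11 = (1/2) *\<^sub>C \<iota> mH"
definition Lu22 :: Ug where "Lu22 = (- 1/2) *\<^sub>C \<iota> mH"

lemma Rep_Kgrp_facts:
  "conj_transpose (Rep_Kgrp k) ** Rep_Kgrp k = mat 1" "Rep_Kgrp k ** conj_transpose (Rep_Kgrp k) = mat 1"
  "det (Rep_Kgrp k) = 1"
  "Rep_Kgrp k $ 1 $ 3 = 0" "Rep_Kgrp k $ 2 $ 3 = 0" "Rep_Kgrp k $ 3 $ 1 = 0" "Rep_Kgrp k $ 3 $ 2 = 0"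
  using Rep_Kgrp[of k] by simp_all

section \<open>The action of \<open>K\<close> on the generators\<close>

lemma Kgrp_unitary:
  defines "m \<equiv> Rep_Kgrp"
  shows "unitary2 (m k $ 1 $ 1) (m k $ 1 $ 2) (m k $ 2 $ 1) (m k $ 2 $ 2)" "m k $ 3 $ 3 * cnj (m k $ 3 $ 3) = 1"
  using Rep_Kgrp_facts(1,2)[of k] Rep_Kgrp_facts(4-7)[of k]
  unfolding mat3_eq_iff forall_3 mult_nth_3 m_def
  by (simp_all add: conj_transpose_def mat_def unitary2_def)

definition kconj :: "Kgrp \<Rightarrow> mat3 \<Rightarrow> mat3" where
  "kconj k A = Rep_Kgrp k ** A ** conj_transpose (Rep_Kgrp k)"

lemma Rep_Ad_g: "Rep_sl3 (Ad_g k X) = kconj k (Rep_sl3 X)"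
  by (simp add: Ad_g.rep_eq kconj_def K_inverse Rep_Kgrp_facts)

lemma Rep_Ad_p: "Rep_pspace (Ad_p k x) = kconj k (Rep_pspace x)"
  by (simp add: Ad_p.rep_eq kconj_def K_inverse Rep_Kgrp_facts)

lemma Ad_U_U_incl: "Ad_U k (U_incl X) = U_incl (Ad_g k X)"
  unfolding U_incl_def by (simp add: Ad_U.abs_eq push_letter)

lemma Ad_C_C_incl: "Ad_C k (C_incl x) = C_incl (Ad_p k x)"
  unfolding C_incl_def by (simp add: Ad_C.abs_eq push_letter)

lemma trace_0: "trace (0 :: mat3) = 0"
  by (simp add: trace_3)

lemma \<iota>_linear:
  assumes "trace A = 0" "trace B = 0"
  shows "\<iota> (A + B) = \<iota> A + \<iota> B" "\<iota> (mscale z A) = z *\<^sub>C \<iota> A"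
proof -
  have "Abs_sl3 (A + B) = sl3_add (Abs_sl3 A) (Abs_sl3 B)" "Abs_sl3 (mscale z A) = sl3_scale z (Abs_sl3 A)"
    unfolding Rep_sl3_inject[symmetric] sl3_add.rep_eq sl3_scale.rep_eq
    using assms by (simp_all add: Abs_sl3_inverse trace_linear)
  then show "\<iota> (A + B) = \<iota> A + \<iota> B" "\<iota> (mscale z A) = z *\<^sub>C \<iota> A"
    by (simp_all add: \<iota>_def U_incl_linear)
qed

lemmas \<iota>_simps = \<iota>_linear(1) \<iota>_linear(2)[where B = 0, OF _ trace_0]

lemma \<gamma>_linear:
  assumes "A \<in> p_space" "B \<in> p_space"
  shows "\<gamma> (A + B) = \<gamma> A + \<gamma> B" "\<gamma> (mscale z A) = z *\<^sub>C \<gamma> A"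
proof -
  have "Abs_pspace (A + B) = p_add (Abs_pspace A) (Abs_pspace B)" "Abs_pspace (mscale z A) = p_scale z (Abs_pspace A)"
    unfolding Rep_pspace_inject[symmetric] p_add.rep_eq p_scale.rep_eq
    using assms by (simp_all add: Abs_pspace_inverse p_space_iff)
  then show "\<gamma> (A + B) = \<gamma> A + \<gamma> B" "\<gamma> (mscale z A) = z *\<^sub>C \<gamma> A"
    by (simp_all add: \<gamma>_def C_incl_linear)
qed

lemma Ad_U_\<iota>:
  assumes "trace A = 0" shows "Ad_U k (\<iota> A) = \<iota> (kconj k A)"
proof -
  have "Ad_g k (Abs_sl3 A) = Abs_sl3 (kconj k A)"
    using Rep_Ad_g[of k "Abs_sl3 A"] assms by (metis Abs_sl3_inverse Rep_sl3_inverse mem_Collect_eq)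
  then show ?thesis by (simp add: \<iota>_def Ad_U_U_incl)
qed

lemma Ad_C_\<gamma>:
  assumes "A \<in> p_space" shows "Ad_C k (\<gamma> A) = \<gamma> (kconj k A)"
proof -
  have "Ad_p k (Abs_pspace A) = Abs_pspace (kconj k A)"
    using Rep_Ad_p[of k "Abs_pspace A"] assms by (metis Abs_pspace_inverse Rep_pspace_inverse)
  then show ?thesis by (simp add: \<gamma>_def Ad_C_C_incl)
qed

context
  fixes k :: Kgrp and a b c d s :: complex
  assumes k: "Rep_Kgrp k $ 1 $ 1 = a" "Rep_Kgrp k $ 1 $ 2 = b" "Rep_Kgrp k $ 2 $ 1 = c"
    "Rep_Kgrp k $ 2 $ 2 = d" "Rep_Kgrp k $ 3 $ 3 = s"
begin

lemma kconj_p: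
  "kconj k mE1 = mscale (cnj s) (mscale a mE1 + mscale c mE2)"
  "kconj k mE2 = mscale (cnj s) (mscale b mE1 + mscale d mE2)"
  "kconj k mF1 = mscale s (mscale (cnj a) mF1 + mscale (cnj c) mF2)"
  "kconj k mF2 = mscale s (mscale (cnj b) mF1 + mscale (cnj d) mF2)"
  unfolding mat3_eq_iff forall_3 kconj_def mult_nth_3
  by (simp_all add: conj_transpose_def k Rep_Kgrp_facts mE1_def mE2_def mF1_def mF2_def)

lemma kconj_k:
  "kconj k mH = mscale (a * cnj a - c * cnj c) mH + (mscale (2 * a * cnj c) mE + mscale (2 * c * cnj a) mF)"
  "kconj k mE = mscale ((a * cnj b - c * cnj d) / 2) mH + (mscale (a * cnj d) mE + mscale (c * cnj b) mF)"
  "kconj k mF = mscale ((b * cnj a - d * cnj c) / 2) mH + (mscale (b * cnj c) mE + mscale (d * cnj a) mF)"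
proof -
  have u: "unitary2 a b c d" using Kgrp_unitary(1)[of k] by (simp add: k)
  note u = this[unfolded unitary2_def]
  have 1: "a * cnj c = - (b * cnj d)" "c * cnj a = - (d * cnj b)" "cnj a * b = - (cnj c * d)" "cnj b * a = - (cnj d * c)"
    using u by (simp_all add: add_eq_0_iff2)
  have 2: "b * cnj b = c * cnj c" "a * cnj a = d * cnj d" 
    using u by (algebra, algebra)
  show "kconj k mH = mscale (a * cnj a - c * cnj c) mH + (mscale (2 * a * cnj c) mE + mscale (2 * c * cnj a) mF)"
    unfolding mat3_eq_iff forall_3 kconj_def mult_nth_3
    using 1 2 by (simp add: conj_transpose_def k Rep_Kgrp_facts mH_def mH1_def mH2_def mE_def mF_def)
  show "kconj k mE = mscale ((a * cnj b - c * cnj d) / 2) mH + (mscale (a * cnj d) mE + mscale (c * cnj b) mF)"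
    unfolding mat3_eq_iff forall_3 kconj_def mult_nth_3
    using 1 by (simp add: conj_transpose_def k Rep_Kgrp_facts mH_def mH1_def mH2_def mE_def mF_def mult.commute)
  show "kconj k mF = mscale ((b * cnj a - d * cnj c) / 2) mH + (mscale (b * cnj c) mE + mscale (d * cnj a) mF)"
    unfolding mat3_eq_iff forall_3 kconj_def mult_nth_3
    using 1 by (simp add: conj_transpose_def k Rep_Kgrp_facts mH_def mH1_def mH2_def mE_def mF_def mult.commute)
qed

lemma Ad_C_p:
  "Ad_C k (\<gamma> mE1) = cnj s *\<^sub>C (a *\<^sub>C \<gamma> mE1 + c *\<^sub>C \<gamma> mE2)"
  "Ad_C k (\<gamma> mE2) = cnj s *\<^sub>C (b *\<^sub>C \<gamma> mE1 + d *\<^sub>C \<gamma> mE2)"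
  "Ad_C k (\<gamma> mF1) = s *\<^sub>C (cnj a *\<^sub>C \<gamma> mF1 + cnj c *\<^sub>C \<gamma> mF2)"
  "Ad_C k (\<gamma> mF2) = s *\<^sub>C (cnj b *\<^sub>C \<gamma> mF1 + cnj d *\<^sub>C \<gamma> mF2)"
proof -
  have "mscale z A \<in> p_space" "A \<in> p_space \<Longrightarrow> B \<in> p_space \<Longrightarrow> A + B \<in> p_space" if "A \<in> p_space" for z A B
    using that by (simp_all add: p_space_iff)
  note pp = this \<gamma>_linear(1) \<gamma>_linear(2)[where B = mE1, OF _ p_space_elements(1)]
  show "Ad_C k (\<gamma> mE1) = cnj s *\<^sub>C (a *\<^sub>C \<gamma> mE1 + c *\<^sub>C \<gamma> mE2)"
    "Ad_C k (\<gamma> mE2) = cnj s *\<^sub>C (b *\<^sub>C \<gamma> mE1 + d *\<^sub>C \<gamma> mE2)"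
    "Ad_C k (\<gamma> mF1) = s *\<^sub>C (cnj a *\<^sub>C \<gamma> mF1 + cnj c *\<^sub>C \<gamma> mF2)"
    "Ad_C k (\<gamma> mF2) = s *\<^sub>C (cnj b *\<^sub>C \<gamma> mF1 + cnj d *\<^sub>C \<gamma> mF2)"
    by (simp_all add: Ad_C_\<gamma> p_space_elements kconj_p pp)
qed

lemma Ad_U_elements:
  "Ad_U k (\<iota> mE1) = cnj s *\<^sub>C (a *\<^sub>C \<iota> mE1 + c *\<^sub>C \<iota> mE2)"
  "Ad_U k (\<iota> mE2) = cnj s *\<^sub>C (b *\<^sub>C \<iota> mE1 + d *\<^sub>C \<iota> mE2)"
  "Ad_U k (\<iota> mF1) = s *\<^sub>C (cnj a *\<^sub>C \<iota> mF1 + cnj c *\<^sub>C \<iota> mF2)"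
  "Ad_U k (\<iota> mF2) = s *\<^sub>C (cnj b *\<^sub>C \<iota> mF1 + cnj d *\<^sub>C \<iota> mF2)"
  "Ad_U k (\<iota> mH) = (a * cnj a - c * cnj c) *\<^sub>C \<iota> mH + ((2 * a * cnj c) *\<^sub>C \<iota> mE + (2 * c * cnj a) *\<^sub>C \<iota> mF)"
  "Ad_U k (\<iota> mE) = ((a * cnj b - c * cnj d) / 2) *\<^sub>C \<iota> mH + ((a * cnj d) *\<^sub>C \<iota> mE + (c * cnj b) *\<^sub>C \<iota> mF)"
  "Ad_U k (\<iota> mF) = ((b * cnj a - d * cnj c) / 2) *\<^sub>C \<iota> mH + ((b * cnj c) *\<^sub>C \<iota> mE + (d * cnj a) *\<^sub>C \<iota> mF)"
  by (simp_all add: Ad_U_\<iota> trace_zero_elements kconj_p kconj_k \<iota>_simps trace_linear)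

lemma unitary_relations:
  "a * cnj a - c * cnj c = - (b * cnj b - d * cnj d)" "2 * a * cnj c = - (2 * b * cnj d)" "2 * c * cnj a = - (2 * d * cnj b)"
proof -
  have "unitary2 a b c d" using Kgrp_unitary(1)[of k] by (simp add: k)
  note u = this[unfolded unitary2_def]
  show "a * cnj a - c * cnj c = - (b * cnj b - d * cnj d)" using u by algebra
  show "2 * a * cnj c = - (2 * b * cnj d)" "2 * c * cnj a = - (2 * d * cnj b)"
    using u by (simp_all add: add_eq_0_iff2)
qed

text \<open>The image of \<open>\<iota> mH\<close> has coefficients in the column
  \<open>a, c\<close>, whereas the pattern of the matrix units asks for \<open>b, d\<close> here;
  unitarity converts one into the other.\<close>

lemma Ad_UC_L22:
  "Ad_UC k (Lu22 \<otimes>\<^sub>T 1) = cnj b *\<^sub>C (b *\<^sub>C (Lu11 \<otimes>\<^sub>T 1) + d *\<^sub>C (\<iota> mF \<otimes>\<^sub>T 1)) + cnj d *\<^sub>C (b *\<^sub>C (\<iota> mE \<otimes>\<^sub>T 1) + d *\<^sub>C (Lu22 \<otimes>\<^sub>T 1))"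
  unfolding Ad_UC_tens Ad_one Lu22_def Lu11_def Ad_U_simps Ad_U_elements unitary_relations
  by (simp add: tens_simps tens_diff tens_minus cscale_cscale cscale_add_right cscale_diff_left cscale_minus_left
      cscale_minus_right cscale_diff_right diff_divide_distrib mult_ac ac_simps)

lemma k_hom_Ad_UC: "k_hom (Ad_UC k) a b c d"
  using Kgrp_unitary(1)[of k] by unfold_locales (simp_all add: Ad_UC_simps k)

lemma families:
  "k_hom.cov (Ad_UC k) a b c d (cnj s) (\<iota> mE1 \<otimes>\<^sub>T 1) (\<iota> mE2 \<otimes>\<^sub>T 1)"
  "k_hom.cov (Ad_UC k) a b c d (cnj s) (1 \<otimes>\<^sub>T \<gamma> mE1) (1 \<otimes>\<^sub>T \<gamma> mE2)"
  "k_hom.contra (Ad_UC k) a b c d s (\<iota> mF1 \<otimes>\<^sub>T 1) (\<iota> mF2 \<otimes>\<^sub>T 1)"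
  "k_hom.contra (Ad_UC k) a b c d s (1 \<otimes>\<^sub>T \<gamma> mF1) (1 \<otimes>\<^sub>T \<gamma> mF2)"
  "k_hom.mixed (Ad_UC k) a b c d (Lu11 \<otimes>\<^sub>T 1) (\<iota> mE \<otimes>\<^sub>T 1) (\<iota> mF \<otimes>\<^sub>T 1) (Lu22 \<otimes>\<^sub>T 1)"
  unfolding k_hom.cov_def[OF k_hom_Ad_UC] k_hom.contra_def[OF k_hom_Ad_UC] k_hom.mixed_def[OF k_hom_Ad_UC]
  by (simp_all add: Ad_UC_tens Ad_one Ad_C_p Ad_U_elements tens_simps)
     (simp_all add: Ad_UC_L22[unfolded Ad_UC_tens Ad_one] tens_simps,
      simp_all add: Lu11_def Lu22_def Ad_U_simps Ad_U_elements tens_simps tens_diff tens_minus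
       cscale_cscale cscale_add_right cscale_diff_left cscale_minus_left cscale_minus_right
       cscale_diff_right diff_divide_distrib mult_ac ac_simps)

end

section \<open>Symbols in the tensor product\<close>

definition tcoord :: "occ \<Rightarrow> (Ug, Cp) tensor \<Rightarrow> Ug" where
  "tcoord i = tensor_lift (\<lambda>u c. cvec c i *\<^sub>C u)"

lemma tcoord_tens: "tcoord i (u \<otimes>\<^sub>T c) = cvec c i *\<^sub>C u"
  unfolding tcoord_def
  by (rule tensor_lift_tens)
     (simp add: bilinear_map_def cvec_simps cscale_add_right cscale_add_left cscale_cscale mult.commute)

lemma tcoord_simps:
  "tcoord i 0 = 0" "tcoord i (x + y) = tcoord i x + tcoord i y" "tcoord i (x - y) = tcoord i x - tcoord i y"
  "tcoord i (z *\<^sub>C x) = z *\<^sub>C tcoord i x"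
  unfolding tcoord_def by (rule tensor_lift_simps)+

lemma tensor_expand: "x = (\<Sum>i\<in>UNIV. tcoord i x \<otimes>\<^sub>T cbasis i)"
proof (induction x rule: tensor_induct)
  case (tens u c)
  have "(\<Sum>i\<in>UNIV. tcoord i (u \<otimes>\<^sub>T c) \<otimes>\<^sub>T cbasis i) = u \<otimes>\<^sub>T (\<Sum>i\<in>UNIV. cvec c i *\<^sub>C cbasis i)"
    by (simp add: tens_sum tens_simps tcoord_tens)
  then show ?case by (simp flip: Cp_expand)
next
  case (add x y)
  have "(\<Sum>i\<in>UNIV. tcoord i (x + y) \<otimes>\<^sub>T cbasis i)
      = (\<Sum>i\<in>UNIV. tcoord i x \<otimes>\<^sub>T cbasis i) + (\<Sum>i\<in>UNIV. tcoord i y \<otimes>\<^sub>T cbasis i)"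
    by (simp add: tcoord_simps tens_simps sum.distrib)
  then show ?case using add by simp
qed

lemma tensor_eq_0I: "(\<And>i. tcoord i x = 0) \<Longrightarrow> x = 0"
  using tensor_expand[of x] by simp

definition Tfil :: "nat \<Rightarrow> (Ug, Cp) tensor set" where
  "Tfil n = {x. \<forall>i. tcoord i x \<in> Ufil n}"

lemma Tfil_closed:
  "0 \<in> Tfil n" "x \<in> Tfil n \<Longrightarrow> y \<in> Tfil n \<Longrightarrow> x + y \<in> Tfil n" "x \<in> Tfil n \<Longrightarrow> y \<in> Tfil n \<Longrightarrow> x - y \<in> Tfil n"
  "x \<in> Tfil n \<Longrightarrow> z *\<^sub>C x \<in> Tfil n"
  by (auto simp: Tfil_def tcoord_simps intro: Ufil.zero Ufil_add Ufil_diff Ufil_scale)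

lemma Tfil_sum: "(\<And>i. i \<in> A \<Longrightarrow> f i \<in> Tfil n) \<Longrightarrow> sum f A \<in> Tfil n"
  by (induction A rule: infinite_finite_induct) (auto intro: Tfil_closed)

lemma Tfil_tens: "u \<in> Ufil n \<Longrightarrow> u \<otimes>\<^sub>T c \<in> Tfil n"
  by (simp add: Tfil_def tcoord_tens Ufil_scale)

lemma Tfil_mono: "x \<in> Tfil m \<Longrightarrow> m \<le> n \<Longrightarrow> x \<in> Tfil n"
  unfolding Tfil_def using Ufil_mono by blast

lemma Tfil_induct [consumes 1, case_names tens add]:
  assumes x: "x \<in> Tfil n" and tens: "\<And>u c. u \<in> Ufil n \<Longrightarrow> P (u \<otimes>\<^sub>T c)"
    and add: "\<And>x y. P x \<Longrightarrow> P y \<Longrightarrow> P (x + y)"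
  shows "P x"
proof -
  have "P (\<Sum>i\<in>A. tcoord i x \<otimes>\<^sub>T cbasis i)" if "finite A" for A
    using that
  proof (induction A rule: finite_induct)
    case empty
    then show ?case using tens[OF Ufil.zero, of 0] by simp
  next
    case (insert i A)
    moreover have "tcoord i x \<in> Ufil n" using x unfolding Tfil_def by blast
    ultimately show ?case by (simp add: add tens)
  qed
  from this[of UNIV] show ?thesis using tensor_expand[of x] by simp
qed

lemma Tfil_exists: "\<exists>n. x \<in> Tfil n"
proof (induction x rule: tensor_induct)
  case (tens u c)
  then show ?case using Ufil_exists[of u] Tfil_tens by blast
next
  case (add x y)
  then obtain m n where "x \<in> Tfil m" "y \<in> Tfil n" by blast
  then have "x + y \<in> Tfil (max m n)"
    by (meson Tfil_closed(2) Tfil_mono max.cobounded1 max.cobounded2)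
  then show ?case by blast
qed

text \<open>Only the factor in \<open>U(\<gg>)\<close> is replaced by its symbol. Values stay in the
  noncommutative \<open>C(\<pp>)\<close>, so symbols of products keep the order of the
  factors.\<close>

definition tsym :: "nat \<Rightarrow> (Ug, Cp) tensor \<Rightarrow> mat3 \<Rightarrow> Cp" where
  "tsym n x y = (\<Sum>i\<in>UNIV. Usym n (tcoord i x) y *\<^sub>C cbasis i)"

lemma cvec_tsym: "cvec (tsym n x y) i = Usym n (tcoord i x) y"
  by (simp add: tsym_def cvec_sum cvec_simps cvec_cbasis mult_delta_right)

lemma tsym_simps:
  "tsym n 0 y = 0" "tsym n (x + x') y = tsym n x y + tsym n x' y" "tsym n (x - x') y = tsym n x y - tsym n x' y"
  "tsym n (z *\<^sub>C x) y = z *\<^sub>C tsym n x y"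
  by (rule Cp_eqI; simp add: cvec_tsym cvec_simps tcoord_simps Usym_simps)+

lemma tsym_sum: "tsym n (sum f A) y = (\<Sum>i\<in>A. tsym n (f i) y)"
  by (induction A rule: infinite_finite_induct) (simp_all add: tsym_simps)

lemma tsym_tens: "tsym n (u \<otimes>\<^sub>T c) y = Usym n u y *\<^sub>C c"
  by (rule Cp_eqI) (simp add: cvec_tsym cvec_simps tcoord_tens Usym_simps mult.commute)

lemma Tfil_mult:
  assumes "x \<in> Tfil m" "x' \<in> Tfil n"
  shows "x * x' \<in> Tfil (m + n)" "tsym (m + n) (x * x') y = tsym m x y * tsym n x' y"
proof -
  have "x * x' \<in> Tfil (m + n) \<and> tsym (m + n) (x * x') y = tsym m x y * tsym n x' y"
    using assms(1)
  proof (induction rule: Tfil_induct)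
    case (tens u c)
    from assms(2) show ?case
    proof (induction rule: Tfil_induct)
      case (tens u' c')
      then show ?case using \<open>u \<in> Ufil m\<close>
        by (simp add: tens_mult tsym_tens Tfil_tens Ufil_mult Usym_mult cscale_mult cscale_cscale mult.commute)
    qed (simp add: distrib_left tsym_simps Tfil_closed)
  qed (simp add: distrib_right tsym_simps Tfil_closed)
  then show "x * x' \<in> Tfil (m + n)" "tsym (m + n) (x * x') y = tsym m x y * tsym n x' y" by auto
qed

lemma tsym_eq_0_imp_low:
  assumes "x \<in> Tfil n" "\<And>z. tsym n x (ymat z) = 0" shows "tcoord i x \<in> Ulow n"
  using assms Usym_eq_0_imp_Ulow[of "tcoord i x" n] by (metis (no_types, lifting) Tfil_def cvec_simps(5) cvec_tsym mem_Collect_eq)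

section \<open>Equivariance of symbols\<close>

lemma Ad_U_zero: "Ad_U k 0 = 0"
  using Ad_U_simps(1)[of k 0 0] by simp

lemma Ad_C_zero: "Ad_C k 0 = 0"
  using Ad_C_simps(1)[of k 0 0] by simp

lemma Ad_C_sum: "Ad_C k (sum f A) = (\<Sum>i\<in>A. Ad_C k (f i))"
  by (induction A rule: infinite_finite_induct) (simp_all add: Ad_C_zero Ad_C_simps)

lemma Ad_U_Uword: "Ad_U k (Uword xs) = Uword (map (Ad_g k) xs)"
  by (induction xs) (simp_all add: Uword_simps Ad_one Ad_U_simps Ad_U_U_incl)

lemma trace_kconj: "trace (kconj k A ** kconj k B) = trace (A ** B)"
proof -
  have "trace (kconj k A ** kconj k B) = trace (kconj k (A ** B))"
    by (simp add: kconj_def conj_mult Rep_Kgrp_facts)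
  also have "\<dots> = trace (conj_transpose (Rep_Kgrp k) ** (Rep_Kgrp k ** (A ** B)))"
    unfolding kconj_def by (rule trace_mul_sym)
  finally show ?thesis by (simp add: matrix_mul_assoc Rep_Kgrp_facts)
qed

lemma Ad_U_Ufil:
  assumes "u \<in> Ufil n" shows "Ad_U k u \<in> Ufil n \<and> Usym n (Ad_U k u) (kconj k y) = Usym n u y"
  using assms
proof (induction rule: Ufil.induct)
  case (step xs x z)
  then show ?case
    by (auto simp: Ad_U_simps Ad_U_Uword Usym_simps Usym_Uword Rep_Ad_g trace_kconj comp_def intro!: Ufil.step)
qed (simp add: Ad_U_zero Ufil.zero Usym_simps)

lemma tsym_Ad_UC:
  assumes "x \<in> Tfil n" shows "tsym n (Ad_UC k x) (kconj k y) = Ad_C k (tsym n x y)"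
  using assms
proof (induction rule: Tfil_induct)
  case (tens u c)
  then show ?case using Ad_U_Ufil[of u n k y] by (simp add: Ad_UC_tens tsym_tens Ad_C_simps)
qed (simp add: Ad_UC_simps tsym_simps Ad_C_simps)

section \<open>\<open>K\<close> acts on symbols through all of \<open>U(2)\<close>\<close>

text \<open>Elements of \<open>K\<close> need determinant 1. The block diagonal matrix with blocks
  \<open>((a, b), (c, d))\<close> and 1, multiplied by the scalar \<open>w\<close>, has determinant
  \<open>w ^ 3 * \<delta>\<close>, so \<open>w\<close> is a cube root of the conjugate of
  \<open>\<delta>\<close>. The scalar disappears under conjugation, which leaves the untwisted
  action of \<open>U(2)\<close>.\<close>

lemma Kgrp_exists:
  assumes u: "unitary2 a b c d"
  shows "\<exists>k w. w * cnj w = 1 \<and> Rep_Kgrp k $ 1 $ 1 = w * a \<and> Rep_Kgrp k $ 1 $ 2 = w * b \<and>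
     Rep_Kgrp k $ 2 $ 1 = w * c \<and> Rep_Kgrp k $ 2 $ 2 = w * d \<and> Rep_Kgrp k $ 3 $ 3 = w"
proof -
  define \<delta> where "\<delta> = a * d - b * c"
  have "\<delta> * cnj \<delta> = (a * cnj a + b * cnj b) * (c * cnj c + d * cnj d) - (a * cnj c + b * cnj d) * (c * cnj a + d * cnj b)"
    by (simp add: \<delta>_def algebra_simps)
  then have \<delta>: "\<delta> * cnj \<delta> = 1" using u by (simp add: unitary2_def)
  obtain w where w: "cnj \<delta> = w ^ 3" using exists_complex_root[of 3 "cnj \<delta>"] by auto
  have w3: "w ^ 3 * \<delta> = 1" using \<delta> by (simp add: w[symmetric] mult.commute)
  have "norm \<delta> = 1"
    using \<delta> by (metis complex_mod_mult_cnj norm_one power2_eq_1_iff norm_ge_zero abs_norm_cancel abs_of_nonneg power2_eq_square real_sqrt_abs real_sqrt_one)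
  then have "norm w ^ 3 = 1" using w by (metis complex_mod_cnj norm_power)
  then have "norm w = 1" using power_eq_imp_eq_base[of "norm w" 3 1] by simp
  then have ww: "w * cnj w = 1" by (simp add: complex_norm_square[symmetric])
  then have ww': "cnj w * w = 1" by (simp add: mult.commute)
  define m :: mat3 where "m = (\<chi> i j. if i = 3 then (if j = 3 then w else 0)
     else if j = 3 then 0 else w * (if i = 1 then (if j = 1 then a else b) else (if j = 1 then c else d)))"
  have m: "m $ 1 $ 1 = w * a" "m $ 1 $ 2 = w * b" "m $ 2 $ 1 = w * c" "m $ 2 $ 2 = w * d" "m $ 3 $ 3 = w"
    "m $ 1 $ 3 = 0" "m $ 2 $ 3 = 0" "m $ 3 $ 1 = 0" "m $ 3 $ 2 = 0"
    by (simp_all add: m_def)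
  have sc: "w * x * (cnj w * y) + w * x' * (cnj w * y') = x * y + x' * y'"
    "cnj w * x * (w * y) + cnj w * x' * (w * y') = x * y + x' * y'" for x y x' y'
  proof -
    have "w * x * (cnj w * y) + w * x' * (cnj w * y') = (w * cnj w) * (x * y + x' * y')"
      "cnj w * x * (w * y) + cnj w * x' * (w * y') = (w * cnj w) * (x * y + x' * y')"
      by (simp_all add: algebra_simps)
    then show "w * x * (cnj w * y) + w * x' * (cnj w * y') = x * y + x' * y'"
      "cnj w * x * (w * y) + cnj w * x' * (w * y') = x * y + x' * y'" by (simp_all add: ww)
  qed
  have "conj_transpose m ** m = mat 1" "m ** conj_transpose m = mat 1"
    unfolding mat3_eq_iff forall_3 mult_nth_3
    using u by (simp_all add: conj_transpose_def mat_def m sc ww ww' unitary2_def)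
  moreover have "det m = w ^ 3 * \<delta>"
    by (simp add: det_3 m \<delta>_def power3_eq_cube algebra_simps)
  ultimately have "m \<in> {k. conj_transpose k ** k = mat 1 \<and> k ** conj_transpose k = mat 1 \<and> det k = 1
    \<and> k$1$3 = 0 \<and> k$2$3 = 0 \<and> k$3$1 = 0 \<and> k$3$2 = 0}"
    using w3 m by simp
  then have "Rep_Kgrp (Abs_Kgrp m) = m" by (rule Abs_Kgrp_inverse)
  then show ?thesis using m ww by (intro exI[of _ "Abs_Kgrp m"] exI[of _ w]) simp
qed

lemma Kgrp_ymat:
  assumes u: "unitary2 a b c d"
  shows "\<exists>k. (\<forall>z. kconj k (ymat z) = ymat (u_act a b c d z)) \<and>
     Ad_C k (\<gamma> mE1) = a *\<^sub>C \<gamma> mE1 + c *\<^sub>C \<gamma> mE2 \<and> Ad_C k (\<gamma> mE2) = b *\<^sub>C \<gamma> mE1 + d *\<^sub>C \<gamma> mE2 \<and>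
     Ad_C k (\<gamma> mF1) = cnj a *\<^sub>C \<gamma> mF1 + cnj c *\<^sub>C \<gamma> mF2 \<and> Ad_C k (\<gamma> mF2) = cnj b *\<^sub>C \<gamma> mF1 + cnj d *\<^sub>C \<gamma> mF2"
proof -
  obtain k w where w: "w * cnj w = 1" and k: "Rep_Kgrp k $ 1 $ 1 = w * a" "Rep_Kgrp k $ 1 $ 2 = w * b"
     "Rep_Kgrp k $ 2 $ 1 = w * c" "Rep_Kgrp k $ 2 $ 2 = w * d" "Rep_Kgrp k $ 3 $ 3 = w"
    using Kgrp_exists[OF u] by blast
  have w': "cnj w * (w * x) = x" "w * (cnj w * x) = x" for x
    using w by (metis mult.assoc mult.commute mult_1)+
  have sw: "w * x * (cnj w * y) = x * y" "w * x * cnj w = x" for x y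
    using w by (metis mult.assoc mult.commute mult_1)+
  have "kconj k (ymat z) = ymat (u_act a b c d z)" for z
  proof -
    have s1: "(w * a1 * x + w * a2 * y) * (cnj w * t) = (a1 * x + a2 * y) * t" for a1 a2 x y t
      using sw(1)[of "a1 * x + a2 * y" t] by (simp add: algebra_simps)
    have s2: "(w * a1 * x + w * a2 * y) * cnj w = a1 * x + a2 * y" for a1 a2 x y
      using sw(2)[of "a1 * x + a2 * y"] by (simp add: algebra_simps)
    have s3: "w * x * (cnj w * t) + w * y * (cnj w * s) = x * t + y * s" for x y t s
      by (simp only: sw)
    show ?thesis
      unfolding mat3_eq_iff forall_3 kconj_def mult_nth_3
      by (simp add: conj_transpose_def k Rep_Kgrp_facts) (simp add: ymat_def gl_act_nth s1 s2 s3)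
  qed
  then show ?thesis
    using Ad_C_p[OF k] by (intro exI[of _ k]) (simp add: cscale_add_right cscale_cscale w')
qed

abbreviation "o0 \<equiv> (False, False, False, False)"
abbreviation "oE1 \<equiv> (True, False, False, False)"
abbreviation "oE2 \<equiv> (False, True, False, False)"
abbreviation "oF1 \<equiv> (False, False, True, False)"
abbreviation "oF2 \<equiv> (False, False, False, True)"
abbreviation "oEE \<equiv> (True, True, False, False)"
abbreviation "oFF \<equiv> (False, False, True, True)"
abbreviation "o11 \<equiv> (True, False, True, False)"
abbreviation "o12 \<equiv> (True, False, False, True)"
abbreviation "o21 \<equiv> (False, True, True, False)"
abbreviation "o22 \<equiv> (False, True, False, True)"
abbreviation "oEE1 \<equiv> (True, True, True, False)"
abbreviation "oEE2 \<equiv> (True, True, False, True)"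
abbreviation "oFF1 \<equiv> (True, False, True, True)"
abbreviation "oFF2 \<equiv> (False, True, True, True)"
abbreviation "oall \<equiv> (True, True, True, True)"

lemma cvec_Ad_C_sum: "cvec (Ad_C k x) i = (\<Sum>j\<in>UNIV. cvec x j * cvec (Ad_C k (cbasis j)) i)"
proof -
  have "Ad_C k x = Ad_C k (\<Sum>j\<in>UNIV. cvec x j *\<^sub>C cbasis j)" using Cp_expand[of x] by simp
  also have "cvec \<dots> i = (\<Sum>j\<in>UNIV. cvec x j * cvec (Ad_C k (cbasis j)) i)"
    by (simp add: Ad_C_sum Ad_C_simps cvec_sum cvec_simps)
  finally show ?thesis .
qed

text \<open>\<open>K\<close> preserves the span of the \<open>E\<close>s and the span of the
  \<open>F\<close>s. Each of them consists of anticommuting elements of square 0, so normal order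
  survives and no contraction terms occur: the coordinates transform as in a product of two exterior
  algebras.\<close>

lemma cvec_Ad_C:
  fixes x :: Cp
  assumes k: "Ad_C k (\<gamma> mE1) = a *\<^sub>C \<gamma> mE1 + c *\<^sub>C \<gamma> mE2" "Ad_C k (\<gamma> mE2) = b *\<^sub>C \<gamma> mE1 + d *\<^sub>C \<gamma> mE2"
    "Ad_C k (\<gamma> mF1) = a' *\<^sub>C \<gamma> mF1 + b' *\<^sub>C \<gamma> mF2" "Ad_C k (\<gamma> mF2) = c' *\<^sub>C \<gamma> mF1 + d' *\<^sub>C \<gamma> mF2"
  defines "v \<equiv> cvec x" and "v' \<equiv> cvec (Ad_C k x)"
  shows "v' o0 = v o0"
    "v' oE1 = a * v oE1 + b * v oE2" "v' oE2 = c * v oE1 + d * v oE2"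
    "v' oF1 = v oF1 * a' + v oF2 * c'" "v' oF2 = v oF1 * b' + v oF2 * d'"
    "v' oEE = (a * d - b * c) * v oEE" "v' oFF = (a' * d' - b' * c') * v oFF"
    "v' o11 = (a * v o11 + b * v o21) * a' + (a * v o12 + b * v o22) * c'"
    "v' o12 = (a * v o11 + b * v o21) * b' + (a * v o12 + b * v o22) * d'"
    "v' o21 = (c * v o11 + d * v o21) * a' + (c * v o12 + d * v o22) * c'"
    "v' o22 = (c * v o11 + d * v o21) * b' + (c * v o12 + d * v o22) * d'"
    "v' oEE1 = (a * d - b * c) * (v oEE1 * a' + v oEE2 * c')"
    "v' oEE2 = (a * d - b * c) * (v oEE1 * b' + v oEE2 * d')"
    "v' oFF1 = (a' * d' - b' * c') * (a * v oFF1 + b * v oFF2)"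
    "v' oFF2 = (a' * d' - b' * c') * (c * v oFF1 + d * v oFF2)"
    "v' oall = (a * d - b * c) * (a' * d' - b' * c') * v oall"
  unfolding v_def v'_def cvec_Ad_C_sum[of k x]
  by (simp_all add: sum_occ sum_bool Ad_C_simps Ad_one k)
     (simp_all add: cvec_def Cp_act_simps Cp_act_\<gamma> op_defs vacuum_def algebra_simps)

lemma ymat_cong:
  assumes "\<And>j. j < 8 \<Longrightarrow> z j = w j" shows "ymat z = ymat w"
proof -
  have eq: "z 0 = w 0" "z 1 = w 1" "z 2 = w 2" "z 3 = w 3" "z 4 = w 4" "z 5 = w 5" "z 6 = w 6" "z 7 = w 7"
    by (rule assms, simp)+
  show ?thesis by (simp only: ymat_def eq)
qed

lemma PF_ymat: "(\<lambda>z. ymat z $ i $ j) \<in> PF"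
proof -
  have i: "i = 1 \<or> i = 2 \<or> i = 3" and j: "j = 1 \<or> j = 2 \<or> j = 3" by (rule exhaust_3)+
  show ?thesis using i j by (elim disjE) (simp_all add: ymat_def PF.intros)
qed

lemma PF_trace_ymat: "(\<lambda>z. trace (ymat z ** M)) \<in> PF"
  unfolding trace_3 mult_nth_3 by (intro PF_intros PF_ymat)

lemma PF_Usym: "u \<in> Ufil n \<Longrightarrow> (\<lambda>z. Usym n u (ymat z)) \<in> PF"
proof (induction rule: Ufil.induct)
  case (step xs x z)
  have "(\<lambda>z. \<Prod>X\<leftarrow>xs. trace (ymat z ** Rep_sl3 X)) \<in> PF" for xs
    by (induction xs) (auto intro: PF_intros PF_trace_ymat)
  then have "(\<lambda>z. Usym n (Uword xs) (ymat z)) \<in> PF"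
    using step(1) by (cases "length xs = n") (simp_all add: Usym_Uword PF.const)
  then show ?case using step by (simp add: Usym_simps PF_intros)
qed (simp add: Usym_simps PF.const)

lemma depends8_Usym: "depends8 (\<lambda>z. Usym n u (ymat z))"
  unfolding depends8_def using ymat_cong by metis

lemma Usym_homogeneous:
  "u \<in> Ufil n \<Longrightarrow> Usym n u (ymat (\<lambda>j. t * z j)) = t ^ n * Usym n u (ymat z)"
proof (induction rule: Ufil.induct)
  case (step xs x w)
  have tr: "trace (ymat (\<lambda>j. t * z j) ** M) = t * trace (ymat z ** M)" for M
    by (simp add: trace_3 mult_nth_3 ymat_def algebra_simps)
  have "(\<Prod>X\<leftarrow>xs. trace (ymat (\<lambda>j. t * z j) ** Rep_sl3 X)) = t ^ length xs * (\<Prod>X\<leftarrow>xs. trace (ymat z ** Rep_sl3 X))" for xs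
    by (induction xs) (simp_all add: tr)
  then have "Usym n (Uword xs) (ymat (\<lambda>j. t * z j)) = t ^ n * Usym n (Uword xs) (ymat z)"
    using step(1) by (simp add: Usym_Uword)
  then show ?case using step by (simp add: Usym_simps algebra_simps)
qed (simp add: Usym_simps)

section \<open>The symbols of the proposed basis\<close>

lemma \<iota>_Ufil: "\<iota> A \<in> Ufil 1"
  unfolding \<iota>_def by (rule U_incl_Ufil)

lemma Usym_\<iota>: "trace A = 0 \<Longrightarrow> Usym 1 (\<iota> A) y = trace (y ** A)"
  by (simp add: \<iota>_def Usym_U_incl[unfolded One_nat_def] Abs_sl3_inverse)

lemma Usym_elements:
  "Usym 1 (\<iota> mH) (ymat z) = z 0 - z 3" "Usym 1 (\<iota> mE) (ymat z) = z 2" "Usym 1 (\<iota> mF) (ymat z) = z 1"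
  "Usym 1 (\<iota> mE1) (ymat z) = z 6" "Usym 1 (\<iota> mE2) (ymat z) = z 7"
  "Usym 1 (\<iota> mF1) (ymat z) = z 4" "Usym 1 (\<iota> mF2) (ymat z) = z 5"
  by (simp_all only: Usym_\<iota> trace_zero_elements)
     (simp_all add: trace_3 mult_nth_3 ymat_def mH_def mH1_def mH2_def mE_def mF_def mE1_def mE2_def mF1_def mF2_def)

lemma Usym_\<iota>_mult: "Usym 2 (\<iota> A * \<iota> B) y = Usym 1 (\<iota> A) y * Usym 1 (\<iota> B) y"
  using Usym_mult[OF \<iota>_Ufil \<iota>_Ufil, of A B y] by (simp add: numeral_2_eq_2)

lemma \<iota>_mult_Ufil: "\<iota> A * \<iota> B \<in> Ufil 2"
  using Ufil_mult[OF \<iota>_Ufil \<iota>_Ufil, of A B] by (simp add: numeral_2_eq_2)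

text \<open>The column \<open>(2 A - tr A) u\<close> and the row \<open>v (2 A - tr A)\<close>. Only
  \<open>H\<close>, \<open>E\<close>, \<open>F\<close> enter the given elements from
  \<open>\<kk>\<close>, hence the trace-free matrix.\<close>

definition pc1 :: "point \<Rightarrow> complex" where "pc1 z = (z 0 - z 3) * z 4 + 2 * z 1 * z 5"
definition pc2 :: "point \<Rightarrow> complex" where "pc2 z = 2 * z 2 * z 4 - (z 0 - z 3) * z 5"
definition rc1 :: "point \<Rightarrow> complex" where "rc1 z = (z 0 - z 3) * z 6 + 2 * z 2 * z 7"
definition rc2 :: "point \<Rightarrow> complex" where "rc2 z = 2 * z 1 * z 6 - (z 0 - z 3) * z 7"

lemmas pr_defs = pc1_def pc2_def rc1_def rc2_def

definition S_e :: "(nat \<Rightarrow> complex) \<Rightarrow> Cp" where "S_e z = z 4 *\<^sub>C \<gamma> mE1 + z 5 *\<^sub>C \<gamma> mE2"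
definition S_f :: "(nat \<Rightarrow> complex) \<Rightarrow> Cp" where "S_f z = z 6 *\<^sub>C \<gamma> mF1 + z 7 *\<^sub>C \<gamma> mF2"
definition S_g :: "(nat \<Rightarrow> complex) \<Rightarrow> Cp" where "S_g z = \<gamma> mE1 * \<gamma> mF1 + \<gamma> mE2 * \<gamma> mF2"
definition S_h :: "(nat \<Rightarrow> complex) \<Rightarrow> Cp" where "S_h z = rc1 z *\<^sub>C \<gamma> mF1 + rc2 z *\<^sub>C \<gamma> mF2"
definition S_i :: "(nat \<Rightarrow> complex) \<Rightarrow> Cp" where
  "S_i z = (2 * z 2) *\<^sub>C (\<gamma> mE2 * \<gamma> mF1) + (z 0 - z 3) *\<^sub>C (\<gamma> mE1 * \<gamma> mF1)
     - (z 0 - z 3) *\<^sub>C (\<gamma> mE2 * \<gamma> mF2) + (2 * z 1) *\<^sub>C (\<gamma> mE1 * \<gamma> mF2)"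
definition S_j :: "(nat \<Rightarrow> complex) \<Rightarrow> Cp" where "S_j z = pc1 z *\<^sub>C \<gamma> mE1 + pc2 z *\<^sub>C \<gamma> mE2"

lemmas S_defs = S_e_def S_f_def S_g_def S_h_def S_i_def S_j_def

lemma generators_Tfil: "t_e \<in> Tfil 1" "t_f \<in> Tfil 1" "t_g \<in> Tfil 0" "t_h \<in> Tfil 2" "t_i \<in> Tfil 1" "t_j \<in> Tfil 2"
  unfolding t_e_def t_f_def t_g_def t_h_def t_i_def t_j_def
  by (intro Tfil_closed Tfil_tens Ufil_add Ufil_diff Ufil_scale Ufil_uminus \<iota>_Ufil \<iota>_mult_Ufil Ufil_one)+

lemma Usym_uminus: "Usym n (- u) y = - Usym n u y"
  using Usym_simps(2)[of n 0 u y] by (simp add: Usym_simps)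

lemma tsym_generators:
  "tsym 1 t_e (ymat z) = S_e z" "tsym 1 t_f (ymat z) = S_f z" "tsym 0 t_g (ymat z) = S_g z"
  "tsym 2 t_h (ymat z) = S_h z" "tsym 1 t_i (ymat z) = S_i z" "tsym 2 t_j (ymat z) = S_j z"
  unfolding t_e_def t_f_def t_g_def t_h_def t_i_def t_j_def S_defs pr_defs
  by (simp_all only: tsym_simps tsym_tens Usym_simps Usym_uminus Usym_\<iota>_mult Usym_elements Usym_one cscale_one)
     (simp_all add: algebra_simps)

definition T_elt :: "nat \<Rightarrow> (Ug, Cp) tensor" where
  "T_elt b = [1, t_e, t_f, t_g, t_h, t_i, t_j, t_e * t_f, t_e * t_g, t_f * t_g, t_g ^ 2,
            t_e * t_i, t_e * t_j, t_f * t_h, t_f * t_i, t_f * t_j] ! b"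

text \<open>The degrees count only the factors in \<open>U(\<gg>)\<close>.\<close>

definition T_deg :: "nat \<Rightarrow> nat" where
  "T_deg b = [0, 1, 1, 0, 2, 1, 2, 2, 1, 1, 0, 2, 3, 3, 2, 3] ! b"

definition T_sym :: "nat \<Rightarrow> (nat \<Rightarrow> complex) \<Rightarrow> Cp" where
  "T_sym b z = [1, S_e z, S_f z, S_g z, S_h z, S_i z, S_j z, S_e z * S_f z, S_e z * S_g z, S_f z * S_g z, S_g z ^ 2,
            S_e z * S_i z, S_e z * S_j z, S_f z * S_h z, S_f z * S_i z, S_f z * S_j z] ! b"

lemma less_16_cases:
  assumes "(b :: nat) < 16" shows "b \<in> {0, 1, 2, 3, 4, 5, 6, 7, 8, 9, 10, 11, 12, 13, 14, 15}"
proof -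
  have "b \<in> set [0..<16]" using assms by simp
  also have "[0..<16] = [0, 1, 2, 3, 4, 5, 6, 7, 8, 9, 10, 11, 12, 13, 14, 15]" by (simp add: upt_rec)
  finally show ?thesis by simp
qed

lemma T_set_eq: "T_set = T_elt ` {..<16}"
proof -
  have "{..<16} = set [0..<16]" by auto
  also have "[0..<16] = [0, 1, 2, 3, 4, 5, 6, 7, 8, 9, 10, 11, 12, 13, 14, 15]" by (simp add: upt_rec)
  finally show ?thesis by (simp add: T_set_def T_elt_def)
qed

lemma Tfil_one: "1 \<in> Tfil 0" "tsym 0 1 y = 1"
  using Tfil_tens[OF Ufil_one, of 1 0] tsym_tens[of 0 1 1 y] by (simp_all add: tens_one Usym_one cscale_one)

lemma T_elt_Tfil_tsym:
  assumes "b < 16" shows "T_elt b \<in> Tfil (T_deg b) \<and> tsym (T_deg b) (T_elt b) (ymat z) = T_sym b z"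
proof -
  note [simp] = T_elt_def T_deg_def T_sym_def power2_eq_square
  note g = generators_Tfil and s = tsym_generators
  note mult = Tfil_mult(1)[OF g(1) g(2)] Tfil_mult(1)[OF g(1) g(3)] Tfil_mult(1)[OF g(2) g(3)] Tfil_mult(1)[OF g(3) g(3)]
    Tfil_mult(1)[OF g(1) g(5)] Tfil_mult(1)[OF g(1) g(6)] Tfil_mult(1)[OF g(2) g(4)] Tfil_mult(1)[OF g(2) g(5)]
    Tfil_mult(1)[OF g(2) g(6)]
  note smult = Tfil_mult(2)[OF g(1) g(2), of "ymat z"] Tfil_mult(2)[OF g(1) g(3), of "ymat z"]
    Tfil_mult(2)[OF g(2) g(3), of "ymat z"] Tfil_mult(2)[OF g(3) g(3), of "ymat z"]
    Tfil_mult(2)[OF g(1) g(5), of "ymat z"] Tfil_mult(2)[OF g(1) g(6), of "ymat z"]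
    Tfil_mult(2)[OF g(2) g(4), of "ymat z"] Tfil_mult(2)[OF g(2) g(5), of "ymat z"]
    Tfil_mult(2)[OF g(2) g(6), of "ymat z"]
  show ?thesis
    using less_16_cases[OF assms] mult smult[unfolded s]
    by (elim insertE emptyE)
       (simp_all add: g[simplified] s[simplified] g[unfolded numeral_2_eq_2] s[unfolded numeral_2_eq_2]
         Tfil_one numeral_2_eq_2 numeral_3_eq_3)
qed

definition table :: "(occ \<times> complex) list \<Rightarrow> occ \<Rightarrow> complex" where
  "table ps i = (case map_of ps i of None \<Rightarrow> 0 | Some v \<Rightarrow> v)"

lemma occ_ext: "\<forall>a b c d. f (a, b, c, d) = g (a, b, c, d) \<Longrightarrow> f = (g :: occ \<Rightarrow> complex)"
  by (simp add: fun_eq_iff)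

lemma cvec_S:
  "cvec 1 = table [(o0, 1)]"
  "cvec (S_e z) = table [(oE1, z 4), (oE2, z 5)]"
  "cvec (S_f z) = table [(oF1, z 6), (oF2, z 7)]"
  "cvec (S_g z) = table [(o11, 1), (o22, 1)]"
  "cvec (S_h z) = table [(oF1, rc1 z), (oF2, rc2 z)]"
  "cvec (S_i z) = table [(o11, z 0 - z 3), (o12, 2 * z 1), (o21, 2 * z 2), (o22, z 3 - z 0)]"
  "cvec (S_j z) = table [(oE1, pc1 z), (oE2, pc2 z)]"
  "cvec (S_e z * S_f z) = table [(o11, z 4 * z 6), (o12, z 4 * z 7), (o21, z 5 * z 6), (o22, z 5 * z 7)]"
  "cvec (S_e z * S_g z) = table [(oEE1, - z 5), (oEE2, z 4)]"
  "cvec (S_f z * S_g z) = table [(oF1, - 2 * z 6), (oF2, - 2 * z 7), (oFF1, z 7), (oFF2, - z 6)]"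
  "cvec (S_g z ^ 2) = table [(o11, - 2), (o22, - 2), (oall, - 2)]"
  "cvec (S_e z * S_i z) = table [(oEE1, pc2 z), (oEE2, - pc1 z)]"
  "cvec (S_e z * S_j z) = table [(oEE, z 4 * pc2 z - z 5 * pc1 z)]"
  "cvec (S_f z * S_h z) = table [(oFF, z 6 * rc2 z - z 7 * rc1 z)]"
  "cvec (S_f z * S_i z) = table [(oF1, - 2 * rc1 z), (oF2, - 2 * rc2 z), (oFF1, - rc2 z), (oFF2, rc1 z)]"
  "cvec (S_f z * S_j z) = table [(o0, - 2 * (z 6 * pc1 z + z 7 * pc2 z)), (o11, - pc1 z * z 6), (o12, - pc1 z * z 7),
     (o21, - pc2 z * z 6), (o22, - pc2 z * z 7)]"
  by (rule occ_ext, simp add: table_def cvec_def Cp_act_simps Cp_act_\<gamma> op_defs vacuum_def S_defs all_bool_eq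
      power2_eq_square pr_defs algebra_simps)+

lemma sum_16: "(\<Sum>b<16. g b) = g 0 + g 1 + g 2 + g 3 + g 4 + g 5 + g 6 + g 7 + g 8 + g 9 + g 10 + g 11
    + g 12 + g 13 + g 14 + g 15" for g :: "nat \<Rightarrow> complex"
  by (simp add: numeral_nat lessThan_Suc algebra_simps)

lemma T_sym_coordinates:
  fixes G :: "nat \<Rightarrow> complex" and z
  defines "v \<equiv> cvec (\<Sum>b<16. G b *\<^sub>C T_sym b z)"
  shows "v o0 = G 0 - 2 * (z 6 * pc1 z + z 7 * pc2 z) * G 15"
    "v oE1 = G 1 * z 4 + G 6 * pc1 z" "v oE2 = G 1 * z 5 + G 6 * pc2 z"
    "v oF1 = (G 2 - 2 * G 9) * z 6 + (G 4 - 2 * G 14) * rc1 z"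
    "v oF2 = (G 2 - 2 * G 9) * z 7 + (G 4 - 2 * G 14) * rc2 z"
    "v oEE = G 12 * (z 4 * pc2 z - z 5 * pc1 z)" "v oFF = G 13 * (z 6 * rc2 z - z 7 * rc1 z)"
    "v o11 = G 3 - 2 * G 10 + G 5 * (z 0 - z 3) + (G 7 * z 4 - G 15 * pc1 z) * z 6"
    "v o12 = G 5 * (2 * z 1) + (G 7 * z 4 - G 15 * pc1 z) * z 7"
    "v o21 = G 5 * (2 * z 2) + (G 7 * z 5 - G 15 * pc2 z) * z 6"
    "v o22 = G 3 - 2 * G 10 + G 5 * (z 3 - z 0) + (G 7 * z 5 - G 15 * pc2 z) * z 7"
    "v oEE1 = - G 8 * z 5 + G 11 * pc2 z" "v oEE2 = G 8 * z 4 - G 11 * pc1 z"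
    "v oFF1 = G 9 * z 7 - G 14 * rc2 z" "v oFF2 = - G 9 * z 6 + G 14 * rc1 z"
    "v oall = - 2 * G 10"
  unfolding v_def cvec_sum cvec_simps sum_16
  by (simp_all add: T_sym_def cvec_S table_def algebra_simps)

lemma det_pc: "z 4 * pc2 z - z 5 * pc1 z = 2 * \<Delta>u z" and det_rc: "z 6 * rc2 z - z 7 * rc1 z = 2 * \<Delta>v z"
  by (simp_all add: pr_defs cov_defs algebra_simps)

lemma solve2:
  fixes g h :: complex
  assumes "g * u1 + h * p1 = 0" "g * u2 + h * p2 = 0" "u1 * p2 - u2 * p1 \<noteq> 0"
  shows "g = 0 \<and> h = 0"
proof -
  have "g * (u1 * p2 - u2 * p1) = 0" "h * (u1 * p2 - u2 * p1) = 0" using assms(1,2) by algebra+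
  then show ?thesis using assms(3) by simp
qed

text \<open>The coordinates are solved block by block. The single coordinates give
  \<open>G 10\<close>, \<open>G 12\<close>, \<open>G 13\<close>, and the columns and rows give 2 by
  2 systems with determinant \<open>2 \<Delta>u\<close> or \<open>2 \<Delta>v\<close>.\<close>

lemma T_sym_independent:
  assumes nz: "\<Delta>u z \<noteq> 0" "\<Delta>v z \<noteq> 0" and zero: "(\<Sum>b<16. G b *\<^sub>C T_sym b z) = 0" and b: "b < 16"
  shows "G b = 0"
proof -
  have D: "z 4 * pc2 z - z 5 * pc1 z \<noteq> 0" "z 6 * rc2 z - z 7 * rc1 z \<noteq> 0"
    using nz by (simp_all add: det_pc det_rc)
  note eq = T_sym_coordinates[of G z, unfolded zero cvec_simps, symmetric]
  have G10: "G 10 = 0" using eq(16) by simp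
  have G12: "G 12 = 0" using eq(6) D by simp
  have G13: "G 13 = 0" using eq(7) D by simp
  have "G 1 = 0 \<and> G 6 = 0" by (rule solve2[OF eq(2,3) D(1)])
  moreover have "G 8 = 0 \<and> - G 11 = 0" 
    by (rule solve2[OF _ _ D(1)]) (use eq(12,13) in algebra)+
  moreover have a: "G 9 = 0 \<and> - G 14 = 0"
    by (rule solve2[OF _ _ D(2)]) (use eq(14,15) in algebra)+
  moreover have "G 2 - 2 * G 9 = 0 \<and> G 4 - 2 * G 14 = 0" by (rule solve2[OF eq(4,5) D(2)])
  \<comment> \<open>Cross-multiplying the two entries of a matrix row with \<open>z 6\<close> and
    \<open>z 7\<close> removes the part that is a column times \<open>v\<close>, and with it
    \<open>G 7\<close> and \<open>G 15\<close>.\<close>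
  moreover have c: "G 3 = 0 \<and> - G 5 = 0"
  proof (rule solve2[OF _ _ D(2)])
    show "G 3 * z 6 + - G 5 * rc1 z = 0" using eq(10,11) G10 unfolding rc1_def by algebra
    show "G 3 * z 7 + - G 5 * rc2 z = 0" using eq(8,9) G10 unfolding rc2_def by algebra
  qed
  moreover have d: "G 7 = 0 \<and> - G 15 = 0"
  proof (rule solve2[OF _ _ D(1)])
    have "z 6 \<noteq> 0 \<or> z 7 \<noteq> 0" using D(2) by auto
    then show "G 7 * z 4 + - G 15 * pc1 z = 0" "G 7 * z 5 + - G 15 * pc2 z = 0"
      using eq(8-11) c G10 by auto
  qed
  moreover have "G 0 = 0" using eq(1) d by simp
  ultimately show ?thesis using less_16_cases[OF b] G10 G12 G13 by auto
qed

section \<open>Invariant elements\<close>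

text \<open>Every element is a contraction of the families of \<open>families\<close>, possibly with
  the mixed matrix in between; this replaces a computation with arbitrary elements of
  \<open>K\<close>.\<close>

lemma Ad_UC_invariants:
  shows "Ad_UC k t_e = t_e" "Ad_UC k t_f = t_f" "Ad_UC k t_g = t_g" "Ad_UC k t_h = t_h" "Ad_UC k t_i = t_i"
    "Ad_UC k t_j = t_j"
    and "Ad_UC k ((\<iota> mE1 * \<iota> mF1 + \<iota> mE2 * \<iota> mF2) \<otimes>\<^sub>T 1) = (\<iota> mE1 * \<iota> mF1 + \<iota> mE2 * \<iota> mF2) \<otimes>\<^sub>T 1"
    and "Ad_UC k (((Lu11 * \<iota> mE1 + \<iota> mE * \<iota> mE2) * \<iota> mF1 + (\<iota> mF * \<iota> mE1 + Lu22 * \<iota> mE2) * \<iota> mF2) \<otimes>\<^sub>T 1)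
      = ((Lu11 * \<iota> mE1 + \<iota> mE * \<iota> mE2) * \<iota> mF1 + (\<iota> mF * \<iota> mE1 + Lu22 * \<iota> mE2) * \<iota> mF2) \<otimes>\<^sub>T 1"
    and "Ad_UC k ((Lu11 * Lu11 + \<iota> mE * \<iota> mF + (\<iota> mF * \<iota> mE + Lu22 * Lu22)) \<otimes>\<^sub>T 1)
      = (Lu11 * Lu11 + \<iota> mE * \<iota> mF + (\<iota> mF * \<iota> mE + Lu22 * Lu22)) \<otimes>\<^sub>T 1"
proof -
  note hom = k_hom_Ad_UC[OF refl refl refl refl refl, of k]
  note fam = families[OF refl refl refl refl refl, of k]
  have s: "cnj (Rep_Kgrp k $ 3 $ 3) * Rep_Kgrp k $ 3 $ 3 = 1" using Kgrp_unitary(2)[of k] by (simp add: mult.commute)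
  note inv = k_hom.invariant_cov_contra[OF hom _ _ s]
  note mcov = k_hom.mixed_cov[OF hom fam(5)] and mcontra = k_hom.mixed_contra[OF hom fam(5)]
  show "Ad_UC k t_e = t_e" using inv(2)[OF fam(2,3)] by (simp add: tens_mult t_e_def)
  show "Ad_UC k t_f = t_f" using inv(1)[OF fam(1,4)] by (simp add: tens_mult t_f_def)
  show "Ad_UC k t_g = t_g" using inv(1)[OF fam(2,4)] by (simp add: tens_mult t_g_def tens_simps)
  show "Ad_UC k ((\<iota> mE1 * \<iota> mF1 + \<iota> mE2 * \<iota> mF2) \<otimes>\<^sub>T 1) = (\<iota> mE1 * \<iota> mF1 + \<iota> mE2 * \<iota> mF2) \<otimes>\<^sub>T 1"
    using inv(1)[OF fam(1,3)] by (simp add: tens_mult tens_simps)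
  show "Ad_UC k (((Lu11 * \<iota> mE1 + \<iota> mE * \<iota> mE2) * \<iota> mF1 + (\<iota> mF * \<iota> mE1 + Lu22 * \<iota> mE2) * \<iota> mF2) \<otimes>\<^sub>T 1)
      = ((Lu11 * \<iota> mE1 + \<iota> mE * \<iota> mE2) * \<iota> mF1 + (\<iota> mF * \<iota> mE1 + Lu22 * \<iota> mE2) * \<iota> mF2) \<otimes>\<^sub>T 1"
    using inv(1)[OF mcov[OF fam(1)] fam(3)] by (simp add: tens_mult tens_simps distrib_left distrib_right)
  show "Ad_UC k ((Lu11 * Lu11 + \<iota> mE * \<iota> mF + (\<iota> mF * \<iota> mE + Lu22 * Lu22)) \<otimes>\<^sub>T 1)
      = (Lu11 * Lu11 + \<iota> mE * \<iota> mF + (\<iota> mF * \<iota> mE + Lu22 * Lu22)) \<otimes>\<^sub>T 1"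
    using k_hom.invariant_trace[OF hom k_hom.mixed_square[OF hom fam(5)]] by (simp add: tens_mult tens_simps)
  \<comment> \<open>The mixed matrix carries \<open>H / 2\<close> on its diagonal, so the remaining
    elements are twice a contraction.\<close>
  have two: "Ad_UC k x = x" if "x = 2 *\<^sub>C y" "Ad_UC k y = y" for x y
    using that by (simp add: Ad_UC_simps)
  note L = Lu11_def Lu22_def tens_mult tens_simps tens_diff tens_minus cscale_add_right cscale_diff_right cscale_cscale
    cscale_minus_left cscale_minus_right cscale_mult cscale_one distrib_left distrib_right
  show "Ad_UC k t_h = t_h"
    by (rule two[OF _ inv(1)[OF mcov[OF fam(1)] fam(4)]]) (simp add: t_h_def L algebra_simps)
  show "Ad_UC k t_i = t_i"
    by (rule two[OF _ inv(1)[OF mcov[OF fam(2)] fam(4)]]) (simp add: t_i_def L algebra_simps)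
  show "Ad_UC k t_j = t_j"
    by (rule two[OF _ inv(2)[OF fam(2) mcontra[OF fam(3)]]]) (simp add: t_j_def L algebra_simps)
qed

lemma Ad_UC_one: "Ad_UC k 1 = 1"
  using Ad_UC_tens[of k 1 1] by (simp add: Ad_one tens_one)

lemma Ad_UC_minus: "Ad_UC k (- x) = - Ad_UC k x"
  using Ad_UC_simps(3)[of k "- 1" x] by (simp add: cscale_minus_left cscale_one)

lemma UC_K_closed:
  "0 \<in> UC_K" "1 \<in> UC_K" "x \<in> UC_K \<Longrightarrow> y \<in> UC_K \<Longrightarrow> x + y \<in> UC_K" "x \<in> UC_K \<Longrightarrow> y \<in> UC_K \<Longrightarrow> x - y \<in> UC_K"
  "x \<in> UC_K \<Longrightarrow> y \<in> UC_K \<Longrightarrow> x * y \<in> UC_K"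
  using Ad_UC_simps(1)[of _ 0 0] Ad_UC_simps(1)[of _ x "- y"]
  by (auto simp: UC_K_def Ad_UC_simps Ad_UC_one Ad_UC_minus)

lemma UC_K_sum: "(\<And>i. i \<in> A \<Longrightarrow> f i \<in> UC_K) \<Longrightarrow> sum f A \<in> UC_K"
  by (induction A rule: infinite_finite_induct) (auto intro: UC_K_closed)

lemma Ug_K_closed:
  "0 \<in> Ug_K" "1 \<in> Ug_K" "x \<in> Ug_K \<Longrightarrow> y \<in> Ug_K \<Longrightarrow> x + y \<in> Ug_K" "x \<in> Ug_K \<Longrightarrow> z *\<^sub>C x \<in> Ug_K"
  "x \<in> Ug_K \<Longrightarrow> y \<in> Ug_K \<Longrightarrow> x * y \<in> Ug_K"
  by (auto simp: Ug_K_def Ad_U_simps Ad_one Ad_U_zero)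

lemma Ug_K_diff: "x \<in> Ug_K \<Longrightarrow> y \<in> Ug_K \<Longrightarrow> x - y \<in> Ug_K"
  using Ug_K_closed(3)[OF _ Ug_K_closed(4)[of y "- 1"], of x] by (simp add: cscale_minus_left cscale_one)

lemma T_elt_UC_K: "b < 16 \<Longrightarrow> T_elt b \<in> UC_K"
proof -
  assume b: "b < 16"
  have "t_e \<in> UC_K" "t_f \<in> UC_K" "t_g \<in> UC_K" "t_h \<in> UC_K" "t_i \<in> UC_K" "t_j \<in> UC_K"
    by (simp_all add: UC_K_def Ad_UC_invariants)
  then show ?thesis
    using less_16_cases[OF b]
    by (elim insertE emptyE) (simp_all add: T_elt_def power2_eq_square UC_K_closed)
qed

lemma U_act_UC_K: "u \<in> Ug_K \<Longrightarrow> x \<in> UC_K \<Longrightarrow> U_act u x \<in> UC_K"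
  by (auto simp: U_act_def UC_K_def Ug_K_def Ad_UC_simps Ad_UC_tens Ad_one)

lemma Ug_K_I:
  assumes "\<And>k. Ad_UC k (u \<otimes>\<^sub>T 1) = u \<otimes>\<^sub>T 1" shows "u \<in> Ug_K"
proof -
  have one: "cvec 1 o0 = 1" by (simp add: cvec_def Cp_act_simps vacuum_def)
  have "Ad_U k u = u" for k
    using arg_cong[OF assms[of k], of "tcoord o0"] by (simp add: Ad_UC_tens Ad_one tcoord_tens one cscale_one)
  then show ?thesis by (simp add: Ug_K_def)
qed

text \<open>\<open>mH1 + mH2\<close> is the diagonal matrix with entries 1/3, 1/3, -2/3 and commutes
  with block diagonal matrices.\<close>

lemma central_Ug_K: "\<iota> (mH1 + mH2) \<in> Ug_K"
proof -
  have "kconj k (mH1 + mH2) = mH1 + mH2" for k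
    using Kgrp_unitary[of k]
    unfolding mat3_eq_iff forall_3 kconj_def mult_nth_3 unitary2_def
    by (simp add: conj_transpose_def Rep_Kgrp_facts mH1_def mH2_def add_divide_distrib[symmetric] mult.assoc mult.commute)
  moreover have "trace (mH1 + mH2) = 0" by (simp add: trace_linear trace_zero_elements)
  ultimately show ?thesis by (simp add: Ug_K_def Ad_U_\<iota>)
qed

section \<open>Symbols of invariants\<close>

definition inv_sym :: "nat \<Rightarrow> (point \<Rightarrow> complex) set" where
  "inv_sym m = {g. \<exists>Z\<in>Ug_K \<inter> Ufil m. g = (\<lambda>z. Usym m Z (ymat z))}"

inductive_set inv_syms :: "(point \<Rightarrow> complex) set" where
  zero: "(\<lambda>z. 0) \<in> inv_syms"
| add: "h \<in> inv_sym m \<Longrightarrow> g \<in> inv_syms \<Longrightarrow> (\<lambda>z. h z + g z) \<in> inv_syms"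

lemma inv_symI: "Z \<in> Ug_K \<Longrightarrow> Z \<in> Ufil m \<Longrightarrow> (\<And>z. g z = Usym m Z (ymat z)) \<Longrightarrow> g \<in> inv_sym m"
  unfolding inv_sym_def by blast

lemma inv_sym_zero: "(\<lambda>z. 0) \<in> inv_sym m"
  by (rule inv_symI[OF Ug_K_closed(1) Ufil.zero]) (simp add: Usym_simps)

lemma inv_sym_add:
  assumes "g \<in> inv_sym m" "h \<in> inv_sym m" shows "(\<lambda>z. g z + h z) \<in> inv_sym m"
proof -
  obtain Y Z where "Y \<in> Ug_K" "Y \<in> Ufil m" "g = (\<lambda>z. Usym m Y (ymat z))"
    "Z \<in> Ug_K" "Z \<in> Ufil m" "h = (\<lambda>z. Usym m Z (ymat z))"
    using assms unfolding inv_sym_def by blast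
  then show ?thesis by (intro inv_symI[of "Y + Z"]) (simp_all add: Ug_K_closed Ufil_add Usym_simps)
qed

lemma inv_sym_mult:
  assumes "g \<in> inv_sym m" "h \<in> inv_sym n" shows "(\<lambda>z. g z * h z) \<in> inv_sym (m + n)"
proof -
  obtain Y Z where "Y \<in> Ug_K" "Y \<in> Ufil m" "g = (\<lambda>z. Usym m Y (ymat z))"
    "Z \<in> Ug_K" "Z \<in> Ufil n" "h = (\<lambda>z. Usym n Z (ymat z))"
    using assms unfolding inv_sym_def by blast
  then show ?thesis by (intro inv_symI[of "Y * Z"]) (simp_all add: Ug_K_closed Ufil_mult Usym_mult)
qed

lemma inv_syms_single: "h \<in> inv_sym m \<Longrightarrow> h \<in> inv_syms"
  using inv_syms.add[OF _ inv_syms.zero] by simp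

lemma inv_syms_add: "g \<in> inv_syms \<Longrightarrow> h \<in> inv_syms \<Longrightarrow> (\<lambda>z. g z + h z) \<in> inv_syms"
proof (induction rule: inv_syms.induct)
  case (add h' m g)
  then show ?case using inv_syms.add[of h' m "\<lambda>z. g z + h z"] by (simp add: add.assoc)
qed simp

lemma inv_syms_mult: "g \<in> inv_syms \<Longrightarrow> h \<in> inv_syms \<Longrightarrow> (\<lambda>z. g z * h z) \<in> inv_syms"
proof (induction rule: inv_syms.induct)
  case (add h' m g)
  have "(\<lambda>z. h' z * h z) \<in> inv_syms"
    using add(4)
  proof (induction rule: inv_syms.induct)
    case (add h'' n g')
    then show ?case
      using inv_syms.add[OF inv_sym_mult[OF \<open>h' \<in> inv_sym m\<close>, of h'' n], of "\<lambda>z. h' z * g' z"]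
      by (simp add: distrib_left)
  qed (simp add: inv_syms.zero)
  then show ?case using inv_syms_add[of "\<lambda>z. h' z * h z" "\<lambda>z. g z * h z"] add by (simp add: distrib_right)
qed (simp add: inv_syms.zero)

text \<open>Let \<open>A0 = A - (tr A) / 2\<close>. Invariant elements with symbols
  \<open>tr A\<close>, \<open>tr (A0 A0)\<close>, \<open>v u\<close> and \<open>v A0 u\<close> are
  at hand. The others follow from \<open>det A = (tr A)^2 / 4 - tr (A0 A0) / 2\<close> and
  \<open>v A u = v A0 u + (tr A) (v u) / 2\<close>.\<close>

lemma inv_pt_inv_sym: "(\<lambda>z. inv_pt z i) \<in> inv_syms"
proof -
  have 0: "(\<lambda>z. inv_pt z 0) \<in> inv_sym 1"
  proof (rule inv_symI)
    show "3 *\<^sub>C \<iota> (mH1 + mH2) \<in> Ug_K" by (intro Ug_K_closed central_Ug_K)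
    show "3 *\<^sub>C \<iota> (mH1 + mH2) \<in> Ufil 1" by (intro Ufil_scale \<iota>_Ufil)
    have "trace (mH1 + mH2) = 0" by (simp add: trace_linear trace_zero_elements)
    then show "inv_pt z 0 = Usym 1 (3 *\<^sub>C \<iota> (mH1 + mH2)) (ymat z)" for z
      by (simp only: Usym_simps Usym_\<iota>)
         (simp add: inv_pt_nth trace_3 mult_nth_3 ymat_def mH1_def mH2_def field_simps)
  qed
  have L: "Lu11 \<in> Ufil 1" "Lu22 \<in> Ufil 1" by (simp_all only: Lu11_def Lu22_def Ufil_scale \<iota>_Ufil)
  have sL: "Usym 1 Lu11 (ymat z) = (z 0 - z 3) / 2" "Usym 1 Lu22 (ymat z) = - (z 0 - z 3) / 2" for z
    by (simp_all only: Lu11_def Lu22_def Usym_simps Usym_elements) (simp_all add: field_simps)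
  have m2: "u * v \<in> Ufil 2" "Usym 2 (u * v) y = Usym 1 u y * Usym 1 v y" if "u \<in> Ufil 1" "v \<in> Ufil 1" for u v y
    using Ufil_mult[OF that] Usym_mult[OF that, of y] by (simp_all add: numeral_2_eq_2)
  have m3: "u * v \<in> Ufil 3" "Usym 3 (u * v) y = Usym 2 u y * Usym 1 v y" if "u \<in> Ufil 2" "v \<in> Ufil 1" for u v y
    using Ufil_mult[OF that] Usym_mult[OF that, of y] by (simp_all add: numeral_2_eq_2 numeral_3_eq_3)
  note inv = Ad_UC_invariants(7-9)[THEN Ug_K_I]
  let ?C = "Lu11 * Lu11 + \<iota> mE * \<iota> mF + (\<iota> mF * \<iota> mE + Lu22 * Lu22)"
  let ?B = "(Lu11 * \<iota> mE1 + \<iota> mE * \<iota> mE2) * \<iota> mF1 + (\<iota> mF * \<iota> mE1 + Lu22 * \<iota> mE2) * \<iota> mF2"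
  have C: "(\<lambda>z. (- 1 / 2) * Usym 2 ?C (ymat z)) \<in> inv_sym 2"
  proof (rule inv_symI)
    show "(- 1 / 2) *\<^sub>C ?C \<in> Ug_K" by (intro Ug_K_closed inv)
    show "(- 1 / 2) *\<^sub>C ?C \<in> Ufil 2" by (intro Ufil_scale Ufil_add m2 L \<iota>_Ufil)
  qed (simp add: Usym_simps)
  have const: "(\<lambda>z. c) \<in> inv_sym 0" for c
    by (rule inv_symI[of "c *\<^sub>C 1"]) (simp_all add: Ug_K_closed Ufil_scale Ufil_one Usym_simps Usym_one)
  have "(\<lambda>z. (1 / 4) * (inv_pt z 0 * inv_pt z 0)) \<in> inv_syms"
    by (intro inv_syms_mult inv_syms_single[OF 0] inv_syms_single[OF const])
  from inv_syms_add[OF this inv_syms_single[OF C]]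
  have "(\<lambda>z. 1 / 4 * (inv_pt z 0 * inv_pt z 0) + - 1 / 2 * Usym 2 ?C (ymat z)) \<in> inv_syms" .
  moreover have sC: "Usym 2 ?C (ymat z) = (z 0 - z 3) / 2 * ((z 0 - z 3) / 2) + z 2 * z 1
      + (z 1 * z 2 + - (z 0 - z 3) / 2 * (- (z 0 - z 3) / 2))" for z
    by (simp only: Usym_simps m2[OF \<iota>_Ufil \<iota>_Ufil] m2[OF L(1) L(1)] m2[OF L(2) L(2)] sL Usym_elements)
  have "(\<lambda>z. 1 / 4 * (inv_pt z 0 * inv_pt z 0) + - 1 / 2 * Usym 2 ?C (ymat z)) = (\<lambda>z. inv_pt z 1)"
    unfolding sC by (simp add: fun_eq_iff inv_pt_nth field_simps)
  ultimately have 1: "(\<lambda>z. inv_pt z 1) \<in> inv_syms" by simp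
  have 2: "(\<lambda>z. inv_pt z 2) \<in> inv_sym 2"
  proof (rule inv_symI)
    show "\<iota> mE1 * \<iota> mF1 + \<iota> mE2 * \<iota> mF2 \<in> Ug_K" by (rule inv)
    show "\<iota> mE1 * \<iota> mF1 + \<iota> mE2 * \<iota> mF2 \<in> Ufil 2" by (intro Ufil_add m2 \<iota>_Ufil)
    show "inv_pt z 2 = Usym 2 (\<iota> mE1 * \<iota> mF1 + \<iota> mE2 * \<iota> mF2) (ymat z)" for z
      by (simp only: Usym_simps m2[OF \<iota>_Ufil \<iota>_Ufil] Usym_elements inv_pt_nth)
  qed
  have B: "(\<lambda>z. Usym 3 ?B (ymat z)) \<in> inv_sym 3"
    by (rule inv_symI[OF inv(2)]) (intro Ufil_add m3 m2 L \<iota>_Ufil refl)+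
  have "(\<lambda>z. (1 / 2) * (inv_pt z 0 * inv_pt z 2)) \<in> inv_syms"
    by (intro inv_syms_mult inv_syms_single[OF 0] inv_syms_single[OF 2] inv_syms_single[OF const])
  then have 3: "(\<lambda>z. inv_pt z 3) \<in> inv_syms"
  proof -
    have sB: "Usym 3 ?B (ymat z) = ((z 0 - z 3) / 2 * z 6 + z 2 * z 7) * z 4 + (z 1 * z 6 + - (z 0 - z 3) / 2 * z 7) * z 5" for z
      by (simp only: Usym_simps m3[OF Ufil_add[OF m2(1)[OF L(1) \<iota>_Ufil] m2(1)[OF \<iota>_Ufil \<iota>_Ufil]] \<iota>_Ufil]
          m3[OF Ufil_add[OF m2(1)[OF \<iota>_Ufil \<iota>_Ufil] m2(1)[OF L(2) \<iota>_Ufil]] \<iota>_Ufil]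
          m2[OF \<iota>_Ufil \<iota>_Ufil] m2[OF L(1) \<iota>_Ufil] m2[OF L(2) \<iota>_Ufil] sL Usym_elements)
    have "(\<lambda>z. inv_pt z 3) = (\<lambda>z. 1 / 2 * (inv_pt z 0 * inv_pt z 2) + Usym 3 ?B (ymat z))"
      unfolding sB by (simp add: fun_eq_iff inv_pt_nth cov_defs field_simps)
    then show ?thesis
      using inv_syms_add[OF \<open>(\<lambda>z. (1 / 2) * (inv_pt z 0 * inv_pt z 2)) \<in> inv_syms\<close> inv_syms_single[OF B]] by simp
  qed
  show ?thesis
  proof (cases "i < 4")
    case True
    then show ?thesis
      unfolding less_4 using inv_syms_single[OF 0] 1 inv_syms_single[OF 2] 3 by auto
  qed (simp add: inv_pt_def inv_syms.zero)
qed

lemma inv_syms_PF: "F \<in> PF \<Longrightarrow> (\<lambda>z. F (inv_pt z)) \<in> inv_syms"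
proof (induction rule: PF.induct)
  case (const c)
  have "(\<lambda>z. c) \<in> inv_sym 0"
    by (rule inv_symI[of "c *\<^sub>C 1"]) (simp_all add: Ug_K_closed Ufil_scale Ufil_one Usym_simps Usym_one)
  then show ?case by (rule inv_syms_single)
qed (auto intro: inv_pt_inv_sym inv_syms_add inv_syms_mult)

lemma inv_syms_decompose:
  "g \<in> inv_syms \<Longrightarrow> \<exists>h N. (\<forall>m. h m \<in> inv_sym m) \<and> (\<forall>m>N. h m = (\<lambda>z. 0)) \<and> (\<forall>z. g z = (\<Sum>m\<le>N. h m z))"
proof (induction rule: inv_syms.induct)
  case zero
  show ?case by (rule exI[of _ "\<lambda>m z. 0"], rule exI[of _ 0]) (simp add: inv_sym_zero)
next
  case (add h0 m0 g)
  then obtain h N where h: "\<forall>m. h m \<in> inv_sym m" "\<forall>m>N. h m = (\<lambda>z. 0)" "\<forall>z. g z = (\<Sum>m\<le>N. h m z)" by blast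
  define h' where "h' = h(m0 := (\<lambda>z. h0 z + h m0 z))"
  define N' where "N' = max N m0"
  have "h0 z + g z = (\<Sum>m\<le>N'. h' m z)" for z
  proof -
    have "(\<Sum>m\<le>N. h m z) = (\<Sum>m\<le>N'. h m z)"
      by (rule sum.mono_neutral_left) (use h(2) in \<open>auto simp: N'_def\<close>)
    moreover have "(\<Sum>m\<le>N'. h' m z) = (\<Sum>m\<le>N'. h m z + (if m = m0 then h0 z else 0))"
      by (rule sum.cong) (auto simp: h'_def)
    ultimately show ?thesis using h(3) by (simp add: sum.distrib N'_def)
  qed
  moreover have "\<forall>m. h' m \<in> inv_sym m" using h(1) add(1) by (auto simp: h'_def intro: inv_sym_add)
  moreover have "\<forall>m>N'. h' m = (\<lambda>z. 0)" using h(2) by (auto simp: h'_def N'_def)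
  ultimately show ?case by blast
qed

section \<open>Spanning\<close>

lemma unitary2_det:
  "unitary2 a b c d \<Longrightarrow> (a * d - b * c) * (cnj a * cnj d - cnj c * cnj b) = 1"
proof -
  assume "unitary2 a b c d"
  moreover have "(a * d - b * c) * (cnj a * cnj d - cnj c * cnj b)
      = (a * cnj a + b * cnj b) * (c * cnj c + d * cnj d) - (a * cnj c + b * cnj d) * (c * cnj a + d * cnj b)"
    by (simp add: algebra_simps)
  ultimately show ?thesis by (simp add: unitary2_def)
qed

text \<open>Each block of coordinates is paired with \<open>\<lambda>\<close> or
  \<open>\<mu>\<close> in the form that the covariant lemmas expect. The coordinates of three
  letters form a row or column times a determinant; swapping the two entries and changing one sign
  turns a row with this factor into a column, and conversely.\<close>

lemma symbol_covariance:
  assumes x: "x \<in> UC_K" "x \<in> Tfil n" and u: "unitary2 a b c d"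
  defines "f \<equiv> \<lambda>i z. cvec (tsym n x (ymat z)) i"
  shows "(let w = u_act a b c d z in
      f o0 w = f o0 z \<and> f oall w = f oall z \<and>
      w 8 * f oE1 w + w 9 * f oE2 w = z 8 * f oE1 z + z 9 * f oE2 z \<and>
      w 10 * f oF1 w + w 11 * f oF2 w = z 10 * f oF1 z + z 11 * f oF2 z \<and>
      f oEE w * (w 6 * w 9 - w 7 * w 8) = f oEE z * (z 6 * z 9 - z 7 * z 8) \<and>
      f oFF w * (w 4 * w 11 - w 5 * w 10) = f oFF z * (z 4 * z 11 - z 5 * z 10) \<and>
      w 8 * (f o11 w * w 10 + f o12 w * w 11) + w 9 * (f o21 w * w 10 + f o22 w * w 11)
        = z 8 * (f o11 z * z 10 + f o12 z * z 11) + z 9 * (f o21 z * z 10 + f o22 z * z 11) \<and>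
      w 8 * f oEE2 w + w 9 * - f oEE1 w = z 8 * f oEE2 z + z 9 * - f oEE1 z \<and>
      w 10 * f oFF2 w + w 11 * - f oFF1 w = z 10 * f oFF2 z + z 11 * - f oFF1 z)"
proof -
  let ?w = "u_act a b c d z"
  obtain k where k: "kconj k (ymat z) = ymat ?w"
    and Ad: "Ad_C k (\<gamma> mE1) = a *\<^sub>C \<gamma> mE1 + c *\<^sub>C \<gamma> mE2" "Ad_C k (\<gamma> mE2) = b *\<^sub>C \<gamma> mE1 + d *\<^sub>C \<gamma> mE2"
    "Ad_C k (\<gamma> mF1) = cnj a *\<^sub>C \<gamma> mF1 + cnj c *\<^sub>C \<gamma> mF2" "Ad_C k (\<gamma> mF2) = cnj b *\<^sub>C \<gamma> mF1 + cnj d *\<^sub>C \<gamma> mF2"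
    using Kgrp_ymat[OF u] by blast
  have "tsym n x (ymat ?w) = Ad_C k (tsym n x (ymat z))"
    using tsym_Ad_UC[OF x(2), of k "ymat z"] x(1) by (simp add: UC_K_def k)
  then have fw: "f i ?w = cvec (Ad_C k (tsym n x (ymat z))) i" for i by (simp add: f_def)
  note f = cvec_Ad_C[OF Ad, of "tsym n x (ymat z)", folded fw, folded f_def]
  have fz: "cvec (tsym n x (ymat z)) i = f i z" for i by (simp add: f_def)
  note f = f[unfolded fz]
  let ?D = "a * d - b * c" and ?D' = "cnj a * cnj d - cnj c * cnj b"
  note D = unitary2_det[OF u]
  have D': "?D * y * (?D' * x) = y * x" "?D' * y * (?D * x) = y * x" for x y
    using D by (metis mult.assoc mult.commute mult_1)+
  have 1: "?w 8 * f oE1 ?w + ?w 9 * f oE2 ?w = z 8 * f oE1 z + z 9 * f oE2 z"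
    unfolding f gl_act_nth(9,10) by (rule contract[OF u])
  have 2: "?w 10 * f oF1 ?w + ?w 11 * f oF2 ?w = z 10 * f oF1 z + z 11 * f oF2 z"
    using contract[OF u, of "f oF1 z" "f oF2 z" "z 10" "z 11"] unfolding f gl_act_nth(11,12)
    by (simp only: mult.commute)
  have 3: "f oEE ?w * (?w 6 * ?w 9 - ?w 7 * ?w 8) = f oEE z * (z 6 * z 9 - z 7 * z 8)"
  proof -
    have "?w 6 * ?w 9 - ?w 7 * ?w 8 = ?D' * (z 6 * z 9 - z 7 * z 8)"
      unfolding gl_act_nth by (simp add: algebra_simps)
    then show ?thesis unfolding f(6) by (simp only: D')
  qed
  have 4: "f oFF ?w * (?w 4 * ?w 11 - ?w 5 * ?w 10) = f oFF z * (z 4 * z 11 - z 5 * z 10)"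
  proof -
    have "?w 4 * ?w 11 - ?w 5 * ?w 10 = ?D * (z 4 * z 11 - z 5 * z 10)"
      unfolding gl_act_nth by (simp add: algebra_simps)
    then show ?thesis unfolding f(7) by (simp only: D')
  qed
  have 5: "?w 8 * (f o11 ?w * ?w 10 + f o12 ?w * ?w 11) + ?w 9 * (f o21 ?w * ?w 10 + f o22 ?w * ?w 11)
      = z 8 * (f o11 z * z 10 + f o12 z * z 11) + z 9 * (f o21 z * z 10 + f o22 z * z 11)"
  proof -
    have "f o11 ?w * ?w 10 + f o12 ?w * ?w 11
        = a * (f o11 z * z 10 + f o12 z * z 11) + b * (f o21 z * z 10 + f o22 z * z 11)"
      unfolding f gl_act_nth(11,12) contract[OF u] by (simp add: algebra_simps)
    moreover have "f o21 ?w * ?w 10 + f o22 ?w * ?w 11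
        = c * (f o11 z * z 10 + f o12 z * z 11) + d * (f o21 z * z 10 + f o22 z * z 11)"
      unfolding f gl_act_nth(11,12) contract[OF u] by (simp add: algebra_simps)
    ultimately show ?thesis
      unfolding gl_act_nth(9,10) by (simp only: contract[OF u])
  qed
  have 6: "?w 8 * f oEE2 ?w + ?w 9 * - f oEE1 ?w = z 8 * f oEE2 z + z 9 * - f oEE1 z"
  proof -
    have "?w 8 * f oEE2 ?w + ?w 9 * - f oEE1 ?w = (?D * ?D') * (z 8 * f oEE2 z + z 9 * - f oEE1 z)"
      unfolding f gl_act_nth by (simp add: algebra_simps)
    then show ?thesis by (simp add: D)
  qed
  have 7: "?w 10 * f oFF2 ?w + ?w 11 * - f oFF1 ?w = z 10 * f oFF2 z + z 11 * - f oFF1 z"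
  proof -
    have "?w 10 * f oFF2 ?w + ?w 11 * - f oFF1 ?w = (?D * ?D') * (z 10 * f oFF2 z + z 11 * - f oFF1 z)"
      unfolding f gl_act_nth by (simp add: algebra_simps)
    then show ?thesis by (simp add: D)
  qed
  have 8: "f oall ?w = f oall z" unfolding f(16) D by simp
  show ?thesis unfolding Let_def by (intro conjI f(1) 8 1 2 3 4 5 6 7)
qed

lemma symbol_invariances:
  assumes x: "x \<in> UC_K" "x \<in> Tfil n"
  defines "f \<equiv> \<lambda>i z. cvec (tsym n x (ymat z)) i"
  shows "unitary_invariant (f o0)" "unitary_invariant (f oall)"
    "unitary_invariant (\<lambda>z. z 8 * f oE1 z + z 9 * f oE2 z)"
    "unitary_invariant (\<lambda>z. z 10 * f oF1 z + z 11 * f oF2 z)"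
    "unitary_invariant (\<lambda>z. f oEE z * (z 6 * z 9 - z 7 * z 8))"
    "unitary_invariant (\<lambda>z. f oFF z * (z 4 * z 11 - z 5 * z 10))"
    "unitary_invariant (\<lambda>z. z 8 * (f o11 z * z 10 + f o12 z * z 11) + z 9 * (f o21 z * z 10 + f o22 z * z 11))"
    "unitary_invariant (\<lambda>z. z 8 * f oEE2 z + z 9 * - f oEE1 z)"
    "unitary_invariant (\<lambda>z. z 10 * f oFF2 z + z 11 * - f oFF1 z)"
  unfolding unitary_invariant_def f_def
  by (intro allI impI, simp only: symbol_covariance[OF x, unfolded Let_def])+

lemma symbol_spanning:
  assumes x: "x \<in> UC_K" "x \<in> Tfil n"
  shows "\<exists>G. (\<forall>b<16. G b \<in> PF) \<and> (\<forall>z. tsym n x (ymat z) = (\<Sum>b<16. G b (inv_pt z) *\<^sub>C T_sym b z))"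
proof -
  define f where "f i z = cvec (tsym n x (ymat z)) i" for i z
  have U: "tcoord i x \<in> Ufil n" for i using x(2) unfolding Tfil_def by blast
  have f_eq: "f i = (\<lambda>z. Usym n (tcoord i x) (ymat z))" for i by (simp add: fun_eq_iff f_def cvec_tsym)
  have PF: "f i \<in> PF" for i unfolding f_eq by (rule PF_Usym[OF U])
  have dep: "depends8 (f i)" for i unfolding f_eq by (rule depends8_Usym)
  have mPF: "(\<lambda>z. - f i z) \<in> PF" and mdep: "depends8 (\<lambda>z. - f i z)" for i
    by (intro PF_uminus PF) (rule depends8_intros(7)[OF dep])
  note inv = symbol_invariances[OF x, folded f_def]
  obtain F0 where F0: "F0 \<in> PF" "\<And>z. f o0 z = F0 (inv_pt z)"
    using invariant_form[OF PF dep inv(1)] by blast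
  obtain F15 where F15: "F15 \<in> PF" "\<And>z. f oall z = F15 (inv_pt z)"
    using invariant_form[OF PF dep inv(2)] by blast
  obtain P1 P2 where P: "P1 \<in> PF" "P2 \<in> PF"
    "\<And>z. f oE1 z = P1 (inv_pt z) * z 4 + P2 (inv_pt z) * Au1 z"
    "\<And>z. f oE2 z = P1 (inv_pt z) * z 5 + P2 (inv_pt z) * Au2 z"
    using column_form[OF PF dep PF dep inv(3)] by blast
  obtain Q1 Q2 where Q: "Q1 \<in> PF" "Q2 \<in> PF"
    "\<And>z. f oF1 z = Q1 (inv_pt z) * z 6 + Q2 (inv_pt z) * vA1 z"
    "\<And>z. f oF2 z = Q1 (inv_pt z) * z 7 + Q2 (inv_pt z) * vA2 z"
    using row_form[OF PF dep PF dep inv(4)] by blast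
  obtain D1 where D1: "D1 \<in> PF" "\<And>z. f oEE z = D1 (inv_pt z) * \<Delta>u z"
    using det_form[OF PF dep inv(5)] by blast
  obtain D2 where D2: "D2 \<in> PF" "\<And>z. f oFF z = D2 (inv_pt z) * \<Delta>v z"
    using codet_form[OF PF dep inv(6)] by blast
  obtain M1 M2 M3 M4 where M: "M1 \<in> PF" "M2 \<in> PF" "M3 \<in> PF" "M4 \<in> PF"
    and m: "\<And>z. f o11 z = M1 (inv_pt z) + M2 (inv_pt z) * z 0 + M3 (inv_pt z) * (z 4 * z 6) + M4 (inv_pt z) * (Au1 z * z 6)"
    "\<And>z. f o12 z = M2 (inv_pt z) * z 1 + M3 (inv_pt z) * (z 4 * z 7) + M4 (inv_pt z) * (Au1 z * z 7)"
    "\<And>z. f o21 z = M2 (inv_pt z) * z 2 + M3 (inv_pt z) * (z 5 * z 6) + M4 (inv_pt z) * (Au2 z * z 6)"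
    "\<And>z. f o22 z = M1 (inv_pt z) + M2 (inv_pt z) * z 3 + M3 (inv_pt z) * (z 5 * z 7) + M4 (inv_pt z) * (Au2 z * z 7)"
    using matrix_form[OF PF PF PF PF dep dep dep dep inv(7)] by blast
  obtain R1 R2 where R: "R1 \<in> PF" "R2 \<in> PF"
    "\<And>z. f oEE2 z = R1 (inv_pt z) * z 4 + R2 (inv_pt z) * Au1 z"
    "\<And>z. - f oEE1 z = R1 (inv_pt z) * z 5 + R2 (inv_pt z) * Au2 z"
    using column_form[OF PF dep mPF mdep inv(8)] by blast
  obtain W1 W2 where W: "W1 \<in> PF" "W2 \<in> PF"
    "\<And>z. f oFF2 z = W1 (inv_pt z) * z 6 + W2 (inv_pt z) * vA1 z"
    "\<And>z. - f oFF1 z = W1 (inv_pt z) * z 7 + W2 (inv_pt z) * vA2 z"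
    using row_form[OF PF dep mPF mdep inv(9)] by blast
  have R4: "f oEE1 z = - (R1 (inv_pt z) * z 5 + R2 (inv_pt z) * Au2 z)" for z
    using R(4)[of z, symmetric] by simp
  have W4: "f oFF1 z = - (W1 (inv_pt z) * z 7 + W2 (inv_pt z) * vA2 z)" for z
    using W(4)[of z, symmetric] by simp
  \<comment> \<open>\<open>p u + q A u = (p + q (tr A) / 2) u + (q / 2) (2 A - tr A) u\<close>, so
    this is the coefficient of \<open>u\<close> after passing to the trace-free matrix.\<close>
  define H where "H p q \<tau> = p \<tau> + q \<tau> * \<tau> 0 * (1 / 2)" for p q :: "point \<Rightarrow> complex" and \<tau>
  have H: "H p q \<in> PF" if "p \<in> PF" "q \<in> PF" for p q
    unfolding H_def by (intro PF_intros that)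
  \<comment> \<open>The solution of \<open>T_sym_coordinates\<close>. The corrections in the entries
    0, 2, 3 and 4 undo the terms with fewer letters that normal ordering produces in the entries 15,
    9, 10 and 14.\<close>
  define Gs where "Gs = [\<lambda>\<tau>. F0 \<tau> + 2 * (2 * \<tau> 3 - \<tau> 0 * \<tau> 2) * (M4 \<tau> * (- 1 / 2)), H P1 P2,
     \<lambda>\<tau>. H Q1 Q2 \<tau> - 2 * H W1 W2 \<tau>, \<lambda>\<tau>. H M1 M2 \<tau> - F15 \<tau>, \<lambda>\<tau>. Q2 \<tau> * (1 / 2) + W2 \<tau>,
     \<lambda>\<tau>. M2 \<tau> * (1 / 2), \<lambda>\<tau>. P2 \<tau> * (1 / 2), H M3 M4, H R1 R2, \<lambda>\<tau>. - H W1 W2 \<tau>, \<lambda>\<tau>. F15 \<tau> * (- 1 / 2),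
     \<lambda>\<tau>. R2 \<tau> * (- 1 / 2), \<lambda>\<tau>. D1 \<tau> * (1 / 2), \<lambda>\<tau>. D2 \<tau> * (1 / 2), \<lambda>\<tau>. W2 \<tau> * (1 / 2), \<lambda>\<tau>. M4 \<tau> * (- 1 / 2)]"
  define G where "G b = Gs ! b" for b
  have "set Gs \<subseteq> PF"
    unfolding Gs_def list.set insert_subset by (intro conjI PF_intros H F0 F15 P Q D1 D2 M R W empty_subsetI)
  moreover have "length Gs = 16" by (simp add: Gs_def)
  ultimately have GPF: "G b \<in> PF" if "b < 16" for b
    using nth_mem[of b Gs] that by (auto simp: G_def)
  have "tsym n x (ymat z) = (\<Sum>b<16. G b (inv_pt z) *\<^sub>C T_sym b z)" for z
  proof (rule Cp_eqI)
    fix i :: occ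
    note rel = cov_defs pr_defs inv_pt_nth H_def
    obtain p q r s where i: "i = (p, q, r, s)" by (cases i)
    have "f (p, q, r, s) z = cvec (\<Sum>b<16. G b (inv_pt z) *\<^sub>C T_sym b z) (p, q, r, s)"
      by (cases p; cases q; cases r; cases s;
          simp only: T_sym_coordinates F0(2) F15(2) P(3,4) Q(3,4) D1(2) D2(2) m R(3) R4 W(3) W4;
          simp add: G_def Gs_def; simp add: rel field_simps)
    then show "cvec (tsym n x (ymat z)) i = cvec (\<Sum>b<16. G b (inv_pt z) *\<^sub>C T_sym b z) i"
      by (simp add: i f_def)
  qed
  then show ?thesis using GPF by blast
qed

lemma tsym_homogeneous:
  assumes "x \<in> Tfil n"
  shows "cvec (tsym n x (ymat (\<lambda>j. t * z j))) i = t ^ n * cvec (tsym n x (ymat z)) i"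
proof -
  have "tcoord i x \<in> Ufil n" using assms unfolding Tfil_def by blast
  then show ?thesis by (simp add: cvec_tsym Usym_homogeneous)
qed

lemma U_act_tsym:
  assumes "u \<in> Ufil m" "x \<in> Tfil n"
  shows "U_act u x \<in> Tfil (m + n)" "tsym (m + n) (U_act u x) y = Usym m u y *\<^sub>C tsym n x y"
  using Tfil_mult[OF Tfil_tens[OF assms(1), of 1] assms(2)]
  by (simp_all add: U_act_def tsym_tens cscale_mult)

lemma U_act_zero: "U_act 0 x = 0"
  by (simp add: U_act_def)

text \<open>Compare the coefficients of \<open>t ^ n\<close>. By \<open>zero\<close>, the value of
  \<open>h b\<close> at \<open>n - d b\<close> is right even if this exceeds the summation bound;
  summands with \<open>d b > n\<close> do not contribute.\<close>

lemma homogeneous_part: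
  fixes h :: "nat \<Rightarrow> nat \<Rightarrow> complex" and B :: "nat \<Rightarrow> complex" and d N :: "nat \<Rightarrow> nat"
  assumes eq: "\<And>t. t ^ n * a = (\<Sum>b<k. (\<Sum>m\<le>N b. t ^ m * h b m) * (t ^ d b * B b))"
    and zero: "\<And>b m. b < k \<Longrightarrow> N b < m \<Longrightarrow> h b m = 0"
  shows "a = (\<Sum>b<k. (if d b \<le> n then h b (n - d b) else 0) * B b)"
proof -
  define P where "P = (\<Sum>b<k. \<Sum>m\<le>N b. Polynomial.monom (h b m * B b) (m + d b)) - Polynomial.monom a n"
  have "poly P t = 0" for t
    using eq[of t] by (simp add: P_def poly_sum poly_monom sum_distrib_right sum_distrib_left power_add mult_ac)
  then have "P = 0" using poly_all_0_iff_0 by blast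
  then have "coeff P n = 0" by simp
  then have "a = (\<Sum>b<k. \<Sum>m\<le>N b. if m + d b = n then h b m * B b else 0)"
    by (simp add: P_def coeff_sum)
  also have "\<dots> = (\<Sum>b<k. (if d b \<le> n then h b (n - d b) else 0) * B b)"
  proof (rule sum.cong[OF refl])
    fix b assume b: "b \<in> {..<k}"
    show "(\<Sum>m\<le>N b. if m + d b = n then h b m * B b else 0) = (if d b \<le> n then h b (n - d b) else 0) * B b"
    proof (cases "d b \<le> n")
      case True
      then have "(\<Sum>m\<le>N b. if m + d b = n then h b m * B b else 0) = (\<Sum>m\<le>N b. if m = n - d b then h b m * B b else 0)"
        by (intro sum.cong) auto
      also have "\<dots> = (if n - d b \<le> N b then h b (n - d b) * B b else 0)" by simp
      finally show ?thesis using True zero[of b "n - d b"] b by auto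
    qed (auto intro!: sum.neutral)
  qed
  finally show ?thesis .
qed

text \<open>Once its coefficients are symbols of invariants, the expansion of the symbol of
  \<open>x\<close> lifts to a combination of the \<open>T_elt b\<close> over
  \<open>U(\<gg>)\<^sup>K\<close>; subtracting it lowers the degree.\<close>

lemma leading_term:
  assumes x: "x \<in> UC_K" "x \<in> Tfil n"
  shows "\<exists>Z. (\<forall>b<16. Z b \<in> Ug_K) \<and> (\<forall>i. tcoord i (x - (\<Sum>b<16. U_act (Z b) (T_elt b))) \<in> Ulow n)"
proof -
  obtain G where G: "\<And>b. b < 16 \<Longrightarrow> G b \<in> PF"
    and sym: "\<And>z. tsym n x (ymat z) = (\<Sum>b<16. G b (inv_pt z) *\<^sub>C T_sym b z)"
    using symbol_spanning[OF x] by blast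
  have "\<forall>b\<in>{..<16}. \<exists>hN. (\<forall>m. fst hN m \<in> inv_sym m) \<and> (\<forall>m>snd hN. fst hN m = (\<lambda>z. 0)) \<and>
      (\<forall>z. G b (inv_pt z) = (\<Sum>m\<le>snd hN. fst hN m z))"
    using inv_syms_decompose[OF inv_syms_PF[OF G]] by fastforce
  from bchoice[OF this] obtain hN where hN: "\<And>b. b < 16 \<Longrightarrow> (\<forall>m. fst (hN b) m \<in> inv_sym m) \<and>
      (\<forall>m>snd (hN b). fst (hN b) m = (\<lambda>z. 0)) \<and> (\<forall>z. G b (inv_pt z) = (\<Sum>m\<le>snd (hN b). fst (hN b) m z))"
    by blast
  define h where "h b = fst (hN b)" for b
  define N where "N b = snd (hN b)" for b
  have h: "h b m \<in> inv_sym m" "N b < m \<Longrightarrow> h b m = (\<lambda>z. 0)" "G b (inv_pt z) = (\<Sum>m\<le>N b. h b m z)" if "b < 16" for b m z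
    using hN[OF that] by (auto simp: h_def N_def)
  have hom: "h b m (\<lambda>j. t * z j) = t ^ m * h b m z" if b: "b < 16" for b m t z
    using h(1)[OF b, of m] by (auto simp: inv_sym_def Usym_homogeneous)
  have Thom: "cvec (T_sym b (\<lambda>j. t * z j)) i = t ^ T_deg b * cvec (T_sym b z) i" if "b < 16" for b t z i
    using T_elt_Tfil_tsym[OF that] tsym_homogeneous[of "T_elt b" "T_deg b" t z i] by simp
  \<comment> \<open>The symbol of \<open>x\<close> and the symbols \<open>T_sym b\<close> are
    homogeneous, so only the component of degree \<open>n - T_deg b\<close> of each coefficient
    matters.\<close>
  have lead: "tsym n x (ymat z) = (\<Sum>b<16. (if T_deg b \<le> n then h b (n - T_deg b) z else 0) *\<^sub>C T_sym b z)" for z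
  proof (rule Cp_eqI)
    fix i
    have "cvec (tsym n x (ymat z)) i = (\<Sum>b<16. (if T_deg b \<le> n then h b (n - T_deg b) z else 0) * cvec (T_sym b z) i)"
    proof (rule homogeneous_part)
      fix t
      have "t ^ n * cvec (tsym n x (ymat z)) i = cvec (tsym n x (ymat (\<lambda>j. t * z j))) i"
        by (simp add: tsym_homogeneous[OF x(2)])
      also have "\<dots> = (\<Sum>b<16. G b (inv_pt (\<lambda>j. t * z j)) * cvec (T_sym b (\<lambda>j. t * z j)) i)"
        by (simp add: sym cvec_sum cvec_simps)
      also have "\<dots> = (\<Sum>b<16. (\<Sum>m\<le>N b. t ^ m * h b m z) * (t ^ T_deg b * cvec (T_sym b z) i))"
        by (rule sum.cong) (simp_all add: h(3) hom Thom)
      finally show "t ^ n * cvec (tsym n x (ymat z)) i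
          = (\<Sum>b<16. (\<Sum>m\<le>N b. t ^ m * h b m z) * (t ^ T_deg b * cvec (T_sym b z) i))" .
    qed (simp add: h(2))
    then show "cvec (tsym n x (ymat z)) i
        = cvec (\<Sum>b<16. (if T_deg b \<le> n then h b (n - T_deg b) z else 0) *\<^sub>C T_sym b z) i"
      by (simp add: cvec_sum cvec_simps)
  qed
  \<comment> \<open>For \<open>T_deg b > n\<close> the coefficient must be 0, since truncated
    subtraction would otherwise assign it degree 0 and the product could leave
    \<open>Tfil n\<close>.\<close>
  have "\<exists>Y\<in>Ug_K. if T_deg b \<le> n then Y \<in> Ufil (n - T_deg b) \<and> (\<forall>z. h b (n - T_deg b) z = Usym (n - T_deg b) Y (ymat z))
      else Y = 0" if "b < 16" for b
    using h(1)[OF that, of "n - T_deg b"] Ug_K_closed(1) by (cases "T_deg b \<le> n") (auto simp: inv_sym_def)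
  then have "\<forall>b\<in>{..<16}. \<exists>Y. Y \<in> Ug_K \<and> (if T_deg b \<le> n then Y \<in> Ufil (n - T_deg b) \<and> (\<forall>z. h b (n - T_deg b) z = Usym (n - T_deg b) Y (ymat z))
      else Y = 0)" by blast
  from bchoice[OF this] obtain Z where Z: "\<And>b. b < 16 \<Longrightarrow> Z b \<in> Ug_K"
    "\<And>b. b < 16 \<Longrightarrow> T_deg b \<le> n \<Longrightarrow> Z b \<in> Ufil (n - T_deg b)"
    "\<And>b z. b < 16 \<Longrightarrow> T_deg b \<le> n \<Longrightarrow> h b (n - T_deg b) z = Usym (n - T_deg b) (Z b) (ymat z)"
    "\<And>b. b < 16 \<Longrightarrow> \<not> T_deg b \<le> n \<Longrightarrow> Z b = 0"
    by (auto split: if_splits)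
  let ?s = "\<Sum>b<16. U_act (Z b) (T_elt b)"
  have act: "U_act (Z b) (T_elt b) \<in> Tfil n \<and>
      tsym n (U_act (Z b) (T_elt b)) (ymat z) = (if T_deg b \<le> n then h b (n - T_deg b) z else 0) *\<^sub>C T_sym b z"
    if b: "b < 16" for b z
  proof (cases "T_deg b \<le> n")
    case True
    have T: "T_elt b \<in> Tfil (T_deg b)" "tsym (T_deg b) (T_elt b) (ymat z) = T_sym b z"
      using T_elt_Tfil_tsym[OF b] by auto
    show ?thesis
      using U_act_tsym(1)[OF Z(2)[OF b True] T(1)] U_act_tsym(2)[OF Z(2)[OF b True] T(1), of "ymat z"] True
      by (simp add: T(2) Z(3)[OF b True])
  next
    case False
    then show ?thesis using Z(4)[OF b] by (simp add: U_act_zero Tfil_closed tsym_simps)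
  qed
  have "x - ?s \<in> Tfil n" using act by (intro Tfil_closed x Tfil_sum) auto
  moreover have "tsym n (x - ?s) (ymat z) = 0" for z
    using act by (simp add: tsym_simps tsym_sum lead)
  ultimately have "tcoord i (x - ?s) \<in> Ulow n" for i by (rule tsym_eq_0_imp_low)
  then show ?thesis using Z(1) by blast
qed

text \<open>Induction on the filtration degree. Shifting it by one through \<open>Ulow\<close> makes
  the base case the zero element.\<close>

lemma T_elt_span:
  assumes "x \<in> UC_K"
  shows "\<exists>c. (\<forall>b<16. c b \<in> Ug_K) \<and> x = (\<Sum>b<16. U_act (c b) (T_elt b))"
proof -
  have "\<exists>c. (\<forall>b<16. c b \<in> Ug_K) \<and> x = (\<Sum>b<16. U_act (c b) (T_elt b))"
    if "x \<in> UC_K" "\<forall>i. tcoord i x \<in> Ulow n" for n x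
    using that
  proof (induction n arbitrary: x)
    case 0
    then have "x = 0" by (intro tensor_eq_0I) (metis Ulow_simps(1) singletonD)
    then show ?case by (intro exI[of _ "\<lambda>b. 0"]) (simp add: U_act_zero Ug_K_closed)
  next
    case (Suc n)
    then have "x \<in> Tfil n" unfolding Tfil_def Ulow_simps by blast
    then obtain Z where Z: "\<And>b. b < 16 \<Longrightarrow> Z b \<in> Ug_K"
      "\<forall>i. tcoord i (x - (\<Sum>b<16. U_act (Z b) (T_elt b))) \<in> Ulow n"
      using leading_term[OF Suc.prems(1)] by blast
    have "x - (\<Sum>b<16. U_act (Z b) (T_elt b)) \<in> UC_K"
      by (intro UC_K_closed Suc.prems(1) UC_K_sum U_act_UC_K Z T_elt_UC_K) auto
    from Suc.IH[OF this Z(2)] obtain c where c: "\<And>b. b < 16 \<Longrightarrow> c b \<in> Ug_K"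
      "x - (\<Sum>b<16. U_act (Z b) (T_elt b)) = (\<Sum>b<16. U_act (c b) (T_elt b))" by blast
    then have "x = (\<Sum>b<16. U_act (c b) (T_elt b)) + (\<Sum>b<16. U_act (Z b) (T_elt b))"
      by (simp add: diff_eq_eq)
    also have "\<dots> = (\<Sum>b<16. U_act (c b + Z b) (T_elt b))"
      by (simp add: U_act_def tens_simps distrib_right sum.distrib)
    finally show ?case using Z(1) c(1) by (intro exI[of _ "\<lambda>b. c b + Z b"]) (simp add: Ug_K_closed)
  qed
  moreover obtain n where "x \<in> Tfil n" using Tfil_exists by blast
  then have "\<forall>i. tcoord i x \<in> Ulow (Suc n)" unfolding Tfil_def Ulow_simps by blast
  ultimately show ?thesis using assms by blast
qed

section \<open>Independence\<close>

text \<open>Descent on a common degree bound: the top symbols of the coefficients satisfy a linear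
  relation between the \<open>T_sym b\<close>. They vanish where \<open>\<Delta>u\<close> and
  \<open>\<Delta>v\<close> are nonzero, hence everywhere by density, so every coefficient drops one
  degree.\<close>

lemma T_elt_independent:
  assumes zero: "(\<Sum>b<16. U_act (c b) (T_elt b)) = 0" and b: "b < 16"
  shows "c b = 0"
proof -
  have step: "\<forall>b<16. c b \<in> Ulow (n - T_deg b)" if prev: "\<forall>b<16. c b \<in> Ulow (Suc n - T_deg b)" for n
  proof -
    have fil: "c b \<in> Ufil (n - T_deg b)" if "b < 16" "T_deg b \<le> n" for b
      using prev that by (auto simp: Suc_diff_le)
    have nil: "c b = 0" if "b < 16" "\<not> T_deg b \<le> n" for b
      using prev that by (metis Ulow_simps(1) diff_is_0_eq not_less_eq_eq singletonD)
    define g where "g b z = (if T_deg b \<le> n then Usym (n - T_deg b) (c b) (ymat z) else 0)" for b z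
    have act: "tsym n (U_act (c b) (T_elt b)) (ymat z) = g b z *\<^sub>C T_sym b z" if b: "b < 16" for b z
    proof (cases "T_deg b \<le> n")
      case True
      have T: "T_elt b \<in> Tfil (T_deg b)" "tsym (T_deg b) (T_elt b) (ymat z) = T_sym b z"
        using T_elt_Tfil_tsym[OF b] by auto
      show ?thesis
        using U_act_tsym(2)[OF fil[OF b True] T(1), of "ymat z"] True by (simp add: T(2) g_def)
    qed (simp add: g_def nil b U_act_zero tsym_simps)
    have sum: "(\<Sum>b<16. g b z *\<^sub>C T_sym b z) = 0" for z
    proof -
      have "(\<Sum>b<16. g b z *\<^sub>C T_sym b z) = tsym n (\<Sum>b<16. U_act (c b) (T_elt b)) (ymat z)"
        by (simp add: tsym_sum act)
      then show ?thesis by (simp add: zero tsym_simps)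
    qed
    show ?thesis
    proof (intro allI impI)
      fix b :: nat assume b: "b < 16"
      show "c b \<in> Ulow (n - T_deg b)"
      proof (cases "T_deg b \<le> n")
        case True
        have "Usym (n - T_deg b) (c b) (ymat z) = 0" for z
        proof (rule PF_zero_dense[OF PF_Usym[OF fil[OF b True]]])
          show "(\<lambda>z. \<Delta>u z * \<Delta>v z) \<in> PF" by (intro PF_intros PF_cov)
          \<comment> \<open>The point \<open>A = diag (0, 1)\<close> with \<open>u\<close> and
            \<open>v\<close> both \<open>(1, 1)\<close>.\<close>
          show "\<Delta>u ((\<lambda>j. 0)(3 := 1, 4 := 1, 5 := 1, 6 := 1, 7 := 1)) * \<Delta>v ((\<lambda>j. 0)(3 := 1, 4 := 1, 5 := 1, 6 := 1, 7 := 1)) \<noteq> 0"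
            by (simp add: cov_defs)
          show "Usym (n - T_deg b) (c b) (ymat z) = 0" if "\<Delta>u z * \<Delta>v z \<noteq> 0" for z
            using T_sym_independent[OF _ _ sum[of z] b] that True by (simp add: g_def)
        qed
        then show ?thesis by (rule Usym_eq_0_imp_Ulow[OF fil[OF b True]])
      qed (simp add: nil b Ulow_closed)
    qed
  qed
  \<comment> \<open>At the end all indices are 0 by truncation, and \<open>Ulow 0\<close> contains
    only zero.\<close>
  have down: "\<forall>b<16. c b \<in> Ulow (n - T_deg b) \<Longrightarrow> \<forall>b<16. c b \<in> Ulow (0 - T_deg b)" for n
    by (induction n) (auto dest: step)
  define e where "e b = (SOME n. c b \<in> Ufil n)" for b
  have e: "c b \<in> Ufil (e b)" for b unfolding e_def by (rule someI_ex[OF Ufil_exists])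
  \<comment> \<open>The sum is a crude bound that dominates \<open>e b + T_deg b\<close> for all
    \<open>b\<close> at once.\<close>
  define n where "n = Suc (\<Sum>b<16. e b + T_deg b)"
  have "\<forall>b<16. c b \<in> Ulow (n - T_deg b)"
  proof (intro allI impI)
    fix b :: nat assume "b < 16"
    then have "e b + T_deg b \<le> (\<Sum>b<16. e b + T_deg b)" by (intro member_le_sum) auto
    then have "n - T_deg b = Suc ((\<Sum>b<16. e b + T_deg b) - T_deg b)"
      and "e b \<le> (\<Sum>b<16. e b + T_deg b) - T_deg b" by (auto simp: n_def)
    then show "c b \<in> Ulow (n - T_deg b)" using Ufil_mono[OF e] by simp
  qed
  from down[OF this] b show ?thesis by auto
qed

lemma Ug_one_neq_zero: "(1 :: Ug) \<noteq> 0"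
  using Usym_one[of 0] by (metis Usym_simps(4) zero_neq_one)

text \<open>The rank needs sixteen different elements. A repetition would be a relation with
  coefficients 1 and -1, and 1 is nonzero in \<open>U(\<gg>)\<close> because its symbol is.\<close>

lemma T_elt_inj: "inj_on T_elt {..<16}"
proof (rule inj_onI, rule ccontr)
  fix i j :: nat assume ij: "i \<in> {..<16}" "j \<in> {..<16}" "T_elt i = T_elt j" "i \<noteq> j"
  define c where "c = (\<lambda>b. if b = i then 1 else if b = j then - 1 else (0 :: Ug))"
  have "(\<Sum>b<16. U_act (c b) (T_elt b)) = (\<Sum>b\<in>{i, j}. U_act (c b) (T_elt b))"
    by (rule sum.mono_neutral_right) (use ij in \<open>auto simp: c_def U_act_zero\<close>)
  also have "\<dots> = 0"
    using ij by (simp add: c_def U_act_def tens_one tens_minus)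
  finally have "c i = 0" using ij by (intro T_elt_independent) auto
  then show False using Ug_one_neq_zero by (simp add: c_def)
qed

lemma T_set_basis: "left_module_basis Ug_K U_act UC_K T_set"
  unfolding left_module_basis_def
proof (intro conjI ballI allI impI)
  show "T_set \<subseteq> UC_K" using T_elt_UC_K by (auto simp: T_set_eq)
next
  fix x assume "x \<in> UC_K"
  then obtain c where c: "\<And>b. b < 16 \<Longrightarrow> c b \<in> Ug_K" "x = (\<Sum>b<16. U_act (c b) (T_elt b))"
    using T_elt_span by blast
  let ?i = "the_inv_into {..<16} T_elt"
  have i: "?i (T_elt b) = b" if "b < 16" for b
    using the_inv_into_f_f[OF T_elt_inj] that by simp
  have "x = (\<Sum>s\<in>T_set. U_act (c (?i s)) s)"
    unfolding T_set_eq by (simp add: sum.reindex[OF T_elt_inj] c(2) i)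
  moreover have "\<forall>s\<in>T_set. c (?i s) \<in> Ug_K" using c(1) i by (auto simp: T_set_eq)
  ultimately show "\<exists>S c. finite S \<and> S \<subseteq> T_set \<and> (\<forall>b\<in>S. c b \<in> Ug_K) \<and> x = (\<Sum>b\<in>S. U_act (c b) b)"
    by (intro exI[of _ T_set] exI[of _ "\<lambda>s. c (?i s)"]) (simp add: T_set_eq)
next
  fix S c s
  assume S: "finite S \<and> S \<subseteq> T_set \<and> (\<forall>b\<in>S. c b \<in> Ug_K) \<and> (\<Sum>b\<in>S. U_act (c b) b) = 0" and s: "s \<in> S"
  \<comment> \<open>A relation over a subset \<open>S\<close> becomes one over all sixteen indices
    by extending the coefficients by 0.\<close>
  define c' where "c' = (\<lambda>b. if T_elt b \<in> S then c (T_elt b) else 0)"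
  have "(\<Sum>b<16. U_act (c' b) (T_elt b)) = (\<Sum>s\<in>T_set. U_act (if s \<in> S then c s else 0) s)"
    unfolding T_set_eq by (simp add: sum.reindex[OF T_elt_inj] c'_def)
  also have "\<dots> = (\<Sum>s\<in>S. U_act (if s \<in> S then c s else 0) s)"
    using S by (intro sum.mono_neutral_right) (auto simp: T_set_eq U_act_zero)
  also have "\<dots> = 0" using S by simp
  finally have *: "c' b = 0" if "b < 16" for b using T_elt_independent that by blast
  obtain b where "b < 16" "s = T_elt b" using s S by (auto simp: T_set_eq)
  then show "c s = 0" using *[of b] s by (simp add: c'_def)
qed

lemma UC_K_module: "left_module_on Ug_K U_act UC_K"
  unfolding left_module_on_def unital_subring_def
proof (intro conjI ballI)
  show "U_act (r * s) x = U_act r (U_act s x)" for r s x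
    by (simp add: U_act_def tens_mult flip: mult.assoc)
qed (auto simp: Ug_K_closed Ug_K_diff UC_K_closed U_act_UC_K, auto simp: U_act_def tens_simps tens_one distrib_left distrib_right)

theorem corollary4p5:
  shows "free_left_module_of_rank Ug_K U_act UC_K 16 \<and>
         left_module_basis Ug_K U_act UC_K T_set \<and>
         card T_set = 16"
proof -
  have "card T_set = 16" by (simp add: T_set_eq card_image[OF T_elt_inj])
  moreover have "finite T_set" by (simp add: T_set_eq)
  ultimately show ?thesis
    using T_set_basis UC_K_module unfolding free_left_module_of_rank_def by blast
qed

end
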